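(* Let $C_1,C_2\in\mathbb{Z}^{n\times m}$ be non defective regular integer matrices (of full rank $m$, without zero rows) such that $C_1=C_2\cdot M$ for a square matrix $M\in\mathbb{Z}^{m\times m}$. Then there exists $v\in\mathbb{Z}^m$ lying in the lattice $\mathbb{Z}M$ spanned by the columns of $M$ (or equivalently, satisfying $\varepsilon^v=1$ for all $\varepsilon\in G_M$) such that, in the Laurent polynomial ring $\mathbb{C}[y_1^{\pm1},\dots,y_m^{\pm1}]$ and up to sign, $$\Delta_{C_1}\circ\alpha_M(y)=y^v\prod_{\varepsilon\in G_M}\Delta_{C_2}(\varepsilon\cdot y).$$
   Context: Let $C=(c_{i,k})\in\mathbb{Z}^{n\times m}$, $n\ge m$, with rows $C_1,\dots,C_n$, none of which is zero. $C$ is regular if its row vectors sum to $0$. Put $l_i(u)=\sum_{k=1}^m c_{i,k}u_k$. For regular $C$ of rank $m$, $\psi_C:\mathbb{P}^{m-1}\dashrightarrow\mathbb{C}^m$ is the rational map $u\mapsto(y_1,\dots,y_m)$ with $y_k=\prod_{i=1}^n l_i(u)^{c_{i,k}}$ (homogeneous of degree $0$), and $S_C\subset\mathbb{C}^m$ is the Zariski closure of its image. $C$ is non defective if $S_C$ is a hypersurface (codimension $1$). In that case $\Delta_C\in\mathbb{Z}[y_1,\dots,y_m]$ denotes the irreducible equation of $S_C$, normalized to have integer coefficients of content $1$; it is thus defined up to sign, and identities involving these polynomials are understood up to sign. For $M=(M_{ij})\in\mathbb{Z}^{m\times m}$ with columns $M^{(1)},\dots,M^{(m)}$, the monomial map $\alpha_M:(\mathbb{C}^*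 )^m\to(\mathbb{C}^* )^m$ is $\alpha_M(y)=(y^{M^{(1)}},\dots,y^{M^{(m)}})=\left(\prod_{i=1}^m y_i^{M_{i,1}},\dots,\prod_{i=1}^m y_i^{M_{i,m}}\right)$, where $y^w=y_1^{w_1}\cdots y_m^{w_m}$ for $w\in\mathbb{Z}^m$. $G_M=\{\varepsilon\in(\mathbb{C}^* )^m:\alpha_M(\varepsilon)=(1,\dots,1)\}$, a multiplicative group under coordinatewise multiplication, and $\varepsilon\cdot y$ denotes coordinatewise multiplication. *)

theory Defs
  imports "HOL-Analysis.Analysis" "HOL-Library.Poly_Mapping"
    "HOL-Computational_Algebra.Factorial_Ring"
begin

text \<open>Exponent vectors are elements of \<open>nat ^ 'm\<close> and \<open>int ^ 'm\<close>; the ring structure is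
  the convolution product of \<open>Poly_Mapping\<close>.\<close>

type_synonym ('r, 'm) mpoly = "(nat, 'm) vec \<Rightarrow>\<^sub>0 'r"
type_synonym 'm laurent = "(int, 'm) vec \<Rightarrow>\<^sub>0 complex"

text \<open>The value of a polynomial over a commutative ring at a point with coordinates in that ring.
  With the Laurent polynomial ring as \<open>'r\<close> this is substitution of Laurent polynomials.\<close>

definition mpoly_eval :: "'r::comm_ring_1 ^ 'm::finite \<Rightarrow> ('r, 'm) mpoly \<Rightarrow> 'r" where
  "mpoly_eval y p =
     (\<Sum>a\<in>Poly_Mapping.keys p. Poly_Mapping.lookup p a * (\<Prod>k\<in>UNIV. (y $ k) ^ (a $ k)))"

definition of_int_mpoly :: "(int, 'm::finite) mpoly \<Rightarrow> ('r::comm_ring_1, 'm) mpoly" where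
  "of_int_mpoly D = Poly_Mapping.map of_int D"

definition content :: "(int, 'm::finite) mpoly \<Rightarrow> int" where
  "content D = Gcd (Poly_Mapping.lookup D ` Poly_Mapping.keys D)"

definition laurent_const :: "complex \<Rightarrow> 'm::finite laurent" where
  "laurent_const c = Poly_Mapping.single 0 c"

definition laurent_monom :: "int ^ 'm::finite \<Rightarrow> 'm laurent" where
  "laurent_monom v = Poly_Mapping.single v 1"

definition zero_locus :: "(complex, 'm::finite) mpoly set \<Rightarrow> (complex ^ 'm) set" where
  "zero_locus P = {y. \<forall>p\<in>P. mpoly_eval y p = 0}"

definition zariski_closed :: "(complex ^ 'm::finite) set \<Rightarrow> bool" where
  "zariski_closed X \<longleftrightarrow> (\<exists>P. X = zero_locus P)"

definition zariski_closure :: "(complex ^ 'm::finite) set \<Rightarrow> (complex ^ 'm) set" where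
  "zariski_closure A = zariski_closed hull A"

definition hypersurface :: "(complex ^ 'm::finite) set \<Rightarrow> bool" where
  "hypersurface X \<longleftrightarrow> (\<exists>f. \<not> Poly_Mapping.keys f \<subseteq> {0} \<and> X = zero_locus {f})"

text \<open>The irreducible equation of \<open>X\<close> with integer coefficients of content 1. It is determined
  by \<open>X\<close> only up to sign, hence a predicate. Irreducibility is over the complex numbers.\<close>

definition irreducible_equation ::
    "(complex ^ 'm::finite) set \<Rightarrow> (int, 'm) mpoly \<Rightarrow> bool" where
  "irreducible_equation X D \<longleftrightarrow>
     irreducible (of_int_mpoly D :: (complex, 'm) mpoly) \<and>
     X = zero_locus {of_int_mpoly D} \<and>
     content D = 1"

definition regular :: "int ^ 'm::finite ^ 'n::finite \<Rightarrow> bool" where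
  "regular C \<longleftrightarrow> (\<Sum>i\<in>UNIV. row i C) = 0"

definition lin_form :: "int ^ 'm::finite ^ 'n::finite \<Rightarrow> 'n \<Rightarrow> complex ^ 'm \<Rightarrow> complex" where
  "lin_form C i u = (\<Sum>k\<in>UNIV. of_int (C $ i $ k) * u $ k)"

text \<open>\<open>psi\<close> is written in homogeneous coordinates. It is used only on the dense open subset of
  projective space on which no linear form vanishes, so that all the powers are meaningful.\<close>

definition psi :: "int ^ 'm::finite ^ 'n::finite \<Rightarrow> complex ^ 'm \<Rightarrow> complex ^ 'm" where
  "psi C u = (\<chi> k. \<Prod>i\<in>UNIV. lin_form C i u powi (C $ i $ k))"

definition psi_domain :: "int ^ 'm::finite ^ 'n::finite \<Rightarrow> (complex ^ 'm) set" where
  "psi_domain C = {u. u \<noteq> 0 \<and> (\<forall>i. lin_form C i u \<noteq> 0)}"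

definition S_var :: "int ^ 'm::finite ^ 'n::finite \<Rightarrow> (complex ^ 'm) set" where
  "S_var C = zariski_closure (psi C ` psi_domain C)"

definition non_defective :: "int ^ 'm::finite ^ 'n::finite \<Rightarrow> bool" where
  "non_defective C \<longleftrightarrow> hypersurface (S_var C)"

definition monom_at :: "complex ^ 'm::finite \<Rightarrow> int ^ 'm \<Rightarrow> complex" where
  "monom_at y w = (\<Prod>i\<in>UNIV. (y $ i) powi (w $ i))"

definition alpha :: "int ^ 'm ^ 'm::finite \<Rightarrow> complex ^ 'm \<Rightarrow> complex ^ 'm" where
  "alpha M y = (\<chi> k. monom_at y (column k M))"

definition G_grp :: "int ^ 'm ^ 'm::finite \<Rightarrow> (complex ^ 'm) set" where
  "G_grp M = {\<epsilon>. (\<forall>i. \<epsilon> $ i \<noteq> 0) \<and> alpha M \<epsilon> = (\<chi> k. 1)}"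

definition column_lattice :: "int ^ 'm ^ 'm::finite \<Rightarrow> (int ^ 'm) set" where
  "column_lattice M = {(\<Sum>k\<in>UNIV. w k *s column k M) | w. True}"

text \<open>\<open>D \<circ> alpha M\<close> and \<open>D (\<epsilon> \<cdot> y)\<close> as Laurent polynomials: the variable with index \<open>k\<close> is
  replaced by the monomial with exponent vector column \<open>k\<close> of \<open>M\<close>, respectively multiplied by
  \<open>\<epsilon> $ k\<close>.\<close>

definition comp_alpha :: "(int, 'm::finite) mpoly \<Rightarrow> int ^ 'm ^ 'm \<Rightarrow> 'm laurent" where
  "comp_alpha D M = mpoly_eval (\<chi> k. laurent_monom (column k M)) (of_int_mpoly D)"

definition comp_scale :: "(int, 'm::finite) mpoly \<Rightarrow> complex ^ 'm \<Rightarrow> 'm laurent" where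
  "comp_scale D \<epsilon> =
     mpoly_eval (\<chi> k. laurent_const (\<epsilon> $ k) * laurent_monom (axis k 1)) (of_int_mpoly D)"

end

theory Submission
  imports Defs "HOL-Computational_Algebra.Fundamental_Theorem_Algebra"
begin

text \<open>
  Write \<open>\<psi>\<close> for the parametrization of \<open>S_var C2\<close>. A polynomial vanishes on the image of \<open>\<psi>\<close> iff
  \<open>\<Delta>2\<close> divides it: by Gauss's lemma the ideal of \<open>\<Delta>2\<close> and a non-multiple of it contains a non-zero
  polynomial in which a variable of \<open>\<Delta>2\<close> does not occur, and such a polynomial cannot vanish on the
  hypersurface. Since \<open>\<alpha>\<^sub>M\<close> maps the image of \<open>\<psi>\<close> into \<open>S_var C1\<close>, every \<open>\<Delta>2(\<epsilon> \<cdot> y)\<close> divides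
  \<open>\<Delta>1 \<circ> \<alpha>\<^sub>M\<close>.

  These factors are pairwise coprime because the logarithmic Gauss map \<open>y \<mapsto> (y\<^sub>k \<partial>\<^sub>k \<Delta>2(y))\<^sub>k\<close> inverts
  \<open>\<psi>\<close> and is insensitive to \<open>\<epsilon>\<close>, so that \<open>\<epsilon> \<cdot> S = S\<close> forces \<open>\<epsilon> = 1\<close>. The inversion holds at points
  where the differential of \<open>\<psi>\<close> has maximal rank. These exist since, by counting monomials, each
  \<open>u\<^sub>i / u\<^sub>j\<close> is algebraic over the coordinates of \<open>\<psi>(u)\<close> with one variable of \<open>\<Delta>2\<close> left out.

  The product \<open>P\<close> of the factors and the cofactor \<open>Q\<close> are invariant under the group, hence Laurent
  polynomials in \<open>\<alpha>\<^sub>M(y)\<close>, and the irreducibility of \<open>\<Delta>1\<close> makes \<open>Q\<close> a monomial \<open>c y\<^sup>v\<close>. Comparing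
  coefficients at exposed vertices of the supports, over \<open>\<int>\<close> and modulo each prime, gives \<open>c = \<plusminus>1\<close>.
\<close>

section \<open>Gauss's lemma over a subring\<close>

text \<open>The number of variables is fixed by the type \<open>'m\<close>, so an induction on it
  cannot run through types. All rings are therefore subsets of one type: \<open>Dep J\<close>
  consists of the polynomials in the variables of \<open>J\<close>, and a variable \<open>k\<close>
  is adjoined by passing to \<open>'a poly\<close> and evaluating at \<open>Var k\<close>. This is
  why divisibility and factoriality are stated relative to a subset.

  What connects the hypersurface with its ideal is a single elimination, followed by the fundamental
  theorem of algebra. The rank of the differential of \<psi> is controlled by differentiating, along
  a kernel vector \<open>v\<close> with \<open>v $ j = 0\<close>, an algebraic relation for each u_i
  / u_j whose derivative does not vanish; this forces \<open>v = 0\<close>.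

  The group G_M consists of tuples of roots of unity, so the coefficients of the factors lie in
  Z[\<zeta>], and those of their product are not visibly integers. Divisibility by a prime p can
  nevertheless be tested there, because a fraction r / p that lies in Z[\<zeta>] is an
  integer.\<close>

locale subdomain =
  fixes A :: "'a::idom set"
  assumes zero_closed: "0 \<in> A" and one_closed: "1 \<in> A"
    and uminus_closed: "a \<in> A \<Longrightarrow> - a \<in> A"
    and add_closed: "a \<in> A \<Longrightarrow> b \<in> A \<Longrightarrow> a + b \<in> A"
    and mult_closed: "a \<in> A \<Longrightarrow> b \<in> A \<Longrightarrow> a * b \<in> A"
begin

lemma diff_closed: "a \<in> A \<Longrightarrow> b \<in> A \<Longrightarrow> a - b \<in> A"
  using add_closed[of a "- b"] uminus_closed by simp

lemma sum_closed: "(\<And>i. i \<in> I \<Longrightarrow> f i \<in> A) \<Longrightarrow> sum f I \<in> A"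
  by (induction I rule: infinite_finite_induct) (auto intro: zero_closed add_closed)

lemma power_closed: "a \<in> A \<Longrightarrow> a ^ n \<in> A"
  by (induction n) (auto intro: one_closed mult_closed)

end

definition dvd_in :: "'a::idom set \<Rightarrow> 'a \<Rightarrow> 'a \<Rightarrow> bool" where
  "dvd_in A a b \<longleftrightarrow> (\<exists>c\<in>A. b = a * c)"

definition irreducible_in :: "'a::idom set \<Rightarrow> 'a \<Rightarrow> bool" where
  "irreducible_in A p \<longleftrightarrow> p \<in> A \<and> p \<noteq> 0 \<and> \<not> dvd_in A p 1 \<and>
     (\<forall>a\<in>A. \<forall>b\<in>A. p = a * b \<longrightarrow> dvd_in A a 1 \<or> dvd_in A b 1)"

definition prime_in :: "'a::idom set \<Rightarrow> 'a \<Rightarrow> bool" where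
  "prime_in A p \<longleftrightarrow> p \<in> A \<and> p \<noteq> 0 \<and> \<not> dvd_in A p 1 \<and>
     (\<forall>a\<in>A. \<forall>b\<in>A. dvd_in A p (a * b) \<longrightarrow> dvd_in A p a \<or> dvd_in A p b)"

text \<open>The additive function \<open>\<omega>\<close> makes every factorization into non-units finite.\<close>

definition factorial_in :: "'a::idom set \<Rightarrow> bool" where
  "factorial_in A \<longleftrightarrow> subdomain A \<and>
     (\<exists>\<omega> :: 'a \<Rightarrow> nat. (\<forall>a\<in>A - {0}. \<forall>b\<in>A - {0}. \<omega> (a * b) = \<omega> a + \<omega> b) \<and>
        (\<forall>a\<in>A - {0}. \<omega> a = 0 \<longrightarrow> dvd_in A a 1)) \<and>
     (\<forall>p. irreducible_in A p \<longrightarrow> prime_in A p)"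

lemma factorial_inE:
  assumes "factorial_in A"
  obtains \<omega> :: "'a::idom \<Rightarrow> nat" where
    "\<And>a b. a \<in> A \<Longrightarrow> a \<noteq> 0 \<Longrightarrow> b \<in> A \<Longrightarrow> b \<noteq> 0 \<Longrightarrow> \<omega> (a * b) = \<omega> a + \<omega> b"
    "\<And>a. a \<in> A \<Longrightarrow> a \<noteq> 0 \<Longrightarrow> \<omega> a = 0 \<Longrightarrow> dvd_in A a 1"
    "\<And>p. irreducible_in A p \<Longrightarrow> prime_in A p"
    "subdomain A"
proof -
  from assms obtain \<omega> :: "'a \<Rightarrow> nat" where
    1: "\<forall>a\<in>A - {0}. \<forall>b\<in>A - {0}. \<omega> (a * b) = \<omega> a + \<omega> b" and
    2: "\<forall>a\<in>A - {0}. \<omega> a = 0 \<longrightarrow> dvd_in A a 1" and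
    3: "\<forall>p. irreducible_in A p \<longrightarrow> prime_in A p" "subdomain A"
    unfolding factorial_in_def by (elim conjE exE)
  show thesis
    by (rule that[of \<omega>]) (use 1 2 3 in simp_all)
qed

text \<open>A non-unit divisor p of \<open>a\<close> with least \<omega> is irreducible: a non-unit
  factor of p has \<omega> at least that of p, which leaves \<omega> = 0 for its cofactor. Hence p
  is prime, and the cofactor of p in \<open>a\<close> has smaller \<omega>.\<close>

lemma factorial_in_induct [consumes 3, case_names unit prime]:
  assumes fact: "factorial_in A" and a: "a \<in> A" "a \<noteq> 0"
    and unit: "\<And>u. u \<in> A \<Longrightarrow> dvd_in A u 1 \<Longrightarrow> Q u"
    and prime: "\<And>p a. prime_in A p \<Longrightarrow> a \<in> A \<Longrightarrow> a \<noteq> 0 \<Longrightarrow> Q a \<Longrightarrow> Q (p * a)"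
  shows "Q a"
proof -
  from fact obtain \<omega> :: "'a \<Rightarrow> nat" where
      add: "\<And>a b. a \<in> A \<Longrightarrow> a \<noteq> 0 \<Longrightarrow> b \<in> A \<Longrightarrow> b \<noteq> 0 \<Longrightarrow> \<omega> (a * b) = \<omega> a + \<omega> b"
    and u0: "\<And>a. a \<in> A \<Longrightarrow> a \<noteq> 0 \<Longrightarrow> \<omega> a = 0 \<Longrightarrow> dvd_in A a 1"
    and irr: "\<And>p. irreducible_in A p \<Longrightarrow> prime_in A p"
    and "subdomain A"
    by (rule factorial_inE) (rule that)
  interpret subdomain A by fact
  show ?thesis
    using a
  proof (induction "\<omega> a" arbitrary: a rule: less_induct)
    case less
    show ?case
    proof (cases "dvd_in A a 1")
      case True
      then show ?thesis using unit less by blast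
    next
      case False
      define P where "P = (\<lambda>p. p \<in> A \<and> dvd_in A p a \<and> \<not> dvd_in A p 1)"
      have "P a"
        unfolding P_def using less False one_closed by (auto simp: dvd_in_def intro!: bexI[of _ 1])
      then obtain p where p: "P p" and pmin: "\<And>x. P x \<Longrightarrow> \<omega> p \<le> \<omega> x"
        using ex_has_least_nat[of P a \<omega>] by blast
      then obtain b where b: "b \<in> A" "a = p * b" and pA: "p \<in> A" "\<not> dvd_in A p 1"
        unfolding P_def dvd_in_def by auto
      have nz: "p \<noteq> 0" "b \<noteq> 0" using b less by auto
      have "irreducible_in A p"
        unfolding irreducible_in_def
      proof (intro conjI ballI impI)
        fix x y assume xy: "x \<in> A" "y \<in> A" "p = x * y"
        have "dvd_in A y 1" if "\<not> dvd_in A x 1"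
        proof -
          have "P x" unfolding P_def
            using that xy b by (auto simp: dvd_in_def mult.assoc intro!: bexI[of _ "y * b"] mult_closed)
          then have "\<omega> p \<le> \<omega> x" by (rule pmin)
          then have "\<omega> y = 0" using add[of x y] xy nz by auto
          then show ?thesis using u0 xy nz by auto
        qed
        then show "dvd_in A x 1 \<or> dvd_in A y 1" by blast
      qed (use pA nz in auto)
      then have pp: "prime_in A p" by (rule irr)
      have "\<omega> b < \<omega> a" using add[of p b] u0[of p] pA nz b by fastforce
      then have "Q b" using less.hyps b nz by blast
      then show ?thesis using prime[OF pp b(1) nz(2)] b by simp
    qed
  qed
qed

section \<open>Polynomials with coefficients in a factorial subring\<close>

definition polys_over :: "'a::idom set \<Rightarrow> 'a poly set" where
  "polys_over A = {P. \<forall>i. coeff P i \<in> A}"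

context subdomain
begin

lemma subdomain_polys_over: "subdomain (polys_over A)"
  by unfold_locales
    (auto simp: polys_over_def coeff_mult coeff_1
      intro: zero_closed one_closed uminus_closed add_closed mult_closed sum_closed)

lemma const_polys_over: "a \<in> A \<Longrightarrow> [:a:] \<in> polys_over A"
  by (auto simp: polys_over_def coeff_pCons zero_closed split: nat.split)

lemma monom_polys_over: "a \<in> A \<Longrightarrow> monom a n \<in> polys_over A"
  by (auto simp: polys_over_def zero_closed)

lemma dvd_in_const_iff:
  assumes "P \<in> polys_over A"
  shows "dvd_in (polys_over A) [:p:] P \<longleftrightarrow> (\<forall>i. dvd_in A p (coeff P i))"
proof
  assume "dvd_in (polys_over A) [:p:] P"
  then show "\<forall>i. dvd_in A p (coeff P i)"
    by (auto simp: dvd_in_def polys_over_def)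
next
  assume "\<forall>i. dvd_in A p (coeff P i)"
  then obtain c where c: "\<And>i. c i \<in> A" "\<And>i. coeff P i = p * c i"
    unfolding dvd_in_def by metis
  interpret B: subdomain "polys_over A" by (rule subdomain_polys_over)
  define Q where "Q = (\<Sum>i\<le>degree P. monom (c i) i)"
  have "Q \<in> polys_over A"
    unfolding Q_def by (intro B.sum_closed monom_polys_over c)
  moreover have "P = [:p:] * Q"
  proof -
    have "P = (\<Sum>i\<le>degree P. monom (coeff P i) i)" by (simp add: poly_as_sum_of_monoms)
    also have "\<dots> = (\<Sum>i\<le>degree P. [:p:] * monom (c i) i)"
      by (simp add: c smult_monom)
    also have "\<dots> = [:p:] * Q" unfolding Q_def by (rule sum_distrib_left[symmetric])
    finally show ?thesis .
  qed
  ultimately show "dvd_in (polys_over A) [:p:] P" unfolding dvd_in_def by blast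
qed

lemma dvd_in_sum: "(\<And>i. i \<in> I \<Longrightarrow> dvd_in A p (f i)) \<Longrightarrow> dvd_in A p (sum f I)"
proof (induction I rule: infinite_finite_induct)
  case (insert x F)
  then obtain c d where "c \<in> A" "d \<in> A" "f x = p * c" "sum f F = p * d"
    unfolding dvd_in_def by blast
  then show ?case
    using insert by (auto simp: dvd_in_def algebra_simps intro!: bexI[of _ "c + d"] add_closed)
qed (auto simp: dvd_in_def intro!: bexI[of _ 0] zero_closed)

lemma dvd_in_mult_left: "dvd_in A p a \<Longrightarrow> b \<in> A \<Longrightarrow> dvd_in A p (a * b)"
  by (auto simp: dvd_in_def mult.assoc intro: mult_closed)

lemma dvd_in_diff: "dvd_in A p a \<Longrightarrow> dvd_in A p b \<Longrightarrow> dvd_in A p (a - b)"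
  by (auto simp: dvd_in_def right_diff_distrib[symmetric] intro: diff_closed)

text \<open>With i and j the least indices at which p fails to divide a coefficient of P and of Q,
  every summand of coefficient i + j of P * Q other than P_i Q_j is divisible by p, so p would
  divide P_i Q_j.\<close>

lemma prime_in_const:
  assumes "prime_in A p"
  shows "prime_in (polys_over A) [:p:]"
proof -
  have pA: "p \<in> A" "p \<noteq> 0" "\<not> dvd_in A p 1"
    and prime: "\<And>a b. a \<in> A \<Longrightarrow> b \<in> A \<Longrightarrow> dvd_in A p (a * b) \<Longrightarrow> dvd_in A p a \<or> dvd_in A p b"
    using assms by (auto simp: prime_in_def)
  interpret B: subdomain "polys_over A" by (rule subdomain_polys_over)
  show ?thesis
    unfolding prime_in_def
  proof (intro conjI ballI impI)
    have "\<not> dvd_in A p (coeff 1 0)" using pA by simp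
    then show "\<not> dvd_in (polys_over A) [:p:] 1"
      using dvd_in_const_iff[OF B.one_closed] by blast
  next
    fix P Q assume PQ: "P \<in> polys_over A" "Q \<in> polys_over A" "dvd_in (polys_over A) [:p:] (P * Q)"
    show "dvd_in (polys_over A) [:p:] P \<or> dvd_in (polys_over A) [:p:] Q"
    proof (rule ccontr)
      assume "\<not> ?thesis"
      then obtain i0 j0 where "\<not> dvd_in A p (coeff P i0)" "\<not> dvd_in A p (coeff Q j0)"
        using dvd_in_const_iff PQ by blast
      then obtain i j where i: "\<not> dvd_in A p (coeff P i)" "\<And>k. k < i \<Longrightarrow> dvd_in A p (coeff P k)"
        and j: "\<not> dvd_in A p (coeff Q j)" "\<And>k. k < j \<Longrightarrow> dvd_in A p (coeff Q k)"
        using exists_least_iff[of "\<lambda>k. \<not> dvd_in A p (coeff P k)"]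
          exists_least_iff[of "\<lambda>k. \<not> dvd_in A p (coeff Q k)"] by blast
      have cA: "coeff P k \<in> A" "coeff Q k \<in> A" for k using PQ by (auto simp: polys_over_def)
      have "coeff (P * Q) (i + j) = coeff P i * coeff Q j +
          (\<Sum>k\<in>{..i + j} - {i}. coeff P k * coeff Q (i + j - k))"
        unfolding coeff_mult by (subst sum.remove[of _ i]) auto
      moreover have "dvd_in A p (coeff (P * Q) (i + j))"
        using PQ dvd_in_const_iff[OF B.mult_closed] by blast
      moreover have "dvd_in A p (\<Sum>k\<in>{..i + j} - {i}. coeff P k * coeff Q (i + j - k))"
      proof (rule dvd_in_sum)
        fix k assume k: "k \<in> {..i + j} - {i}"
        show "dvd_in A p (coeff P k * coeff Q (i + j - k))"
        proof (cases "k < i")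
          case True
          then show ?thesis using i(2) cA dvd_in_mult_left by blast
        next
          case False
          then have "i + j - k < j" using k by auto
          then show ?thesis using j(2) cA dvd_in_mult_left mult.commute by metis
        qed
      qed
      ultimately have "dvd_in A p (coeff P i * coeff Q j)"
        using dvd_in_diff by fastforce
      then show False using prime cA i(1) j(1) by blast
    qed
  qed (use pA const_polys_over in auto)
qed

text \<open>The leading coefficient of d has no inverse, so the dividend is multiplied by it before
  each subtraction. These multipliers accumulate in c, which stays non-zero.\<close>

lemma pseudo_division_in:
  assumes "d \<in> polys_over A" "d \<noteq> 0" "f \<in> polys_over A"
  shows "\<exists>c q r. c \<in> A \<and> c \<noteq> 0 \<and> q \<in> polys_over A \<and> r \<in> polys_over A \<and>
    [:c:] * f = q * d + r \<and> (r = 0 \<or> degree r < degree d)"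
  using assms(3)
proof (induction "degree f" arbitrary: f rule: less_induct)
  case less
  interpret B: subdomain "polys_over A" by (rule subdomain_polys_over)
  show ?case
  proof (cases "f = 0 \<or> degree f < degree d")
    case True
    then show ?thesis
      using less.prems one_closed B.zero_closed
      by (intro exI[of _ 1] exI[of _ 0] exI[of _ f]) auto
  next
    case False
    define c where "c = lead_coeff d"
    define h where "h = monom (lead_coeff f) (degree f - degree d)"
    define f' where "f' = [:c:] * f - h * d"
    have cA: "c \<in> A" "c \<noteq> 0" using assms by (auto simp: c_def polys_over_def)
    have hB: "h \<in> polys_over A"
      unfolding h_def using less.prems by (intro monom_polys_over) (auto simp: polys_over_def)
    have f'B: "f' \<in> polys_over A"
      unfolding f'_def using less.prems assms cA hB
      by (intro B.diff_closed B.mult_closed const_polys_over)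
    have dh: "degree (h * d) = degree f"
      unfolding h_def using False assms
      by (subst degree_mult_eq) (auto simp: degree_monom_eq monom_eq_0_iff)
    have lh: "coeff (h * d) (degree f) = c * lead_coeff f"
      using dh lead_coeff_mult[of h d] False by (simp add: h_def c_def degree_monom_eq mult.commute)
    have dle: "degree f' \<le> degree f"
      unfolding f'_def using dh by (intro degree_diff_le) auto
    have c0: "coeff f' (degree f) = 0"
      unfolding f'_def using lh by simp
    have small: "f' = 0 \<or> degree f' < degree f"
      using dle c0 by (metis leading_coeff_0_iff le_neq_implies_less)
    show ?thesis
    proof (cases "f' = 0")
      case True
      then have "[:c:] * f = h * d + 0" unfolding f'_def by simp
      then show ?thesis using cA hB B.zero_closed by blast
    next
      case False
      then obtain c' q r where IH: "c' \<in> A" "c' \<noteq> 0" "q \<in> polys_over A" "r \<in> polys_over A"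
          "[:c':] * f' = q * d + r" "r = 0 \<or> degree r < degree d"
        using less.hyps[of f'] small f'B by blast
      have "[:c' * c:] * f = [:c':] * f' + [:c':] * h * d"
        unfolding f'_def by (simp add: algebra_simps smult_diff_right)
      also have "\<dots> = (q + [:c':] * h) * d + r" using IH by (simp add: algebra_simps)
      finally have eq: "[:c' * c:] * f = (q + [:c':] * h) * d + r" .
      have "c' * c \<in> A" "c' * c \<noteq> 0" using IH cA mult_closed by auto
      moreover have "q + [:c':] * h \<in> polys_over A"
        using IH hB by (intro B.add_closed B.mult_closed const_polys_over)
      ultimately show ?thesis using eq IH by blast
    qed
  qed
qed

end

lemma unit_poly_degree:
  fixes r s :: "'a::idom poly"
  assumes "r * s = 1" shows "degree r = 0"
proof -
  have "r \<noteq> 0" "s \<noteq> 0" using assms by auto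
  then have "degree r + degree s = 0" using assms degree_mult_eq[of r s] by simp
  then show ?thesis by simp
qed

text \<open>The primes of c are removed one at a time: by \<open>prime_in_const\<close> each divides
  q or d, and it is moved into e' or e accordingly. This is the passage from the fraction field of A
  back to A.\<close>

lemma cancel_const:
  fixes A :: "'a::idom set"
  assumes fact: "factorial_in A" and c: "c \<in> A" "c \<noteq> 0"
    and "f \<in> polys_over A" "q \<in> polys_over A" "d \<in> polys_over A" "[:c:] * f = q * d"
  shows "\<exists>q' d' e e'. q' \<in> polys_over A \<and> d' \<in> polys_over A \<and> e \<in> A \<and> e' \<in> A \<and>
    f = q' * d' \<and> d = [:e:] * d' \<and> q = [:e':] * q'"
  using fact c assms(4-)
proof (induction arbitrary: f q d rule: factorial_in_induct)
  case (unit u)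
  interpret subdomain A using fact by (simp add: factorial_in_def)
  interpret B: subdomain "polys_over A" by (rule subdomain_polys_over)
  from unit obtain w where w: "w \<in> A" "u * w = 1" "w * u = 1"
    by (auto simp: dvd_in_def mult.commute)
  have "f = [:w:] * ([:u:] * f)" using w by simp
  also have "\<dots> = q * ([:w:] * d)" using unit by (simp add: algebra_simps)
  finally have "f = q * ([:w:] * d)" .
  moreover have "d = [:u:] * ([:w:] * d)" using w by simp
  moreover have "q = [:1:] * q" by simp
  ultimately show ?case
    using unit w one_closed B.mult_closed[OF const_polys_over[OF w(1)] \<open>d \<in> _\<close>] by blast
next
  case (prime p a)
  interpret subdomain A using fact by (simp add: factorial_in_def)
  interpret B: subdomain "polys_over A" by (rule subdomain_polys_over)
  have pp: "prime_in (polys_over A) [:p:]" using prime by (intro prime_in_const)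
  have pA: "p \<in> A" "p \<noteq> 0" using prime by (auto simp: prime_in_def)
  have eq: "[:p:] * ([:a:] * f) = q * d" using prime.prems by (simp add: mult.commute)
  have "dvd_in (polys_over A) [:p:] (q * d)"
    unfolding dvd_in_def using eq prime by (metis B.mult_closed const_polys_over)
  then consider "dvd_in (polys_over A) [:p:] q" | "dvd_in (polys_over A) [:p:] d"
    using pp prime.prems by (auto simp: prime_in_def)
  then show ?case
  proof cases
    case 1
    then obtain q1 where q1: "q1 \<in> polys_over A" "q = [:p:] * q1" by (auto simp: dvd_in_def)
    have "[:p:] * ([:a:] * f) = [:p:] * (q1 * d)" using eq q1 by (simp add: algebra_simps)
    then have "[:a:] * f = q1 * d" using pA by (metis mult_left_cancel pCons_eq_0_iff)
    from prime.IH[OF prime.prems(1) q1(1) prime.prems(3) this] obtain q' d' e e' where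
      "q' \<in> polys_over A" "d' \<in> polys_over A" "e \<in> A" "e' \<in> A" 
      "f = q' * d'" "d = [:e:] * d'" "q1 = [:e':] * q'" by blast
    moreover from this have "q = [:p * e':] * q'" using q1 by (simp add: mult.commute)
    ultimately show ?thesis using mult_closed pA by blast
  next
    case 2
    then obtain q1 where q1: "q1 \<in> polys_over A" "d = [:p:] * q1" by (auto simp: dvd_in_def)
    have "[:p:] * ([:a:] * f) = [:p:] * (q * q1)" using eq q1 by (simp add: algebra_simps)
    then have "[:a:] * f = q * q1" using pA by (metis mult_left_cancel pCons_eq_0_iff)
    from prime.IH[OF prime.prems(1,2) q1(1) this] obtain q' d' e e' where
      "q' \<in> polys_over A" "d' \<in> polys_over A" "e \<in> A" "e' \<in> A" 
      "f = q' * d'" "q1 = [:e:] * d'" "q = [:e':] * q'" by blast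
    moreover from this have "d = [:p * e:] * d'" using q1 by (simp add: mult.commute)
    ultimately show ?thesis using mult_closed pA by blast
  qed
qed

text \<open>\<open>cancel_const\<close> writes f as a constant e times a factor d' of g. As f is
  irreducible and d' is not constant, e is a unit, so f itself divides g.\<close>

lemma cancel_const_dvd:
  fixes A :: "'a::idom set"
  assumes fact: "factorial_in A" and c: "c \<in> A" "c \<noteq> 0"
    and f: "irreducible_in (polys_over A) f" "degree f > 0"
    and g: "g \<in> polys_over A" "dvd_in (polys_over A) f ([:c:] * g)"
  shows "dvd_in (polys_over A) f g"
proof -
  interpret subdomain A using fact by (simp add: factorial_in_def)
  interpret B: subdomain "polys_over A" by (rule subdomain_polys_over)
  have fB: "f \<in> polys_over A" "f \<noteq> 0" using f by (auto simp: irreducible_in_def)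
  from g obtain h where h: "h \<in> polys_over A" "[:c:] * g = h * f"
    by (auto simp: dvd_in_def mult.commute)
  from cancel_const[OF fact c g(1) h(1) fB(1) h(2)] obtain q' d' e where
    *: "q' \<in> polys_over A" "d' \<in> polys_over A" "e \<in> A" "g = q' * d'" "f = [:e:] * d'" by blast
  have "dvd_in (polys_over A) [:e:] 1 \<or> dvd_in (polys_over A) d' 1"
    using f * const_polys_over unfolding irreducible_in_def by blast
  moreover have "\<not> dvd_in (polys_over A) d' 1"
  proof
    assume "dvd_in (polys_over A) d' 1"
    then have "degree d' = 0" unfolding dvd_in_def using unit_poly_degree by metis
    then have "degree f = 0" using * fB by auto
    then show False using f by simp
  qed
  ultimately obtain s where s: "s \<in> polys_over A" "1 = [:e:] * s" by (auto simp: dvd_in_def)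
  have "d' = ([:e:] * s) * d'" using s by simp
  then have d'f: "d' = f * s" using * by (simp add: algebra_simps)
  have "g = f * (s * q')" by (subst *(4), subst d'f) (simp only: ac_simps)
  then show ?thesis unfolding dvd_in_def using s * B.mult_closed by blast
qed

text \<open>Let d be a non-zero element of least degree in the ideal of f and g. If d is constant,
  it is the wanted r. Otherwise pseudo-division shows that d divides constant multiples of f and of
  g. Irreducibility makes the factor d' that f shares with d associated to f, so f divides a
  constant multiple of g, hence g.\<close>

theorem gauss_dichotomy:
  fixes A :: "'a::idom set"
  assumes fact: "factorial_in A"
    and f: "irreducible_in (polys_over A) f" "degree f > 0" and g: "g \<in> polys_over A"
  shows "dvd_in (polys_over A) f g \<or>
    (\<exists>a\<in>polys_over A. \<exists>b\<in>polys_over A. \<exists>r\<in>A. r \<noteq> 0 \<and> a * f + b * g = [:r:])"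
proof -
  interpret subdomain A using fact by (simp add: factorial_in_def)
  interpret B: subdomain "polys_over A" by (rule subdomain_polys_over)
  have fB: "f \<in> polys_over A" "f \<noteq> 0" using f by (auto simp: irreducible_in_def)
  define I where "I = (\<lambda>d. \<exists>a\<in>polys_over A. \<exists>b\<in>polys_over A. d = a * f + b * g)"
  have If: "I f" unfolding I_def
    by (rule bexI[of _ 1], rule bexI[of _ 0]) (auto intro: B.one_closed B.zero_closed)
  have Ig: "I g" unfolding I_def
    by (rule bexI[of _ 0], rule bexI[of _ 1]) (auto intro: B.one_closed B.zero_closed)
  have I_sub: "I (s * x - q * d)" if "I x" "I d" "s \<in> polys_over A" "q \<in> polys_over A" for s x q d
  proof -
    from that obtain a b a' b' where "a \<in> polys_over A" "b \<in> polys_over A" "a' \<in> polys_over A" "b' \<in> polys_over A"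
      "x = a * f + b * g" "d = a' * f + b' * g" unfolding I_def by blast
    then show ?thesis unfolding I_def using that
      by (intro bexI[of _ "s * a - q * a'"] bexI[of _ "s * b - q * b'"])
        (auto simp: algebra_simps intro!: B.diff_closed B.mult_closed)
  qed
  have IB: "d \<in> polys_over A" if "I d" for d
    using that fB g unfolding I_def by (auto intro!: B.add_closed B.mult_closed)
  obtain d where d: "I d" "d \<noteq> 0" and dmin: "\<And>x. I x \<Longrightarrow> x \<noteq> 0 \<Longrightarrow> degree d \<le> degree x"
    using ex_has_least_nat[of "\<lambda>x. I x \<and> x \<noteq> 0" f degree] If fB by blast
  show ?thesis
  proof (cases "degree d = 0")
    case True
    then obtain r where r: "d = [:r:]" by (rule degree_eq_zeroE)
    have "r \<in> A" using IB[OF d(1)] r by (auto simp: polys_over_def coeff_pCons dest: spec[of _ 0])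
    moreover have "r \<noteq> 0" using d r by auto
    ultimately show ?thesis using d(1) r unfolding I_def by metis
  next
    case False
    have div: "\<exists>c q. c \<in> A \<and> c \<noteq> 0 \<and> q \<in> polys_over A \<and> [:c:] * x = q * d" if x: "I x" for x
    proof -
      obtain c q r where *: "c \<in> A" "c \<noteq> 0" "q \<in> polys_over A" "r \<in> polys_over A"
        "[:c:] * x = q * d + r" "r = 0 \<or> degree r < degree d"
        using pseudo_division_in[OF IB[OF d(1)] d(2) IB[OF x]] by blast
      have "r = [:c:] * x - q * d" using * by simp
      then have "I r" using I_sub[OF x d(1) const_polys_over[OF *(1)] *(3)] by simp
      then have "r = 0" using dmin * by fastforce
      then show ?thesis using * by auto
    qed
    from div[OF If] obtain c q where c: "c \<in> A" "c \<noteq> 0" "q \<in> polys_over A" "[:c:] * f = q * d"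
      by blast
    from cancel_const[OF fact c(1,2) fB(1) c(3) IB[OF d(1)] c(4)] obtain q' d' e where
      *: "q' \<in> polys_over A" "d' \<in> polys_over A" "e \<in> A" "f = q' * d'" "d = [:e:] * d'" by blast
    have "degree d' = degree d" using * d by (auto simp: )
    then have "\<not> dvd_in (polys_over A) d' 1"
      using False unfolding dvd_in_def using unit_poly_degree by metis
    then obtain s where s: "s \<in> polys_over A" "1 = q' * s"
      using f * unfolding irreducible_in_def dvd_in_def by blast
    have "d' = (q' * s) * d'" using s by simp
    then have d'f: "d' = f * s" using * by (simp add: algebra_simps)
    from div[OF Ig] obtain c q where c: "c \<in> A" "c \<noteq> 0" "q \<in> polys_over A" "[:c:] * g = q * d"
      by blast
    have "[:c:] * g = f * (q * [:e:] * s)"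
      by (subst c(4), subst *(5), subst d'f) (simp only: ac_simps)
    moreover have "q * [:e:] * s \<in> polys_over A"
      using c s * by (intro B.mult_closed const_polys_over)
    ultimately have "dvd_in (polys_over A) f ([:c:] * g)" unfolding dvd_in_def by blast
    then show ?thesis using cancel_const_dvd[OF fact c(1,2) f g] by blast
  qed
qed

text \<open>Degree and \<omega> of the leading coefficient are both additive, and so is their sum.
  For a non-constant irreducible f that does not divide g, a combination a f + b g is a constant r;
  if f divides g h, it divides r h, and the constant cancels.\<close>

theorem factorial_in_polys_over:
  fixes A :: "'a::idom set"
  assumes fact: "factorial_in A"
  shows "factorial_in (polys_over A)"
proof -
  interpret subdomain A using fact by (simp add: factorial_in_def)
  interpret B: subdomain "polys_over A" by (rule subdomain_polys_over)
  from fact obtain \<omega> :: "'a \<Rightarrow> nat" where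
      add: "\<And>a b. a \<in> A \<Longrightarrow> a \<noteq> 0 \<Longrightarrow> b \<in> A \<Longrightarrow> b \<noteq> 0 \<Longrightarrow> \<omega> (a * b) = \<omega> a + \<omega> b"
    and u0: "\<And>a. a \<in> A \<Longrightarrow> a \<noteq> 0 \<Longrightarrow> \<omega> a = 0 \<Longrightarrow> dvd_in A a 1"
    and irr: "\<And>p. irreducible_in A p \<Longrightarrow> prime_in A p"
    and "subdomain A"
    by (rule factorial_inE) (rule that)
  have unitB: "dvd_in (polys_over A) [:a:] 1" if a: "dvd_in A a 1" for a
  proof -
    from a obtain b where "b \<in> A" "1 = a * b" by (auto simp: dvd_in_def)
    then have "[:b:] \<in> polys_over A" "1 = [:a:] * [:b:]" by (auto simp: const_polys_over one_pCons mult.commute)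
    then show ?thesis unfolding dvd_in_def by blast
  qed
  have unitA: "dvd_in A a 1" if "dvd_in (polys_over A) [:a:] 1" for a
    using that dvd_in_const_iff[OF B.one_closed, of a] by (metis coeff_1 lead_coeff_1)
  show ?thesis
    unfolding factorial_in_def
  proof (intro conjI allI impI)
    show "subdomain (polys_over A)" by (rule subdomain_polys_over)
  next
    show "\<exists>\<omega> :: 'a poly \<Rightarrow> nat. (\<forall>a\<in>polys_over A - {0}. \<forall>b\<in>polys_over A - {0}. \<omega> (a * b) = \<omega> a + \<omega> b) \<and>
        (\<forall>a\<in>polys_over A - {0}. \<omega> a = 0 \<longrightarrow> dvd_in (polys_over A) a 1)"
    proof (intro exI[of _ "\<lambda>f. degree f + \<omega> (lead_coeff f)"] conjI ballI impI)
      fix f g assume "f \<in> polys_over A - {0}" "g \<in> polys_over A - {0}"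
      then show "degree (f * g) + \<omega> (lead_coeff (f * g)) =
          degree f + \<omega> (lead_coeff f) + (degree g + \<omega> (lead_coeff g))"
        by (subst lead_coeff_mult, subst add) (auto simp: degree_mult_eq polys_over_def)
    next
      fix f assume f: "f \<in> polys_over A - {0}" "degree f + \<omega> (lead_coeff f) = 0"
      then obtain r where r: "f = [:r:]" by (metis add_is_0 degree_eq_zeroE)
      then show "dvd_in (polys_over A) f 1"
        using f u0[of r] unitB by (auto simp: polys_over_def coeff_pCons dest: spec[of _ 0])
    qed
  next
    fix f assume f: "irreducible_in (polys_over A) f"
    then have fB: "f \<in> polys_over A" "f \<noteq> 0" "\<not> dvd_in (polys_over A) f 1"
      by (auto simp: irreducible_in_def)
    show "prime_in (polys_over A) f"
    proof (cases "degree f = 0")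
      case True
      then obtain p where p: "f = [:p:]" by (rule degree_eq_zeroE)
      have "irreducible_in A p"
        unfolding irreducible_in_def
      proof (intro conjI ballI impI)
        show "p \<in> A" using fB p by (auto simp: polys_over_def coeff_pCons dest: spec[of _ 0])
        show "p \<noteq> 0" using fB p by auto
        show "\<not> dvd_in A p 1" using fB p unitB by auto
        fix a b assume "a \<in> A" "b \<in> A" "p = a * b"
        then have "[:a:] \<in> polys_over A" "[:b:] \<in> polys_over A" "f = [:a:] * [:b:]"
          using const_polys_over p by auto
        then show "dvd_in A a 1 \<or> dvd_in A b 1"
          using f unitA unfolding irreducible_in_def by blast
      qed
      then show ?thesis using irr prime_in_const p by blast
    next
      case False
      show ?thesis
        unfolding prime_in_def
      proof (intro conjI ballI impI fB)
        fix g h assume gh: "g \<in> polys_over A" "h \<in> polys_over A" "dvd_in (polys_over A) f (g * h)"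
        have "dvd_in (polys_over A) f h" if nd: "\<not> dvd_in (polys_over A) f g"
        proof -
          obtain a b r where *: "a \<in> polys_over A" "b \<in> polys_over A" "r \<in> A" "r \<noteq> 0"
            "a * f + b * g = [:r:]"
            using gauss_dichotomy[OF fact f _ gh(1)] False nd by blast
          from gh obtain k where k: "k \<in> polys_over A" "g * h = f * k" by (auto simp: dvd_in_def)
          have "[:r:] * h = f * (a * h) + b * (g * h)" using *(5)[symmetric] by (simp only: algebra_simps)
          also have "\<dots> = f * (a * h + b * k)" using k by (simp add: algebra_simps)
          finally have "dvd_in (polys_over A) f ([:r:] * h)"
            unfolding dvd_in_def using * k gh B.add_closed B.mult_closed by blast
          then show ?thesis using cancel_const_dvd[OF fact *(3,4) f _ gh(2)] False by blast
        qed
        then show "dvd_in (polys_over A) f g \<or> dvd_in (polys_over A) f h" by blast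
      qed
    qed
  qed
qed

section \<open>Transport of factoriality along injective homomorphisms\<close>

lemma dvd_in_image:
  assumes "inj_on \<phi> B" "\<And>x y. x \<in> B \<Longrightarrow> y \<in> B \<Longrightarrow> \<phi> (x * y) = \<phi> x * \<phi> y"
    and "subdomain B" "x \<in> B" "y \<in> B"
  shows "dvd_in (\<phi> ` B) (\<phi> x) (\<phi> y) \<longleftrightarrow> dvd_in B x y"
proof -
  interpret subdomain B by fact
  show ?thesis
  proof
    assume "dvd_in (\<phi> ` B) (\<phi> x) (\<phi> y)"
    then obtain c where c: "c \<in> B" "\<phi> y = \<phi> (x * c)"
      using assms by (auto simp: dvd_in_def)
    then have "y = x * c" using inj_onD[OF assms(1) c(2)] assms mult_closed by blast
    then show "dvd_in B x y" using c by (auto simp: dvd_in_def)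
  next
    assume "dvd_in B x y"
    then show "dvd_in (\<phi> ` B) (\<phi> x) (\<phi> y)" using assms by (auto simp: dvd_in_def)
  qed
qed

theorem factorial_in_image:
  fixes B :: "'a::idom set" and \<phi> :: "'a \<Rightarrow> 'b::idom"
  assumes fact: "factorial_in B" and inj: "inj_on \<phi> B"
    and hom0: "\<phi> 0 = 0" and hom1: "\<phi> 1 = 1"
    and hom_uminus: "\<And>x. x \<in> B \<Longrightarrow> \<phi> (- x) = - \<phi> x"
    and hom_add: "\<And>x y. x \<in> B \<Longrightarrow> y \<in> B \<Longrightarrow> \<phi> (x + y) = \<phi> x + \<phi> y"
    and hom_mult: "\<And>x y. x \<in> B \<Longrightarrow> y \<in> B \<Longrightarrow> \<phi> (x * y) = \<phi> x * \<phi> y"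
  shows "factorial_in (\<phi> ` B)"
proof -
  interpret subdomain B using fact by (simp add: factorial_in_def)
  have sub: "subdomain B" by unfold_locales
  from fact obtain \<omega> :: "'a \<Rightarrow> nat" where
      add: "\<And>a b. a \<in> B \<Longrightarrow> a \<noteq> 0 \<Longrightarrow> b \<in> B \<Longrightarrow> b \<noteq> 0 \<Longrightarrow> \<omega> (a * b) = \<omega> a + \<omega> b"
    and u0: "\<And>a. a \<in> B \<Longrightarrow> a \<noteq> 0 \<Longrightarrow> \<omega> a = 0 \<Longrightarrow> dvd_in B a 1"
    and irr: "\<And>p. irreducible_in B p \<Longrightarrow> prime_in B p"
    and "subdomain B"
    by (rule factorial_inE) (rule that)
  have dvd: "dvd_in (\<phi> ` B) (\<phi> x) (\<phi> y) \<longleftrightarrow> dvd_in B x y" if "x \<in> B" "y \<in> B" for x y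
    using inj hom_mult sub that by (intro dvd_in_image) auto
  have dvd1: "dvd_in (\<phi> ` B) (\<phi> x) 1 \<longleftrightarrow> dvd_in B x 1" if "x \<in> B" for x
    using dvd[OF that one_closed] hom1 by simp
  have z: "\<phi> x = 0 \<longleftrightarrow> x = 0" if "x \<in> B" for x
    using inj_onD[OF inj, of x 0] that zero_closed hom0 by auto
  have eqm: "\<phi> x = \<phi> a * \<phi> b \<longleftrightarrow> x = a * b" if "x \<in> B" "a \<in> B" "b \<in> B" for x a b
    using inj_onD[OF inj, of x "a * b"] that mult_closed hom_mult by auto
  define \<psi> where "\<psi> = inv_into B \<phi>"
  have \<psi>: "\<psi> (\<phi> x) = x" if "x \<in> B" for x using that inj by (simp add: \<psi>_def)
  show ?thesis
    unfolding factorial_in_def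
  proof (intro conjI allI impI)
    show "subdomain (\<phi> ` B)"
    proof
      show "0 \<in> \<phi> ` B" using zero_closed hom0 by (metis image_eqI)
      show "1 \<in> \<phi> ` B" using one_closed hom1 by (metis image_eqI)
    next
      fix a assume "a \<in> \<phi> ` B"
      then show "- a \<in> \<phi> ` B" using uminus_closed hom_uminus by (metis (no_types, lifting) image_iff)
    next
      fix a b assume "a \<in> \<phi> ` B" "b \<in> \<phi> ` B"
      then show "a + b \<in> \<phi> ` B" "a * b \<in> \<phi> ` B"
        using add_closed hom_add mult_closed hom_mult by (metis (no_types, lifting) image_iff)+
    qed
  next
    show "\<exists>\<omega> :: 'b \<Rightarrow> nat. (\<forall>a\<in>\<phi> ` B - {0}. \<forall>b\<in>\<phi> ` B - {0}. \<omega> (a * b) = \<omega> a + \<omega> b) \<and>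
        (\<forall>a\<in>\<phi> ` B - {0}. \<omega> a = 0 \<longrightarrow> dvd_in (\<phi> ` B) a 1)"
    proof (intro exI[of _ "\<lambda>x. \<omega> (\<psi> x)"] conjI ballI impI)
      fix a b assume "a \<in> \<phi> ` B - {0}" "b \<in> \<phi> ` B - {0}"
      then obtain x y where "x \<in> B" "y \<in> B" "a = \<phi> x" "b = \<phi> y" "x \<noteq> 0" "y \<noteq> 0"
        using hom0 by auto
      then show "\<omega> (\<psi> (a * b)) = \<omega> (\<psi> a) + \<omega> (\<psi> b)"
        using add \<psi> mult_closed hom_mult by metis
    next
      fix a assume a: "a \<in> \<phi> ` B - {0}" "\<omega> (\<psi> a) = 0"
      then obtain x where x: "x \<in> B" "a = \<phi> x" by blast
      then have "x \<noteq> 0" "\<omega> x = 0" using a hom0 \<psi> by auto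
      then show "dvd_in (\<phi> ` B) a 1" using x u0 dvd1 by simp
    qed
  next
    fix p assume p: "irreducible_in (\<phi> ` B) p"
    then obtain x where x: "x \<in> B" "p = \<phi> x" by (auto simp: irreducible_in_def)
    have "irreducible_in B x"
      using p x unfolding irreducible_in_def by (auto simp: z dvd1 eqm)
    then have "prime_in B x" by (rule irr)
    then show "prime_in (\<phi> ` B) p"
      using x unfolding prime_in_def
      by (auto simp: z dvd1 dvd hom_mult[symmetric] mult_closed)
  qed
qed

section \<open>Polynomial functions\<close>

abbreviation "lookup \<equiv> Poly_Mapping.lookup"
abbreviation "keys \<equiv> Poly_Mapping.keys"
abbreviation "single \<equiv> Poly_Mapping.single"

text \<open>Evaluation at a point is the linear extension of a character of the exponent monoid. One
  notion serves polynomials, with exponents in \<open>nat ^ 'm\<close>, and Laurent polynomials,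
  with exponents in \<open>int ^ 'm\<close>.\<close>

definition char_sum :: "('a \<Rightarrow> 'r) \<Rightarrow> ('a \<Rightarrow>\<^sub>0 'r::comm_ring_1) \<Rightarrow> 'r" where
  "char_sum \<phi> p = (\<Sum>a\<in>keys p. lookup p a * \<phi> a)"

lemma char_sum_superset:
  assumes "finite S" "keys p \<subseteq> S"
  shows "char_sum \<phi> p = (\<Sum>a\<in>S. lookup p a * \<phi> a)"
  unfolding char_sum_def using assms by (intro sum.mono_neutral_left) (auto simp: in_keys_iff)

lemma char_sum_0 [simp]: "char_sum \<phi> 0 = 0"
  by (simp add: char_sum_def)

lemma char_sum_add: "char_sum \<phi> (p + q) = char_sum \<phi> p + char_sum \<phi> q"
proof -
  let ?S = "keys p \<union> keys q"
  have "char_sum \<phi> (p + q) = (\<Sum>a\<in>?S. lookup (p + q) a * \<phi> a)"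
    using Poly_Mapping.keys_add[of p q] by (intro char_sum_superset) auto
  then show ?thesis
    by (simp add: lookup_add distrib_right sum.distrib char_sum_superset[of ?S])
qed

lemma char_sum_sum: "char_sum \<phi> (sum f I) = (\<Sum>i\<in>I. char_sum \<phi> (f i))"
  by (induction I rule: infinite_finite_induct) (auto simp: char_sum_add)

lemma char_sum_single [simp]: "char_sum \<phi> (single a c) = c * \<phi> a"
  by (subst char_sum_superset[of "{a}"]) auto

lemma poly_mapping_eq_sum_single:
  "p = (\<Sum>a\<in>keys p. single a (lookup p a))"
proof (rule poly_mapping_eqI)
  fix b
  have "(\<Sum>a\<in>keys p. lookup (single a (lookup p a)) b)
      = (\<Sum>a\<in>keys p. if a = b then lookup p b else 0)"
    by (intro sum.cong) (auto simp: lookup_single when_def)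
  then show "lookup p b = lookup
      (\<Sum>a\<in>keys p. single a (lookup p a)) b"
    by (simp add: lookup_sum in_keys_iff)
qed

lemma mult_eq_sum_single:
  "p * q = (\<Sum>a\<in>keys p. \<Sum>b\<in>keys q.
      single (a + b) (lookup p a * lookup q b))"
  for p q :: "'a::comm_monoid_add \<Rightarrow>\<^sub>0 'r::comm_ring_1"
proof -
  have "p * q = (\<Sum>a\<in>keys p. single a (lookup p a)) *
      (\<Sum>b\<in>keys q. single b (lookup q b))"
    using poly_mapping_eq_sum_single[of p] poly_mapping_eq_sum_single[of q] by simp
  then show ?thesis by (simp add: sum_product mult_single)
qed

lemma char_sum_mult:
  fixes \<phi> :: "'a::comm_monoid_add \<Rightarrow> 'r::comm_ring_1"
  assumes "\<And>a b. \<phi> (a + b) = \<phi> a * \<phi> b"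
  shows "char_sum \<phi> (p * q) = char_sum \<phi> p * char_sum \<phi> q"
proof -
  have "char_sum \<phi> (p * q) = (\<Sum>a\<in>keys p. \<Sum>b\<in>keys q.
      (lookup p a * \<phi> a) * (lookup q b * \<phi> b))"
    unfolding mult_eq_sum_single[of p q] by (simp add: char_sum_sum assms mult_ac)
  then show ?thesis
    by (simp add: char_sum_def sum_product)
qed

lemma char_sum_uminus: "char_sum \<phi> (- p) = - char_sum \<phi> p"
  using char_sum_add[of \<phi> p "- p"] by (simp add: eq_neg_iff_add_eq_0 add.commute)

lemma char_sum_diff: "char_sum \<phi> (p - q) = char_sum \<phi> p - char_sum \<phi> q"
  using char_sum_add[of \<phi> "p - q" q] by simp

lemma char_sum_1 [simp]: "char_sum \<phi> 1 = \<phi> 0"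
  unfolding single_one[symmetric] char_sum_single by simp

text \<open>Dedekind's argument: the relation at \<open>mul x y\<close> minus
  \<open>\<phi> w0 y\<close> times the relation at x has no term for w0, so the induction hypothesis
  applies, and a y that separates w from w0 gives a w = 0. The point e, where no character vanishes,
  settles w0 itself.\<close>

lemma characters_independent:
  fixes \<phi> :: "'w \<Rightarrow> 'x \<Rightarrow> complex"
  assumes "finite W"
    and closed: "\<And>x y. x \<in> T \<Longrightarrow> y \<in> T \<Longrightarrow> mul x y \<in> T"
    and char: "\<And>w x y. x \<in> T \<Longrightarrow> y \<in> T \<Longrightarrow> \<phi> w (mul x y) = \<phi> w x * \<phi> w y"
    and distinct: "\<And>w w'. w \<noteq> w' \<Longrightarrow> \<exists>x\<in>T. \<phi> w x \<noteq> \<phi> w' x"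
    and e: "e \<in> T" "\<And>w. \<phi> w e \<noteq> 0"
    and "\<And>x. x \<in> T \<Longrightarrow> (\<Sum>w\<in>W. a w * \<phi> w x) = 0"
  shows "\<forall>w\<in>W. a w = 0"
  using assms(1,7)
proof (induction W arbitrary: a rule: finite_induct)
  case (insert w0 W)
  have eq: "a w0 * \<phi> w0 x + (\<Sum>w\<in>W. a w * \<phi> w x) = 0" if "x \<in> T" for x
    using insert.prems[OF that] insert.hyps by simp
  have *: "\<forall>w\<in>W. a w * (\<phi> w y - \<phi> w0 y) = 0" if y: "y \<in> T" for y
  proof (rule insert.IH)
    fix x assume x: "x \<in> T"
    have "(\<Sum>w\<in>W. a w * (\<phi> w y - \<phi> w0 y) * \<phi> w x) =
        (\<Sum>w\<in>W. a w * \<phi> w (mul x y)) - (\<Sum>w\<in>W. a w * \<phi> w x) * \<phi> w0 y"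
      by (simp add: char x y algebra_simps sum_subtractf sum_distrib_left)
    also have "\<dots> = - (a w0 * \<phi> w0 (mul x y)) + a w0 * \<phi> w0 x * \<phi> w0 y"
      using eq[OF closed[OF x y]] eq[OF x] by (simp add: eq_neg_iff_add_eq_0[symmetric] add.commute)
    finally show "(\<Sum>w\<in>W. a w * (\<phi> w y - \<phi> w0 y) * \<phi> w x) = 0"
      by (simp add: char x y)
  qed
  have W0: "a w = 0" if w: "w \<in> W" for w
  proof -
    have "w \<noteq> w0" using insert.hyps w by blast
    then obtain y where "y \<in> T" "\<phi> w y \<noteq> \<phi> w0 y" using distinct by blast
    then show ?thesis using * w by fastforce
  qed
  then have "a w0 * \<phi> w0 e = 0" using eq[OF e(1)] by simp
  then show ?case using W0 e by simp
qed simp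

lemma char_sum_eq_0_imp:
  fixes \<phi> :: "'w \<Rightarrow> 'x \<Rightarrow> complex"
  assumes "\<And>x y. x \<in> T \<Longrightarrow> y \<in> T \<Longrightarrow> mul x y \<in> T"
    and "\<And>w x y. x \<in> T \<Longrightarrow> y \<in> T \<Longrightarrow> \<phi> w (mul x y) = \<phi> w x * \<phi> w y"
    and "\<And>w w'. w \<noteq> w' \<Longrightarrow> \<exists>x\<in>T. \<phi> w x \<noteq> \<phi> w' x"
    and "e \<in> T" "\<And>w. \<phi> w e \<noteq> 0"
    and "\<And>x. x \<in> T \<Longrightarrow> char_sum (\<lambda>w. \<phi> w x) p = 0"
  shows "p = 0"
proof -
  have "\<forall>w\<in>keys p. lookup p w = 0"
    by (rule characters_independent[of _ T mul \<phi> e]) (use assms in \<open>auto simp: char_sum_def\<close>)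
  then show ?thesis by (metis in_keys_iff lookup_zero poly_mapping_eqI)
qed

definition nat_monom :: "'r::comm_ring_1 ^ 'm::finite \<Rightarrow> nat ^ 'm \<Rightarrow> 'r" where
  "nat_monom y a = (\<Prod>k\<in>UNIV. (y $ k) ^ (a $ k))"

lemma nat_monom_add: "nat_monom y (a + b) = nat_monom y a * nat_monom y b"
  by (simp add: nat_monom_def power_add prod.distrib)

lemma nat_monom_mult: "nat_monom (y * z) a = nat_monom y a * nat_monom z a"
  by (simp add: nat_monom_def power_mult_distrib prod.distrib)

lemma nat_monom_one: "nat_monom 1 a = 1"
  by (simp add: nat_monom_def)

lemma mpoly_eval_eq: "mpoly_eval y p = char_sum (nat_monom y) p"
  by (simp add: mpoly_eval_def char_sum_def nat_monom_def)

definition upd :: "'a ^ 'm \<Rightarrow> 'm::finite \<Rightarrow> 'a \<Rightarrow> 'a ^ 'm" where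
  "upd y k t = (\<chi> i. if i = k then t else y $ i)"

lemma upd_nth [simp]: "upd y k t $ i = (if i = k then t else y $ i)"
  by (simp add: upd_def)

lemma upd_same [simp]: "upd y k (y $ k) = y"
  by (simp add: vec_eq_iff)

lemma mpoly_eval_eq_0_imp:
  fixes p :: "(complex, 'm::finite) mpoly"
  assumes "\<And>y. mpoly_eval y p = 0"
  shows "p = 0"
proof (rule char_sum_eq_0_imp[of UNIV "(*)" "\<lambda>a y. nat_monom y a" 1])
  fix a b :: "nat ^ 'm" assume "a \<noteq> b"
  then obtain k where k: "a $ k \<noteq> b $ k" by (auto simp: vec_eq_iff)
  have "nat_monom (upd 1 k 2 :: complex ^ 'm) c = 2 ^ (c $ k)" for c :: "nat ^ 'm"
  proof -
    have "nat_monom (upd 1 k 2 :: complex ^ 'm) c = (\<Prod>i\<in>UNIV. if i = k then 2 ^ (c $ k) else 1)"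
      unfolding nat_monom_def by (intro prod.cong) auto
    then show ?thesis by simp
  qed
  moreover have "(2::complex) ^ (a $ k) \<noteq> 2 ^ (b $ k)"
  proof
    assume "(2::complex) ^ (a $ k) = 2 ^ (b $ k)"
    then have "cmod (2 ^ (a $ k)) = cmod (2 ^ (b $ k))" by simp
    then show False using k by (simp add: norm_power)
  qed
  ultimately show "\<exists>x\<in>UNIV. nat_monom (x :: complex ^ 'm) a \<noteq> nat_monom x b"
    by (intro bexI[of _ "upd 1 k 2"]) auto
qed (use assms in \<open>simp_all add: mpoly_eval_eq nat_monom_mult nat_monom_one\<close>)

text \<open>The convolution ring of polynomials is not an instance of \<open>idom\<close>, since \<open>nat ^ 'm\<close> carries no
  linear order. It is replaced by the isomorphic ring of polynomial functions.\<close>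

typedef (overloaded) 'm::finite pfun = "{f :: complex ^ 'm \<Rightarrow> complex. \<exists>p. f = (\<lambda>y. mpoly_eval y p)}"
  morphisms papply Abs_pfun
  by blast

setup_lifting type_definition_pfun

lift_definition pf_of :: "(complex, 'm) mpoly \<Rightarrow> 'm::finite pfun" is "\<lambda>p y. mpoly_eval y p"
  by blast

instantiation pfun :: (finite) comm_ring_1
begin

lift_definition zero_pfun :: "'a pfun" is "\<lambda>_. 0"
  by (rule exI[of _ 0]) (simp add: mpoly_eval_eq)

lift_definition one_pfun :: "'a pfun" is "\<lambda>_. 1"
  by (rule exI[of _ 1]) (simp add: mpoly_eval_eq nat_monom_def)

lift_definition plus_pfun :: "'a pfun \<Rightarrow> 'a pfun \<Rightarrow> 'a pfun" is "\<lambda>f g y. f y + g y"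
proof -
  fix f g :: "complex ^ 'a \<Rightarrow> complex"
  assume "\<exists>p. f = (\<lambda>y. mpoly_eval y p)" "\<exists>p. g = (\<lambda>y. mpoly_eval y p)"
  then obtain p q where "f = (\<lambda>y. mpoly_eval y p)" "g = (\<lambda>y. mpoly_eval y q)" by blast
  then show "\<exists>p. (\<lambda>y. f y + g y) = (\<lambda>y. mpoly_eval y p)"
    by (intro exI[of _ "p + q"]) (simp add: mpoly_eval_eq char_sum_add)
qed

lift_definition times_pfun :: "'a pfun \<Rightarrow> 'a pfun \<Rightarrow> 'a pfun" is "\<lambda>f g y. f y * g y"
proof -
  fix f g :: "complex ^ 'a \<Rightarrow> complex"
  assume "\<exists>p. f = (\<lambda>y. mpoly_eval y p)" "\<exists>p. g = (\<lambda>y. mpoly_eval y p)"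
  then obtain p q where "f = (\<lambda>y. mpoly_eval y p)" "g = (\<lambda>y. mpoly_eval y q)" by blast
  then show "\<exists>p. (\<lambda>y. f y * g y) = (\<lambda>y. mpoly_eval y p)"
    by (intro exI[of _ "p * q"]) (simp add: mpoly_eval_eq char_sum_mult nat_monom_add)
qed

lift_definition uminus_pfun :: "'a pfun \<Rightarrow> 'a pfun" is "\<lambda>f y. - f y"
proof -
  fix f :: "complex ^ 'a \<Rightarrow> complex"
  assume "\<exists>p. f = (\<lambda>y. mpoly_eval y p)"
  then obtain p where "f = (\<lambda>y. mpoly_eval y p)" by blast
  then show "\<exists>p. (\<lambda>y. - f y) = (\<lambda>y. mpoly_eval y p)"
    by (intro exI[of _ "- p"]) (simp add: mpoly_eval_eq char_sum_uminus)
qed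

definition minus_pfun :: "'a pfun \<Rightarrow> 'a pfun \<Rightarrow> 'a pfun" where "minus_pfun f g = f + - g"

instance
proof
  fix a b c :: "'a pfun"
  show "a * b * c = a * (b * c)" by transfer (simp add: mult.assoc)
  show "a * b = b * a" by transfer (simp add: mult.commute)
  show "1 * a = a" by transfer simp
  show "a + b + c = a + (b + c)" by transfer (simp add: add.assoc)
  show "a + b = b + a" by transfer (simp add: add.commute)
  show "0 + a = a" by transfer simp
  show "- a + a = 0" by transfer simp
  show "a - b = a + - b" by (rule minus_pfun_def)
  show "(a + b) * c = a * c + b * c" by transfer (simp add: distrib_right)
  show "(0::'a pfun) \<noteq> 1" by transfer (simp add: fun_eq_iff)
qed

end

lemmas papply_zero [simp] = zero_pfun.rep_eq[THEN fun_cong]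
lemmas papply_one [simp] = one_pfun.rep_eq[THEN fun_cong]
lemmas papply_add [simp] = plus_pfun.rep_eq[THEN fun_cong]
lemmas papply_mult [simp] = times_pfun.rep_eq[THEN fun_cong]
lemmas papply_uminus [simp] = uminus_pfun.rep_eq[THEN fun_cong]

lemma papply_diff [simp]: "papply (f - g) y = papply f y - papply g y"
  unfolding minus_pfun_def papply_add papply_uminus by simp

lemma pfun_eqI: "(\<And>y. papply f y = papply g y) \<Longrightarrow> f = g"
  by transfer auto

lemma pfun_eq_0_iff: "f = 0 \<longleftrightarrow> (\<forall>y. papply f y = 0)"
  by transfer auto

lemma papply_power [simp]: "papply (f ^ n) y = papply f y ^ n"
  by (induction n) auto

lemma papply_prod [simp]: "papply (prod f I) y = (\<Prod>i\<in>I. papply (f i) y)"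
  by (induction I rule: infinite_finite_induct) auto

lemma papply_sum [simp]: "papply (sum f I) y = (\<Sum>i\<in>I. papply (f i) y)"
  by (induction I rule: infinite_finite_induct) auto

lemma papply_of_nat [simp]: "papply (of_nat n) y = of_nat n"
  by (induction n) auto

lift_definition Cst :: "complex \<Rightarrow> 'm::finite pfun" is "\<lambda>c _. c"
  by (rule exI[of _ "single 0 c" for c]) (simp add: mpoly_eval_eq nat_monom_def)

lemmas papply_Cst [simp] = Cst.rep_eq[THEN fun_cong]

lift_definition Var :: "'m \<Rightarrow> 'm::finite pfun" is "\<lambda>k y. y $ k"
proof -
  fix k :: 'm
  have "nat_monom y (axis k 1) = y $ k" for y :: "complex ^ 'm"
  proof -
    have "nat_monom y (axis k 1) = (\<Prod>i\<in>UNIV. if i = k then y $ k else 1)"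
      unfolding nat_monom_def by (intro prod.cong) (auto simp: axis_def)
    then show ?thesis by simp
  qed
  then show "\<exists>p. (\<lambda>y. y $ k) = (\<lambda>y :: complex ^ 'm. mpoly_eval y p)"
    by (intro exI[of _ "single (axis k 1) 1"]) (simp add: mpoly_eval_eq)
qed

lemmas papply_Var [simp] = Var.rep_eq[THEN fun_cong]
lemmas papply_pf_of [simp] = pf_of.rep_eq[THEN fun_cong]

lemma Var_nonzero: "Var k \<noteq> (0 :: 'm::finite pfun)"
proof
  assume "Var k = (0 :: 'm pfun)"
  then have "papply (Var k) (1 :: complex ^ 'm) = papply 0 1" by simp
  then show False by simp
qed

lemma pf_of_surj: "\<exists>p. f = pf_of p"
  by transfer blast

lemma pf_of_single: "pf_of (single a c) = Cst c * (\<Prod>k\<in>UNIV. Var k ^ (a $ k))"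
  by (rule pfun_eqI) (simp add: mpoly_eval_eq nat_monom_def)

lemma pf_of_sum: "pf_of (sum f I) = (\<Sum>i\<in>I. pf_of (f i))"
  by (rule pfun_eqI) (simp add: mpoly_eval_eq char_sum_sum)

lemma pf_of_mult: "pf_of (p * q) = pf_of p * pf_of q"
  by (rule pfun_eqI) (simp add: mpoly_eval_eq char_sum_mult nat_monom_add)

lemma pf_of_eq_0_iff [simp]: "pf_of p = 0 \<longleftrightarrow> p = 0"
proof
  assume "pf_of p = 0"
  then have "mpoly_eval y p = 0" for y using papply_pf_of[of p y] by simp
  then show "p = 0" by (rule mpoly_eval_eq_0_imp)
qed (auto intro!: pfun_eqI simp: mpoly_eval_eq)

lemma pf_of_inj: "pf_of p = pf_of q \<Longrightarrow> p = q"
proof -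
  assume eq: "pf_of p = pf_of q"
  have "pf_of (p - q) = pf_of p - pf_of q"
    by (rule pfun_eqI) (simp add: mpoly_eval_eq char_sum_diff)
  then have "p - q = 0" using eq pf_of_eq_0_iff[of "p - q"] by simp
  then show "p = q" by simp
qed

lemma pf_of_1: "pf_of 1 = 1"
  by (rule pfun_eqI) (simp add: mpoly_eval_eq nat_monom_def)

lemma pf_of_dvd_iff: "pf_of p dvd pf_of q \<longleftrightarrow> p dvd q"
  by (metis dvd_def pf_of_inj pf_of_mult pf_of_surj)

lemma irreducible_pf_of: "irreducible (pf_of p) \<longleftrightarrow> irreducible p"
proof -
  have "(\<forall>a b. pf_of p = a * b \<longrightarrow> a dvd 1 \<or> b dvd 1) \<longleftrightarrow>
      (\<forall>a b. pf_of p = pf_of a * pf_of b \<longrightarrow> pf_of a dvd 1 \<or> pf_of b dvd 1)"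
    by (metis pf_of_surj)
  moreover have "pf_of p = pf_of a * pf_of b \<longleftrightarrow> p = a * b" for a b
    by (metis pf_of_inj pf_of_mult)
  moreover have "pf_of a dvd 1 \<longleftrightarrow> a dvd 1" for a :: "(complex, 'a) mpoly"
    using pf_of_dvd_iff[of a 1] by (simp add: pf_of_1)
  ultimately show ?thesis unfolding irreducible_def by simp
qed

lemma pfun_induct [case_names Cst Var add mult]:
  assumes "\<And>c. P (Cst c)" "\<And>k. P (Var k)"
    and "\<And>f g. P f \<Longrightarrow> P g \<Longrightarrow> P (f + g)" "\<And>f g. P f \<Longrightarrow> P g \<Longrightarrow> P (f * g)"
  shows "P f"
proof -
  have 0: "P 0" and 1: "P 1"
    using assms(1)[of 0] assms(1)[of 1]
    by (metis papply_Cst papply_zero pfun_eqI, metis papply_Cst papply_one pfun_eqI)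
  have pow: "P (g ^ n)" if "P g" for g n
    using that by (induction n) (auto intro: assms 1)
  have prod: "P (prod g I)" if "\<And>i. P (g i)" for g :: "'a \<Rightarrow> 'a pfun" and I
    using that by (induction I rule: infinite_finite_induct) (auto intro: assms 1)
  have sum: "P (sum g I)" if "\<And>i. P (g i)" for g :: "(nat, 'a) vec \<Rightarrow> 'a pfun" and I
    using that by (induction I rule: infinite_finite_induct) (auto intro: assms 0)
  obtain p where p: "f = pf_of p" using pf_of_surj by blast
  have "f = (\<Sum>a\<in>keys p. Cst (lookup p a) * (\<Prod>k\<in>UNIV. Var k ^ (a $ k)))"
    unfolding p by (subst poly_mapping_eq_sum_single) (simp only: pf_of_sum pf_of_single)
  then show ?thesis by (auto intro!: sum prod pow assms)
qed

lemma papply_line: "\<exists>P. \<forall>t. papply f (y + t *s v) = poly P t"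
proof (induction f rule: pfun_induct)
  case (Cst c)
  show ?case by (rule exI[of _ "[:c:]"]) simp
next
  case (Var k)
  show ?case by (rule exI[of _ "[:y $ k, v $ k:]"]) simp
next
  case (add f g)
  then obtain P Q where "\<forall>t. papply f (y + t *s v) = poly P t" "\<forall>t. papply g (y + t *s v) = poly Q t"
    by blast
  then show ?case by (intro exI[of _ "P + Q"]) simp
next
  case (mult f g)
  then obtain P Q where "\<forall>t. papply f (y + t *s v) = poly P t" "\<forall>t. papply g (y + t *s v) = poly Q t"
    by blast
  then show ?case by (intro exI[of _ "P * Q"]) simp
qed

text \<open>On the line through a point where f is non-zero and one where g is non-zero, both
  restrict to non-zero polynomials in one variable, whose product is not identically zero.\<close>

instance pfun :: (finite) idom
proof
  fix f g :: "'a pfun"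
  assume "f \<noteq> 0" "g \<noteq> 0"
  then obtain y z where y: "papply f y \<noteq> 0" and z: "papply g z \<noteq> 0"
    unfolding pfun_eq_0_iff by blast
  obtain P where P: "\<And>t. papply f (y + t *s (z - y)) = poly P t" using papply_line by blast
  obtain Q where Q: "\<And>t. papply g (y + t *s (z - y)) = poly Q t" using papply_line by blast
  have "poly P 0 \<noteq> 0" using P[of 0] y by simp
  moreover have "poly Q 1 \<noteq> 0" using Q[of 1] z by simp
  ultimately have "P * Q \<noteq> 0" by auto
  then obtain t where "poly (P * Q) t \<noteq> 0" using poly_all_0_iff_0[of "P * Q"] by blast
  then have "papply (f * g) (y + t *s (z - y)) \<noteq> 0" using P Q by simp
  then show "f * g \<noteq> 0" by fastforce
qed

text \<open>Characteristic 0 is what makes the derivative of a polynomial of positive degree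
  non-zero.\<close>

instance pfun :: (finite) ring_char_0
proof
  show "inj (of_nat :: nat \<Rightarrow> 'a pfun)"
  proof (rule injI)
    fix m n :: nat assume "(of_nat m :: 'a pfun) = of_nat n"
    then have "papply (of_nat m :: 'a pfun) 0 = papply (of_nat n) 0" by simp
    then show "m = n" by simp
  qed
qed

section \<open>Substitution and dependence on a set of variables\<close>

definition psubst :: "('m \<Rightarrow> 'k::finite pfun) \<Rightarrow> 'm::finite pfun \<Rightarrow> 'k pfun" where
  "psubst g f = Abs_pfun (\<lambda>y. papply f (\<chi> i. papply (g i) y))"

lemma papply_psubst [simp]: "papply (psubst g f) y = papply f (\<chi> i. papply (g i) y)"
proof -
  have "\<exists>h. \<forall>y. papply h y = papply f (\<chi> i. papply (g i) y)"
  proof (induction f rule: pfun_induct)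
    case (Cst c)
    show ?case by (rule exI[of _ "Cst c"]) simp
  next
    case (Var k)
    show ?case by (rule exI[of _ "g k"]) simp
  next
    case (add f1 f2)
    then show ?case by (metis papply_add)
  next
    case (mult f1 f2)
    then show ?case by (metis papply_mult)
  qed
  then obtain h where h: "papply h = (\<lambda>y. papply f (\<chi> i. papply (g i) y))" by auto
  have "psubst g f = h" unfolding psubst_def h[symmetric] by (rule papply_inverse)
  then show ?thesis using h by simp
qed

text \<open>Stated through values: moving the coordinates outside J does not change f. Closure under
  the ring operations is then immediate; that such an f is a polynomial in the variables of J is the
  content of \<open>Dep_insert\<close>.\<close>

definition Dep :: "'m set \<Rightarrow> 'm::finite pfun set" where
  "Dep J = {f. \<forall>y z. (\<forall>i\<in>J. y $ i = z $ i) \<longrightarrow> papply f y = papply f z}"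

lemma DepD: "f \<in> Dep J \<Longrightarrow> (\<And>i. i \<in> J \<Longrightarrow> y $ i = z $ i) \<Longrightarrow> papply f y = papply f z"
  by (auto simp: Dep_def)

lemma subdomain_Dep: "subdomain (Dep J)"
  by unfold_locales (auto 0 0 simp: Dep_def, metis, metis)

lemma Dep_UNIV [simp]: "Dep UNIV = UNIV"
  by (auto simp: Dep_def vec_eq_iff[symmetric])

lemma papply_poly:
  "papply (poly P f) y = poly (map_poly (\<lambda>c. papply c y) P) (papply f y)"
  by (induction P) (simp_all add: map_poly_pCons)

lemma pfun_as_poly: "\<exists>P\<in>polys_over (Dep (- {k})). f = poly P (Var k)"
proof -
  interpret A: subdomain "Dep (- {k})" by (rule subdomain_Dep)
  interpret B: subdomain "polys_over (Dep (- {k}))" by (rule A.subdomain_polys_over)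
  show ?thesis
  proof (induction f rule: pfun_induct)
    case (Cst c)
    show ?case
      by (rule bexI[of _ "[:Cst c:]"], simp, rule A.const_polys_over, simp add: Dep_def)
  next
    case (Var i)
    show ?case
    proof (cases "i = k")
      case True
      then show ?thesis
        using A.monom_polys_over[OF A.one_closed, of 1]
        by (intro bexI[of _ "monom 1 1"]) (auto simp: poly_monom)
    next
      case False
      then show ?thesis
        by (intro bexI[of _ "[:Var i:]"] A.const_polys_over) (auto simp: Dep_def)
    qed
  next
    case (add f g)
    then show ?case by (metis B.add_closed poly_add)
  next
    case (mult f g)
    then show ?case by (metis B.mult_closed poly_mult)
  qed
qed

lemma papply_upd_poly:
  assumes "P \<in> polys_over (Dep J)" "k \<notin> J"
  shows "papply (poly P (Var k)) (upd y k t) = poly (map_poly (\<lambda>c. papply c y) P) t"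
proof -
  have "map_poly (\<lambda>c. papply c (upd y k t)) P = map_poly (\<lambda>c. papply c y) P"
    using assms by (intro poly_eqI) (auto simp: coeff_map_poly polys_over_def intro!: DepD[of _ J])
  then show ?thesis by (simp add: papply_poly)
qed

lemma poly_Var_eq_0:
  assumes "P \<in> polys_over (Dep J)" "k \<notin> J" "poly P (Var k) = 0"
  shows "P = 0"
proof (rule poly_eqI, rule pfun_eqI)
  fix i y
  have "poly (map_poly (\<lambda>c. papply c y) P) t = 0" for t
    using papply_upd_poly[OF assms(1,2), of y t] assms(3) by simp
  then have "map_poly (\<lambda>c. papply c y) P = 0" using poly_all_0_iff_0 by blast
  then have "coeff (map_poly (\<lambda>c. papply c y) P) i = 0" by simp
  then show "papply (coeff P i) y = papply (coeff 0 i) y" by (simp add: coeff_map_poly)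
qed

text \<open>The coefficients supplied by \<open>pfun_as_poly\<close> may involve every variable
  except k. Setting the variables outside J to 0 in them brings them into \<open>Dep J\<close> and
  does not affect f, which does not depend on these variables.\<close>

lemma Dep_insert:
  assumes "k \<notin> J"
  shows "Dep (insert k J) = (\<lambda>P. poly P (Var k)) ` polys_over (Dep J)"
proof (intro equalityI subsetI)
  fix f assume f: "f \<in> Dep (insert k J)"
  obtain P where P: "P \<in> polys_over (Dep (- {k}))" "f = poly P (Var k)" using pfun_as_poly by blast
  define \<rho> where "\<rho> = psubst (\<lambda>i. if i \<in> J then Var i else 0 :: 'a pfun)"
  have \<rho>: "papply (\<rho> c) y = papply c (\<chi> i. if i \<in> J then y $ i else 0)" for c y
  proof -
    have "(\<chi> i. papply (if i \<in> J then Var i else 0) y) = (\<chi> i. if i \<in> J then y $ i else 0)"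
      by (simp add: vec_eq_iff)
    then show ?thesis by (simp add: \<rho>_def)
  qed
  have \<rho>0: "\<rho> 0 = 0" by (rule pfun_eqI) (simp add: \<rho>)
  have "f = poly (map_poly \<rho> P) (Var k)"
  proof (rule pfun_eqI)
    fix y :: "complex ^ 'a"
    define z where "z = (\<chi> i. if i \<in> insert k J then y $ i else 0)"
    have "papply f y = papply f z" by (rule DepD[OF f]) (auto simp: z_def)
    also have "\<dots> = poly (map_poly (\<lambda>c. papply c z) P) (y $ k)"
      using P by (simp add: papply_poly z_def)
    also have "map_poly (\<lambda>c. papply c z) P = map_poly (\<lambda>c. papply c y) (map_poly \<rho> P)"
    proof (rule poly_eqI)
      fix i
      have "papply (coeff P i) z = papply (\<rho> (coeff P i)) y"
        unfolding \<rho> using P(1) assms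
        by (intro DepD[of _ "- {k}"]) (auto simp: polys_over_def z_def)
      then show "coeff (map_poly (\<lambda>c. papply c z) P) i = coeff (map_poly (\<lambda>c. papply c y) (map_poly \<rho> P)) i"
        by (simp add: coeff_map_poly \<rho>0)
    qed
    finally show "papply f y = papply (poly (map_poly \<rho> P) (Var k)) y" by (simp add: papply_poly)
  qed
  moreover have "map_poly \<rho> P \<in> polys_over (Dep J)"
    unfolding polys_over_def Dep_def
    by (auto simp: coeff_map_poly \<rho>0 \<rho> intro!: arg_cong[of _ _ "papply _"] simp: vec_eq_iff)
  ultimately show "f \<in> (\<lambda>P. poly P (Var k)) ` polys_over (Dep J)" by blast
next
  fix f assume "f \<in> (\<lambda>P. poly P (Var k)) ` polys_over (Dep J)"
  then obtain P where P: "P \<in> polys_over (Dep J)" "f = poly P (Var k)" by blast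
  show "f \<in> Dep (insert k J)"
    unfolding Dep_def
  proof (intro CollectI allI impI)
    fix y z :: "complex ^ 'a" assume yz: "\<forall>i\<in>insert k J. y $ i = z $ i"
    have "map_poly (\<lambda>c. papply c y) P = map_poly (\<lambda>c. papply c z) P"
      using P yz by (intro poly_eqI) (auto simp: coeff_map_poly polys_over_def intro!: DepD[of _ J])
    then show "papply f y = papply f z" using P yz by (simp add: papply_poly)
  qed
qed

lemma Dep_empty_unit:
  assumes "f \<in> Dep {}" "f \<noteq> 0"
  shows "f dvd 1"
proof -
  obtain y where y: "papply f y \<noteq> 0" using assms by (auto simp: pfun_eq_0_iff)
  have const: "papply f z = papply f y" for z by (rule DepD[OF assms(1)]) auto
  have "papply f z * inverse (papply f y) = 1" for z unfolding const[of z] using y by simp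
  then have "1 = f * Cst (inverse (papply f y))" by (intro pfun_eqI) simp
  then show ?thesis by (rule dvdI)
qed

text \<open>In \<open>Dep {}\<close> every non-zero element is a unit, so \<omega> = 0 works there.
  For the induction step, evaluation at \<open>Var k\<close> embeds the polynomial ring over
  \<open>Dep J\<close> with image \<open>Dep (insert k J)\<close>.\<close>

theorem factorial_in_Dep: "factorial_in (Dep J)"
proof -
  have "finite J" by simp
  then show ?thesis
  proof (induction J rule: finite_induct)
    case empty
    have unit: "dvd_in (Dep {}) f 1" if f: "f \<in> Dep {}" "f \<noteq> 0" for f :: "'a pfun"
    proof -
      obtain g where g: "1 = f * g" using Dep_empty_unit[OF f] by (auto elim: dvdE)
      have "papply g y = papply g z" for y z
      proof -
        have "papply f y * papply g y = papply f z * papply g z"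
          by (simp flip: papply_mult g)
        moreover have "papply f y = papply f z" by (rule DepD[OF f(1)]) auto
        moreover have "papply f y * papply g y = 1" by (simp flip: papply_mult g)
        ultimately show ?thesis by auto
      qed
      then have "g \<in> Dep {}" by (auto simp: Dep_def)
      then show ?thesis using g unfolding dvd_in_def by blast
    qed
    show ?case
      unfolding factorial_in_def
    proof (intro conjI subdomain_Dep)
      show "\<exists>\<omega> :: 'a pfun \<Rightarrow> nat. (\<forall>a\<in>Dep {} - {0}. \<forall>b\<in>Dep {} - {0}. \<omega> (a * b) = \<omega> a + \<omega> b) \<and>
          (\<forall>a\<in>Dep {} - {0}. \<omega> a = 0 \<longrightarrow> dvd_in (Dep {}) a 1)"
        using unit by (intro exI[of _ "\<lambda>_. 0"]) auto
      show "\<forall>p :: 'a pfun. irreducible_in (Dep {}) p \<longrightarrow> prime_in (Dep {}) p"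
        using unit by (auto simp: irreducible_in_def)
    qed
  next
    case (insert k J)
    interpret A: subdomain "Dep J" by (rule subdomain_Dep)
    interpret B: subdomain "polys_over (Dep J)" by (rule A.subdomain_polys_over)
    show ?case
      unfolding Dep_insert[OF insert.hyps(2)]
    proof (rule factorial_in_image[OF factorial_in_polys_over[OF insert.IH]])
      show "inj_on (\<lambda>P. poly P (Var k)) (polys_over (Dep J))"
      proof (rule inj_onI)
        fix P Q assume PQ: "P \<in> polys_over (Dep J)" "Q \<in> polys_over (Dep J)"
          "poly P (Var k) = poly Q (Var k)"
        then have "P - Q = 0"
          using insert.hyps by (intro poly_Var_eq_0[of _ J k] B.diff_closed) auto
        then show "P = Q" by simp
      qed
    qed auto
  qed
qed

section \<open>Degrees, derivatives and rational functions\<close>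

lemma poly_Var_inj:
  assumes "P \<in> polys_over (Dep (- {k}))" "Q \<in> polys_over (Dep (- {k}))"
    and "poly P (Var k) = poly Q (Var k)"
  shows "P = Q"
proof -
  interpret A: subdomain "Dep (- {k})" by (rule subdomain_Dep)
  interpret B: subdomain "polys_over (Dep (- {k}))" by (rule A.subdomain_polys_over)
  have "P - Q = 0"
    using assms by (intro poly_Var_eq_0[of _ "- {k}" k] B.diff_closed) auto
  then show ?thesis by simp
qed

text \<open>The choice is unique by \<open>poly_Var_inj\<close>, so its degree is the degree of f in
  the variable k.\<close>

definition as_poly :: "'m::finite \<Rightarrow> 'm pfun \<Rightarrow> 'm pfun poly" where
  "as_poly k f = (SOME P. P \<in> polys_over (Dep (- {k})) \<and> f = poly P (Var k))"

lemma as_poly: "as_poly k f \<in> polys_over (Dep (- {k}))" "poly (as_poly k f) (Var k) = f"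
proof -
  have "\<exists>P. P \<in> polys_over (Dep (- {k})) \<and> f = poly P (Var k)" using pfun_as_poly by blast
  from someI_ex[OF this]
  show "as_poly k f \<in> polys_over (Dep (- {k}))" "poly (as_poly k f) (Var k) = f"
    unfolding as_poly_def by auto
qed

lemma as_poly_eqI: "P \<in> polys_over (Dep (- {k})) \<Longrightarrow> poly P (Var k) = f \<Longrightarrow> as_poly k f = P"
  using as_poly[of k f] by (intro poly_Var_inj[of _ k]) auto

lemma as_poly_eq_0_iff [simp]: "as_poly k f = 0 \<longleftrightarrow> f = 0"
  using as_poly[of k f] by (auto intro: as_poly_eqI simp: polys_over_def Dep_def)

lemma as_poly_mult: "as_poly k (f * g) = as_poly k f * as_poly k g"
proof (rule as_poly_eqI)
  interpret A: subdomain "Dep (- {k})" by (rule subdomain_Dep)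
  interpret B: subdomain "polys_over (Dep (- {k}))" by (rule A.subdomain_polys_over)
  show "as_poly k f * as_poly k g \<in> polys_over (Dep (- {k}))" by (intro B.mult_closed as_poly)
qed (simp add: as_poly)

lemma degree_as_poly_eq_0_iff: "degree (as_poly k f) = 0 \<longleftrightarrow> f \<in> Dep (- {k})"
proof
  assume "degree (as_poly k f) = 0"
  then obtain c where c: "as_poly k f = [:c:]" by (rule degree_eq_zeroE)
  then have "c \<in> Dep (- {k})"
    using as_poly(1)[of k f] by (auto simp: polys_over_def coeff_pCons dest: spec[of _ 0])
  moreover have "f = c" using as_poly(2)[of k f] c by simp
  ultimately show "f \<in> Dep (- {k})" by simp
next
  interpret A: subdomain "Dep (- {k})" by (rule subdomain_Dep)
  assume "f \<in> Dep (- {k})"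
  then have "as_poly k f = [:f:]" by (intro as_poly_eqI A.const_polys_over) auto
  then show "degree (as_poly k f) = 0" by simp
qed

text \<open>In the second alternative r plays the part of the resultant of f and g with respect to
  k: a non-zero element of their ideal from which k is eliminated.\<close>

theorem pfun_gauss_dichotomy:
  assumes f: "irreducible f" "f \<notin> Dep (- {k})"
  shows "f dvd g \<or> (\<exists>a b r. r \<in> Dep (- {k}) \<and> r \<noteq> 0 \<and> a * f + b * g = r)"
proof -
  let ?A = "Dep (- {k})"
  interpret A: subdomain ?A by (rule subdomain_Dep)
  interpret B: subdomain "polys_over ?A" by (rule A.subdomain_polys_over)
  have one: "as_poly k 1 = 1" by (intro as_poly_eqI) (auto intro: B.one_closed)
  have unit: "dvd_in (polys_over ?A) P 1" if P: "P \<in> polys_over ?A" "poly P (Var k) dvd 1" for P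
  proof -
    from P obtain c where "1 = poly P (Var k) * c" by (auto elim: dvdE)
    moreover have "as_poly k (poly P (Var k)) = P" using P by (intro as_poly_eqI) auto
    ultimately have "1 = P * as_poly k c" using one as_poly_mult by metis
    then show ?thesis unfolding dvd_in_def using as_poly(1) by blast
  qed
  have irr: "irreducible_in (polys_over ?A) (as_poly k f)"
    unfolding irreducible_in_def
  proof (intro conjI ballI impI as_poly)
    show "as_poly k f \<noteq> 0" using f by auto
    show "\<not> dvd_in (polys_over ?A) (as_poly k f) 1"
    proof
      assume "dvd_in (polys_over ?A) (as_poly k f) 1"
      then obtain c where "1 = as_poly k f * c" by (auto simp: dvd_in_def)
      then have "poly 1 (Var k) = f * poly c (Var k)"
        using as_poly(2)[of k f] by (metis poly_mult)
      then have "f dvd 1" by (auto intro: dvdI)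
      then show False using f by (simp add: irreducible_def)
    qed
    fix a b assume ab: "a \<in> polys_over ?A" "b \<in> polys_over ?A" "as_poly k f = a * b"
    then have "f = poly a (Var k) * poly b (Var k)" using as_poly(2)[of k f] by simp
    then have "poly a (Var k) dvd 1 \<or> poly b (Var k) dvd 1" using f unfolding irreducible_def by blast
    then show "dvd_in (polys_over ?A) a 1 \<or> dvd_in (polys_over ?A) b 1" using ab unit by blast
  qed
  have "degree (as_poly k f) > 0" using f degree_as_poly_eq_0_iff by blast
  from gauss_dichotomy[OF factorial_in_Dep irr this as_poly(1)[of k g]] show ?thesis
  proof (elim disjE bexE conjE)
    assume "dvd_in (polys_over ?A) (as_poly k f) (as_poly k g)"
    then obtain c where "as_poly k g = as_poly k f * c" by (auto simp: dvd_in_def)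
    then have "g = f * poly c (Var k)" using as_poly(2) by (metis poly_mult)
    then show ?thesis by auto
  next
    fix a b r assume r: "r \<in> ?A" "r \<noteq> 0" "a * as_poly k f + b * as_poly k g = [:r:]"
    then have "poly (a * as_poly k f + b * as_poly k g) (Var k) = r" by simp
    then have "poly a (Var k) * f + poly b (Var k) * g = r" by (simp add: as_poly)
    then show ?thesis using r by blast
  qed
qed

lemma Dep_emptyI:
  assumes D: "\<And>k. f \<in> Dep (- {k})" shows "f \<in> Dep {}"
proof -
  have "f \<in> Dep (- K)" for K :: "'a set"
  proof -
    have "finite K" by simp
    then show ?thesis
    proof (induction K rule: finite_induct)
      case (insert k K)
      show ?case
        unfolding Dep_def
      proof (intro CollectI allI impI)
        fix y z :: "complex ^ 'a" assume yz: "\<forall>i\<in>- insert k K. y $ i = z $ i"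
        have "papply f y = papply f (upd y k (z $ k))" by (rule DepD[OF D[of k]]) auto
        also have "\<dots> = papply f z" by (rule DepD[OF insert.IH]) (use yz in auto)
        finally show "papply f y = papply f z" .
      qed
    qed simp
  qed
  from this[of UNIV] show ?thesis by simp
qed

lemma ex_not_Dep:
  assumes "\<not> f dvd 1" "f \<noteq> 0"
  shows "\<exists>k. f \<notin> Dep (- {k})"
  using assms Dep_emptyI Dep_empty_unit by blast

text \<open>Choose y where neither r nor the leading coefficient of f in the variable k vanishes.
  Along the line in direction k, f is then a non-constant polynomial and has a root, while r does
  not change.\<close>

lemma no_elimination:
  assumes f: "f \<notin> Dep (- {k})" and r: "r \<in> Dep (- {k})" "r \<noteq> 0"
  shows "\<exists>y. papply f y = 0 \<and> papply r y \<noteq> 0"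
proof -
  define P where "P = as_poly k f"
  have P: "P \<in> polys_over (Dep (- {k}))" "f = poly P (Var k)" by (simp_all add: P_def as_poly)
  have deg: "degree P > 0" using f degree_as_poly_eq_0_iff by (auto simp: P_def)
  then have "r * lead_coeff P \<noteq> 0" using r by auto
  then obtain y where y: "papply r y \<noteq> 0" "papply (lead_coeff P) y \<noteq> 0"
    by (auto simp: pfun_eq_0_iff)
  let ?p = "map_poly (\<lambda>c. papply c y) P"
  have "coeff ?p (degree P) \<noteq> 0" using y by (simp add: coeff_map_poly)
  then have "degree ?p > 0" using deg le_degree by fastforce
  then obtain t where t: "poly ?p t = 0"
    using fundamental_theorem_of_algebra[of ?p] constant_degree[of ?p] by auto
  have "papply f (upd y k t) = 0" unfolding P(2) using papply_upd_poly[OF P(1)] t by simp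
  moreover have "papply r (upd y k t) = papply r y" by (rule DepD[OF r(1)]) auto
  ultimately show ?thesis using y by metis
qed

section \<open>Partial derivatives and the chain rule\<close>

definition pd :: "'m::finite \<Rightarrow> 'm pfun \<Rightarrow> 'm pfun" where
  "pd k f = poly (pderiv (as_poly k f)) (Var k)"

lemma pderiv_polys_over:
  assumes "P \<in> polys_over (Dep J)" shows "pderiv P \<in> polys_over (Dep J)"
  using assms by (auto simp: polys_over_def coeff_pderiv Dep_def simp del: of_nat_Suc)

lemma as_poly_pd: "as_poly k (pd k f) = pderiv (as_poly k f)"
  unfolding pd_def by (intro as_poly_eqI pderiv_polys_over as_poly refl)

lemma pd_nonzero: "f \<notin> Dep (- {k}) \<Longrightarrow> pd k f \<noteq> 0"
  using as_poly_pd[of k f] degree_as_poly_eq_0_iff[of k f]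
  by (auto simp: pderiv_eq_0_iff simp flip: as_poly_eq_0_iff[of k])

lemma degree_pd: "degree (as_poly k (pd k f)) = degree (as_poly k f) - 1"
  by (simp add: as_poly_pd degree_pderiv)

text \<open>The derivative is non-zero and has smaller degree in k than f. Applied to \<Delta>, this
  keeps the gradient from vanishing on the whole image of \<psi>.\<close>

lemma not_dvd_pd:
  assumes "f \<notin> Dep (- {k})" shows "\<not> f dvd pd k f"
proof
  assume "f dvd pd k f"
  then obtain q where q: "pd k f = f * q" by (auto elim: dvdE)
  have nz: "f * q \<noteq> 0" using q pd_nonzero[OF assms] by metis
  have "degree (as_poly k (pd k f)) = degree (as_poly k f) + degree (as_poly k q)"
    using nz unfolding q as_poly_mult by (intro degree_mult_eq) auto
  moreover have "degree (as_poly k f) > 0" using assms degree_as_poly_eq_0_iff by blast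
  ultimately show False using degree_pd[of k f] by simp
qed

lemma pd_upd:
  "((\<lambda>t. papply f (upd y k t)) has_field_derivative papply (pd k f) (upd y k t)) (at t)"
proof -
  let ?m = "map_poly (\<lambda>c. papply c y)"
  have "pderiv (?m (as_poly k f)) = ?m (pderiv (as_poly k f))"
    by (intro poly_eqI) (simp add: coeff_pderiv coeff_map_poly del: of_nat_Suc)
  moreover have "papply (pd k f) (upd y k t) = poly (?m (pderiv (as_poly k f))) t"
    unfolding pd_def by (rule papply_upd_poly[where J = "- {k}"]) (auto intro: pderiv_polys_over as_poly)
  ultimately have "papply (pd k f) (upd y k t) = poly (pderiv (?m (as_poly k f))) t" by simp
  moreover have "papply f (upd y k s) = poly (?m (as_poly k f)) s" for s
    using papply_upd_poly[OF as_poly(1)[of k f], of k y s] by (simp add: as_poly)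
  ultimately show ?thesis by (simp add: poly_DERIV)
qed

text \<open>\<open>pd\<close> is defined through \<open>as_poly\<close> and not by recursion on f,
  so the induction only yields some coefficients d. In \<open>chain_rule\<close> the coordinate
  lines identify them with the partial derivatives.\<close>

lemma chain_rule_ex:
  "\<exists>d :: 'm \<Rightarrow> 'm::finite pfun. \<forall>c c' t. (\<forall>k. ((\<lambda>t. c t $ k) has_field_derivative c' k) (at t)) \<longrightarrow>
     ((\<lambda>t. papply f (c t)) has_field_derivative (\<Sum>k\<in>UNIV. papply (d k) (c t) * c' k)) (at t)"
proof (induction f rule: pfun_induct)
  case (Cst a)
  show ?case by (rule exI[of _ "\<lambda>_. 0"]) simp
next
  case (Var i)
  show ?case
    by (rule exI[of _ "\<lambda>k. if k = i then 1 else 0"]) (simp add: if_distrib if_distribR cong: if_cong)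
next
  case (add f g)
  then obtain d e where
    "\<forall>c c' t. (\<forall>k. ((\<lambda>t. c t $ k) has_field_derivative c' k) (at t)) \<longrightarrow>
     ((\<lambda>t. papply f (c t)) has_field_derivative (\<Sum>k\<in>UNIV. papply (d k) (c t) * c' k)) (at t)"
    "\<forall>c c' t. (\<forall>k. ((\<lambda>t. c t $ k) has_field_derivative c' k) (at t)) \<longrightarrow>
     ((\<lambda>t. papply g (c t)) has_field_derivative (\<Sum>k\<in>UNIV. papply (e k) (c t) * c' k)) (at t)"
    by blast
  then show ?case
    by (intro exI[of _ "\<lambda>k. d k + e k"]) (auto simp: distrib_right sum.distrib intro!: DERIV_add)
next
  case (mult f g)
  then obtain d e where d:
    "\<And>c c' t. (\<forall>k. ((\<lambda>t. c t $ k) has_field_derivative c' k) (at t)) \<Longrightarrow>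
     ((\<lambda>t. papply f (c t)) has_field_derivative (\<Sum>k\<in>UNIV. papply (d k) (c t) * c' k)) (at t)"
    and e: "\<And>c c' t. (\<forall>k. ((\<lambda>t. c t $ k) has_field_derivative c' k) (at t)) \<Longrightarrow>
     ((\<lambda>t. papply g (c t)) has_field_derivative (\<Sum>k\<in>UNIV. papply (e k) (c t) * c' k)) (at t)"
    by blast
  show ?case
  proof (rule exI[of _ "\<lambda>k. d k * g + e k * f"], intro allI impI)
    fix c :: "complex \<Rightarrow> complex ^ 'm" and c' t
    assume "\<forall>k. ((\<lambda>t. c t $ k) has_field_derivative c' k) (at t)"
    from DERIV_mult[OF d[OF this] e[OF this]]
    show "((\<lambda>t. papply (f * g) (c t)) has_field_derivative
        (\<Sum>k\<in>UNIV. papply (d k * g + e k * f) (c t) * c' k)) (at t)"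
      by (simp add: algebra_simps sum.distrib sum_distrib_left)
  qed
qed

theorem chain_rule:
  assumes "\<And>k. ((\<lambda>t. c t $ k) has_field_derivative c' k) (at t)"
  shows "((\<lambda>t. papply f (c t)) has_field_derivative (\<Sum>k\<in>UNIV. papply (pd k f) (c t) * c' k)) (at t)"
proof -
  from chain_rule_ex[of f] obtain d where d:
    "\<And>c c' t. (\<forall>k. ((\<lambda>t. c t $ k) has_field_derivative c' k) (at t)) \<Longrightarrow>
     ((\<lambda>t. papply f (c t)) has_field_derivative (\<Sum>k\<in>UNIV. papply (d k) (c t) * c' k)) (at t)"
    by blast
  have "papply (pd k f) y = papply (d k) y" for k y
  proof -
    have "((\<lambda>t. upd y k t $ i) has_field_derivative (if i = k then 1 else 0)) (at t)" for i t
      by (cases "i = k") auto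
    then have "((\<lambda>t. papply f (upd y k t)) has_field_derivative
        (\<Sum>i\<in>UNIV. papply (d i) (upd y k (y $ k)) * (if i = k then 1 else 0))) (at (y $ k))"
      by (intro d) blast
    then have "((\<lambda>t. papply f (upd y k t)) has_field_derivative papply (d k) y) (at (y $ k))"
      by (simp add: if_distrib cong: if_cong)
    moreover have "((\<lambda>t. papply f (upd y k t)) has_field_derivative papply (pd k f) y) (at (y $ k))"
      using pd_upd[of f y k "y $ k"] by simp
    ultimately show ?thesis using DERIV_unique by blast
  qed
  then show ?thesis using d[of c c' t] assms by simp
qed

text \<open>Where L is non-zero, h agrees with an element of the polynomial ring localized at L;
  elsewhere its value is arbitrary, so that inverses of 0 do no harm.\<close>

definition rat :: "'m::finite pfun \<Rightarrow> (complex ^ 'm \<Rightarrow> complex) \<Rightarrow> bool" where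
  "rat L h \<longleftrightarrow> (\<exists>Q N. \<forall>u. papply L u \<noteq> 0 \<longrightarrow> h u * papply L u ^ N = papply Q u)"

lemma rat_papply: "rat L (papply f)"
  unfolding rat_def by (rule exI[of _ f], rule exI[of _ 0]) simp

lemma rat_const: "rat L (\<lambda>_. c)"
  using rat_papply[of L "Cst c"] by (simp add: Cst.rep_eq)

lemma rat_add:
  assumes "rat L g" "rat L h" shows "rat L (\<lambda>u. g u + h u)"
proof -
  from assms obtain P M Q N where
    "\<forall>u. papply L u \<noteq> 0 \<longrightarrow> g u * papply L u ^ M = papply P u"
    "\<forall>u. papply L u \<noteq> 0 \<longrightarrow> h u * papply L u ^ N = papply Q u" unfolding rat_def by blast
  then have "papply L u \<noteq> 0 \<longrightarrow> (g u + h u) * papply L u ^ (M + N) = papply (P * L ^ N + Q * L ^ M) u" for u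
    by (auto simp: power_add algebra_simps) (metis mult.assoc mult.commute)
  then show ?thesis unfolding rat_def by blast
qed

lemma rat_mult:
  assumes "rat L g" "rat L h" shows "rat L (\<lambda>u. g u * h u)"
proof -
  from assms obtain P M Q N where
    *: "\<And>u. papply L u \<noteq> 0 \<Longrightarrow> g u * papply L u ^ M = papply P u"
    "\<And>u. papply L u \<noteq> 0 \<Longrightarrow> h u * papply L u ^ N = papply Q u" unfolding rat_def by blast
  have "papply L u \<noteq> 0 \<longrightarrow> (g u * h u) * papply L u ^ (M + N) = papply (P * Q) u" for u
  proof
    assume u: "papply L u \<noteq> 0"
    have "(g u * h u) * papply L u ^ (M + N) = (g u * papply L u ^ M) * (h u * papply L u ^ N)"
      by (simp only: power_add ac_simps)
    then show "(g u * h u) * papply L u ^ (M + N) = papply (P * Q) u" using *[OF u] by simp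
  qed
  then show ?thesis unfolding rat_def by blast
qed

lemma rat_power: "rat L h \<Longrightarrow> rat L (\<lambda>u. h u ^ n)"
  by (induction n) (auto intro: rat_const rat_mult)

lemma rat_prod: "(\<And>i. i \<in> I \<Longrightarrow> rat L (h i)) \<Longrightarrow> rat L (\<lambda>u. \<Prod>i\<in>I. h i u)"
  by (induction I rule: infinite_finite_induct) (auto intro: rat_const rat_mult)

lemma rat_inverse_factor:
  assumes "l dvd L" shows "rat L (\<lambda>u. inverse (papply l u))"
proof -
  from assms obtain r where "L = l * r" by (auto elim: dvdE)
  then have "\<forall>u. papply L u \<noteq> 0 \<longrightarrow> inverse (papply l u) * papply L u ^ 1 = papply r u"
    by (auto simp: field_simps)
  then show ?thesis unfolding rat_def by blast
qed

lemma rat_power_int_factor: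
  assumes "l dvd L" shows "rat L (\<lambda>u. papply l u powi n)"
proof (cases "n \<ge> 0")
  case True
  then show ?thesis
    using rat_power[OF rat_papply[of L l]] by (simp add: power_int_def)
next
  case False
  then show ?thesis
    using rat_power[OF rat_inverse_factor[OF assms]] by (simp add: power_int_def)
qed

lemma rat_compose:
  assumes "\<And>k. rat L (h k)"
  shows "rat L (\<lambda>u. papply f (\<chi> k. h k u))"
  by (induction f rule: pfun_induct) (auto intro: rat_const rat_add rat_mult assms)

text \<open>Clearing denominators gives polynomials with P * Q * L = 0 everywhere, and polynomial
  functions form a domain. The lemma expresses that the open set where L is non-zero is irreducible,
  which is behind all arguments at generic points.\<close>

lemma rat_mult_eq_0:
  assumes "L \<noteq> 0" "rat L g" "rat L h"
    and "\<And>u. papply L u \<noteq> 0 \<Longrightarrow> g u * h u = 0"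
  shows "(\<forall>u. papply L u \<noteq> 0 \<longrightarrow> g u = 0) \<or> (\<forall>u. papply L u \<noteq> 0 \<longrightarrow> h u = 0)"
proof -
  from assms obtain P M Q N where
    *: "\<And>u. papply L u \<noteq> 0 \<Longrightarrow> g u * papply L u ^ M = papply P u"
    "\<And>u. papply L u \<noteq> 0 \<Longrightarrow> h u * papply L u ^ N = papply Q u" unfolding rat_def by blast
  have "papply P u * papply Q u = 0" if "papply L u \<noteq> 0" for u
    using assms(4)[OF that] *[OF that] by (metis mult_eq_0_iff)
  then have "P * Q * L = 0" by (intro pfun_eqI) (metis papply_mult papply_zero mult_eq_0_iff)
  then have "P = 0 \<or> Q = 0" using assms(1) by simp
  then show ?thesis using * by (metis mult_eq_0_iff papply_zero power_not_zero)
qed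

lemma rat_prod_nonzero:
  assumes "L \<noteq> 0" "finite I" "\<And>i. i \<in> I \<Longrightarrow> rat L (h i)"
    and "\<And>i. i \<in> I \<Longrightarrow> \<exists>u. papply L u \<noteq> 0 \<and> h i u \<noteq> 0"
  shows "\<exists>u. papply L u \<noteq> 0 \<and> (\<forall>i\<in>I. h i u \<noteq> 0)"
proof -
  have "\<exists>u. papply L u \<noteq> 0 \<and> (\<Prod>i\<in>I. h i u) \<noteq> 0"
    using assms(2-4)
  proof (induction I rule: finite_induct)
    case empty
    then show ?case using \<open>L \<noteq> 0\<close> by (auto simp: pfun_eq_0_iff)
  next
    case (insert i I)
    then have r: "rat L (h i)" "rat L (\<lambda>u. \<Prod>i\<in>I. h i u)" by (auto intro: rat_prod)
    show ?case
    proof (rule ccontr)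
      assume "\<not> ?thesis"
      then have "h i u * (\<Prod>i\<in>I. h i u) = 0" if "papply L u \<noteq> 0" for u
        using that insert.hyps by auto
      from rat_mult_eq_0[OF \<open>L \<noteq> 0\<close> r this] show False using insert by blast
    qed
  qed
  then show ?thesis using assms(2) by auto
qed

section \<open>Algebraic dependence\<close>

text \<open>Elimination, with equations indexed by J and unknowns by I: equation j0 is solved for an
  unknown i0 with non-zero coefficient, and the remaining equations in the remaining unknowns are
  solved by induction.\<close>

lemma nontrivial_linear_solution:
  fixes a :: "'i \<Rightarrow> 'j \<Rightarrow> complex"
  assumes "finite J" "finite I" "card J < card I"
  shows "\<exists>x. (\<exists>i\<in>I. x i \<noteq> 0) \<and> (\<forall>j\<in>J. (\<Sum>i\<in>I. x i * a i j) = 0)"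
  using assms
proof (induction J arbitrary: I a rule: finite_induct)
  case empty
  then have "I \<noteq> {}" by auto
  then show ?case by (intro exI[of _ "\<lambda>_. 1"]) auto
next
  case (insert j0 J)
  show ?case
  proof (cases "\<forall>i\<in>I. a i j0 = 0")
    case True
    have "card J < card I" using insert by simp
    from insert.IH[OF insert.prems(1) this, of a] obtain x where
      "\<exists>i\<in>I. x i \<noteq> 0" "\<forall>j\<in>J. (\<Sum>i\<in>I. x i * a i j) = 0" by blast
    then show ?thesis using True by (intro exI[of _ x]) auto
  next
    case False
    then obtain i0 where i0: "i0 \<in> I" "a i0 j0 \<noteq> 0" by blast
    define I' where "I' = I - {i0}"
    have I: "I = insert i0 I'" "i0 \<notin> I'" "finite I'" using i0 insert by (auto simp: I'_def)
    have "card J < card I'" using insert I by auto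
    from insert.IH[OF I(3) this, of "\<lambda>i j. a i j - a i j0 / a i0 j0 * a i0 j"] obtain x where
      x: "\<exists>i\<in>I'. x i \<noteq> 0" "\<forall>j\<in>J. (\<Sum>i\<in>I'. x i * (a i j - a i j0 / a i0 j0 * a i0 j)) = 0" by blast
    define s where "s = (\<Sum>i\<in>I'. x i * a i j0)"
    define z where "z = (\<lambda>i. if i = i0 then - s / a i0 j0 else x i)"
    have sum: "(\<Sum>i\<in>I. z i * a i j) = - s / a i0 j0 * a i0 j + (\<Sum>i\<in>I'. x i * a i j)" for j
    proof -
      have "(\<Sum>i\<in>I'. z i * a i j) = (\<Sum>i\<in>I'. x i * a i j)"
        using I by (intro sum.cong) (auto simp: z_def)
      then show ?thesis using I by (simp add: z_def)
    qed
    have "(\<Sum>i\<in>I. z i * a i j) = 0" if "j \<in> J" for j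
    proof -
      have "0 = (\<Sum>i\<in>I'. x i * (a i j - a i j0 / a i0 j0 * a i0 j))" using x that by simp
      also have "\<dots> = (\<Sum>i\<in>I'. x i * a i j) - (\<Sum>i\<in>I'. x i * a i j0 * (a i0 j / a i0 j0))"
        by (simp add: algebra_simps sum_subtractf)
      also have "(\<Sum>i\<in>I'. x i * a i j0 * (a i0 j / a i0 j0)) = s * (a i0 j / a i0 j0)"
        unfolding s_def by (simp add: sum_distrib_right sum_divide_distrib)
      finally show ?thesis unfolding sum by simp
    qed
    moreover have "(\<Sum>i\<in>I. z i * a i j0) = 0" unfolding sum using i0 by (simp add: s_def)
    moreover have "\<exists>i\<in>I. z i \<noteq> 0" using x I by (auto simp: z_def)
    ultimately show ?thesis by (intro exI[of _ z]) auto
  qed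
qed

section \<open>Boxes of exponents\<close>

lemma card_vec_box:
  fixes S :: "'m::finite \<Rightarrow> 'a set"
  assumes "\<And>k. finite (S k)"
  shows "finite {b :: 'a ^ 'm. \<forall>k. b $ k \<in> S k}"
    and "card {b :: 'a ^ 'm. \<forall>k. b $ k \<in> S k} = (\<Prod>k\<in>UNIV. card (S k))"
proof -
  have eq: "{b :: 'a ^ 'm. \<forall>k. b $ k \<in> S k} = vec_lambda ` (PiE UNIV S)"
  proof (intro equalityI subsetI)
    fix b :: "'a ^ 'm" assume "b \<in> {b. \<forall>k. b $ k \<in> S k}"
    then have "b = vec_lambda (($) b)" "($) b \<in> PiE UNIV S" by (auto simp: vec_lambda_eta)
    then show "b \<in> vec_lambda ` (PiE UNIV S)" by blast
  qed auto
  have inj: "inj_on vec_lambda (PiE UNIV S)" by (auto simp: inj_on_def vec_eq_iff)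
  show "finite {b :: 'a ^ 'm. \<forall>k. b $ k \<in> S k}"
    unfolding eq using assms by (intro finite_imageI finite_PiE) auto
  show "card {b :: 'a ^ 'm. \<forall>k. b $ k \<in> S k} = (\<Prod>k\<in>UNIV. card (S k))"
    unfolding eq using inj by (simp add: card_image card_PiE)
qed

text \<open>The degree is bounded in each variable separately, so that supports lie in boxes and are
  counted by powers.\<close>

definition exp_le :: "nat \<Rightarrow> 'm::finite pfun \<Rightarrow> bool" where
  "exp_le E f \<longleftrightarrow> (\<exists>p. f = pf_of p \<and> (\<forall>a\<in>keys p. \<forall>k. a $ k \<le> E))"

lemma exp_le_mono:
  assumes "exp_le E f" "E \<le> E'" shows "exp_le E' f"
proof -
  from assms obtain p where "f = pf_of p" "\<forall>a\<in>keys p. \<forall>k. a $ k \<le> E"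
    unfolding exp_le_def by blast
  then show ?thesis unfolding exp_le_def using assms(2) le_trans by blast
qed

lemma ex_exp_le: "\<exists>E. exp_le E f"
proof -
  obtain p where p: "f = pf_of p" using pf_of_surj by blast
  define E where "E = (\<Sum>a\<in>keys p. \<Sum>k\<in>UNIV. a $ k)"
  have "a $ k \<le> E" if a: "a \<in> keys p" for a k
  proof -
    have "a $ k \<le> (\<Sum>k\<in>UNIV. a $ k)" by (rule member_le_sum) auto
    also have "\<dots> \<le> E" unfolding E_def using a by (intro member_le_sum) auto
    finally show ?thesis .
  qed
  then show ?thesis using p unfolding exp_le_def by blast
qed

lemma exp_le_mult:
  assumes "exp_le E f" "exp_le E' g" shows "exp_le (E + E') (f * g)"
proof -
  from assms obtain p q where pq: "f = pf_of p" "\<forall>a\<in>keys p. \<forall>k. a $ k \<le> E"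
    "g = pf_of q" "\<forall>a\<in>keys q. \<forall>k. a $ k \<le> E'" unfolding exp_le_def by blast
  have "\<forall>a\<in>keys (p * q). \<forall>k. a $ k \<le> E + E'"
    using keys_mult[of p q] pq by (fastforce intro: add_mono)
  then show ?thesis unfolding exp_le_def using pq pf_of_mult by metis
qed

lemma exp_le_one: "exp_le 0 1"
  unfolding exp_le_def by (rule exI[of _ 1]) (simp add: pf_of_1)

lemma exp_le_power: "exp_le E f \<Longrightarrow> exp_le (n * E) (f ^ n)"
  by (induction n) (auto intro: exp_le_mult exp_le_one)

lemma exp_le_prod:
  assumes "finite I" "\<And>i. i \<in> I \<Longrightarrow> exp_le E (f i)"
  shows "exp_le (card I * E) (prod f I)"
  using assms by (induction I rule: finite_induct) (auto intro: exp_le_mult exp_le_one)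

text \<open>Where u_j = 1 the exponent at j may be replaced by 0. The box of exponents loses one
  dimension, and the coefficients c do not depend on u.\<close>

lemma exp_le_restrict:
  assumes "exp_le E f"
  shows "\<exists>c. \<forall>u. u $ j = 1 \<longrightarrow>
    papply f u = (\<Sum>b | \<forall>k. b $ k \<in> (if k = j then {0} else {..E}). c b * nat_monom u b)"
proof -
  let ?J = "{b :: nat ^ 'a. \<forall>k. b $ k \<in> (if k = j then {0} else {..E})}"
  have fin: "finite ?J" by (rule card_vec_box) auto
  from assms obtain p where p: "f = pf_of p" "\<forall>a\<in>keys p. \<forall>k. a $ k \<le> E"
    unfolding exp_le_def by blast
  have main: "papply f u = (\<Sum>b\<in>?J. (\<Sum>a\<in>keys p.
      if b = upd a j 0 then lookup p a else 0) * nat_monom u b)" if u: "u $ j = 1" for u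
  proof -
    have mon: "nat_monom u a = nat_monom u (upd a j 0)" for a
      unfolding nat_monom_def using u by (intro prod.cong) auto
    have "papply f u = (\<Sum>a\<in>keys p. lookup p a * nat_monom u (upd a j 0))"
      using p mon by (simp add: mpoly_eval_eq char_sum_def)
    also have "\<dots> = (\<Sum>a\<in>keys p. \<Sum>b\<in>?J.
        (if b = upd a j 0 then lookup p a else 0) * nat_monom u b)"
    proof (rule sum.cong)
      fix a assume a: "a \<in> keys p"
      have "upd a j 0 \<in> ?J" using p(2) a by auto
      then show "lookup p a * nat_monom u (upd a j 0) =
          (\<Sum>b\<in>?J. (if b = upd a j 0 then lookup p a else 0) * nat_monom u b)"
        using fin by (subst sum.remove[of _ "upd a j 0"]) auto
    qed simp
    also have "\<dots> = (\<Sum>b\<in>?J. (\<Sum>a\<in>keys p.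
        if b = upd a j 0 then lookup p a else 0) * nat_monom u b)"
      by (subst sum.swap) (simp add: sum_distrib_right)
    finally show ?thesis .
  qed
  show ?thesis by (intro exI allI impI) (rule main)
qed

text \<open>By counting monomials: setting \<open>u $ j\<close> to 1 leaves only \<open>CARD('m) - 1\<close> variables.\<close>

theorem algebraic_dependence:
  fixes B :: "'m::finite \<Rightarrow> 'm pfun"
  shows "\<exists>R. R \<noteq> 0 \<and> (\<forall>u. u $ j = 1 \<longrightarrow> papply L u \<noteq> 0 \<longrightarrow>
    papply R (\<chi> k. papply (B k) u / papply L u) = 0)"
proof -
  define m where "m = CARD('m)"
  have m: "m > 0" by (simp add: m_def)
  have "\<forall>k. \<exists>e. exp_le e (B k)" using ex_exp_le by blast
  then obtain e where e: "\<And>k. exp_le (e k) (B k)" by metis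
  obtain e' where e': "exp_le e' L" using ex_exp_le by blast
  define E where "E = e' + (\<Sum>k\<in>UNIV. e k)"
  have BE: "exp_le E (B k)" for k
    using e[of k] by (rule exp_le_mono) (auto simp: E_def intro!: trans_le_add2 member_le_sum)
  have LE: "exp_le E L" using e' by (rule exp_le_mono) (simp add: E_def)
  \<comment> \<open>J will have at most ((m * E + 1) * (D + 1)) ^ (m - 1) elements. This choice
    turns the bound into D * (D + 1) ^ (m - 1), which is less than the (D + 1) ^ m exponents in
    I.\<close>
  define D where "D = (m * E + 1) ^ (m - 1)"
  define I where "I = {a :: nat ^ 'm. \<forall>k. a $ k \<in> {..D}}"
  define E' where "E' = m * (D * E)"
  define J where "J = {b :: nat ^ 'm. \<forall>k. b $ k \<in> (if k = j then {0} else {..E'})}"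
  have fI: "finite I" unfolding I_def by (rule card_vec_box) auto
  have fJ: "finite J" unfolding J_def by (rule card_vec_box) auto
  have cI: "card I = (D + 1) ^ m" unfolding I_def m_def by (subst card_vec_box(2)) auto
  have "card J = (\<Prod>k\<in>UNIV. card (if k = j then {0} else {..E'}))"
    unfolding J_def by (rule card_vec_box) auto
  also have "\<dots> = (\<Prod>k\<in>UNIV - {j}. E' + 1)"
    by (subst prod.remove[of _ j]) (auto intro!: prod.cong)
  also have "\<dots> = (E' + 1) ^ (m - 1)" by (simp add: m_def card_Diff_singleton)
  also have "\<dots> \<le> ((m * E + 1) * (D + 1)) ^ (m - 1)"
    by (rule power_mono) (auto simp: E'_def algebra_simps)
  also have "\<dots> = D * (D + 1) ^ (m - 1)" by (simp only: power_mult_distrib D_def)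
  also have "\<dots> < (D + 1) * (D + 1) ^ (m - 1)" by simp
  also have "\<dots> = card I" using m by (simp add: cI power_eq_if)
  finally have less: "card J < card I" .
  \<comment> \<open>The monomial with exponent a in the fractions \<open>B k\<close> / L, multiplied
    by \<open>L ^ (m * D)\<close> to clear all denominators.\<close>
  define T where "T = (\<lambda>a :: nat ^ 'm. \<Prod>k\<in>UNIV. B k ^ (a $ k) * L ^ (D - a $ k))"
  have TE: "exp_le E' (T a)" if a: "a \<in> I" for a
    unfolding T_def E'_def m_def
  proof (rule exp_le_prod)
    fix k
    have "a $ k * E + (D - a $ k) * E = D * E"
      using a by (simp add: I_def add_mult_distrib[symmetric])
    then show "exp_le (D * E) (B k ^ (a $ k) * L ^ (D - a $ k))"
      using exp_le_mult[OF exp_le_power[OF BE, of "a $ k" k] exp_le_power[OF LE, of "D - a $ k"]] by simp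
  qed simp
  have "\<forall>a\<in>I. \<exists>c. \<forall>u. u $ j = 1 \<longrightarrow> papply (T a) u = (\<Sum>b\<in>J. c b * nat_monom u b)"
    using exp_le_restrict[OF TE] unfolding J_def by blast
  then obtain c where c: "\<And>a u. a \<in> I \<Longrightarrow> u $ j = 1 \<Longrightarrow> papply (T a) u = (\<Sum>b\<in>J. c a b * nat_monom u b)"
    by metis
  from nontrivial_linear_solution[OF fJ fI less, of c] obtain x where
    x: "\<exists>a\<in>I. x a \<noteq> 0" "\<forall>b\<in>J. (\<Sum>a\<in>I. x a * c a b) = 0" by blast
  define p where "p = (\<Sum>a\<in>I. single a (x a))"
  have lookup: "lookup p a = x a" if "a \<in> I" for a
    unfolding p_def using that fI by (simp add: lookup_sum lookup_single when_def)
  have "p \<noteq> 0" using x(1) lookup by fastforce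
  moreover have "papply (pf_of p) (\<chi> k. papply (B k) u / papply L u) = 0"
    if u: "u $ j = 1" "papply L u \<noteq> 0" for u
  proof -
    let ?l = "papply L u"
    have "papply (pf_of p) (\<chi> k. papply (B k) u / ?l) * ?l ^ (m * D) =
        (\<Sum>a\<in>I. x a * (nat_monom (\<chi> k. papply (B k) u / ?l) a * ?l ^ (m * D)))"
      unfolding p_def by (simp add: mpoly_eval_eq char_sum_sum sum_distrib_right mult.assoc)
    also have "\<dots> = (\<Sum>a\<in>I. x a * papply (T a) u)"
    proof (rule sum.cong)
      fix a assume a: "a \<in> I"
      have "?l ^ (m * D) = (\<Prod>k\<in>(UNIV :: 'm set). ?l ^ D)"
        by (simp add: m_def power_mult[symmetric] mult.commute)
      then have "nat_monom (\<chi> k. papply (B k) u / ?l) a * ?l ^ (m * D) =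
          (\<Prod>k\<in>UNIV. (papply (B k) u / ?l) ^ (a $ k) * ?l ^ D)"
        by (simp add: nat_monom_def prod.distrib)
      also have "\<dots> = papply (T a) u"
        unfolding T_def papply_prod
      proof (rule prod.cong)
        fix k
        have "?l ^ D = ?l ^ (a $ k) * ?l ^ (D - a $ k)"
          using a by (simp add: I_def power_add[symmetric])
        then show "(papply (B k) u / ?l) ^ (a $ k) * ?l ^ D = papply (B k ^ (a $ k) * L ^ (D - a $ k)) u"
          using u by (simp add: power_divide)
      qed simp
      finally show "x a * (nat_monom (\<chi> k. papply (B k) u / ?l) a * ?l ^ (m * D)) = x a * papply (T a) u"
        by simp
    qed simp
    also have "\<dots> = (\<Sum>b\<in>J. (\<Sum>a\<in>I. x a * c a b) * nat_monom u b)"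
      using u by (simp add: c sum_distrib_left sum_distrib_right mult.assoc)
        (rule sum.swap)
    also have "\<dots> = 0" using x by simp
    finally show ?thesis using u by simp
  qed
  ultimately show ?thesis by (intro exI[of _ "pf_of p"]) auto
qed

section \<open>The Horn-Kapranov parametrization\<close>

definition linp :: "int ^ 'm::finite ^ 'n::finite \<Rightarrow> 'n \<Rightarrow> 'm pfun" where
  "linp C i = (\<Sum>k\<in>UNIV. Cst (of_int (C $ i $ k)) * Var k)"

lemma papply_linp [simp]: "papply (linp C i) u = lin_form C i u"
  by (simp add: linp_def lin_form_def)

lemma linp_nonzero:
  assumes "row i C \<noteq> 0" shows "linp C i \<noteq> 0"
proof -
  obtain k where k: "C $ i $ k \<noteq> 0" using assms by (auto simp: vec_eq_iff row_def)
  have "papply (linp C i) (axis k 1) = of_int (C $ i $ k)"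
    by (simp add: lin_form_def axis_def if_distrib cong: if_cong)
  then show ?thesis using k by (auto simp: pfun_eq_0_iff intro!: exI[of _ "axis k 1"])
qed

lemma lin_form_add_scale: "lin_form C i (u + t *s v) = lin_form C i u + t * lin_form C i v"
  by (simp add: lin_form_def algebra_simps sum.distrib sum_distrib_left)

lemma lin_form_scale: "lin_form C i (t *s v) = t * lin_form C i v"
  using lin_form_add_scale[of C i 0 t v] by (simp add: lin_form_def)

lemma power_int_sum:
  fixes c :: complex
  assumes "c \<noteq> 0"
  shows "(\<Prod>i\<in>I. c powi f i) = c powi (\<Sum>i\<in>I. f i)"
  using assms by (induction I rule: infinite_finite_induct) (auto simp: power_int_add)

lemma DERIV_prod_log:
  fixes f :: "'i \<Rightarrow> complex \<Rightarrow> complex"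
  assumes "\<And>i. i \<in> I \<Longrightarrow> (f i has_field_derivative f i t * a i) (at t)"
  shows "((\<lambda>t. \<Prod>i\<in>I. f i t) has_field_derivative (\<Prod>i\<in>I. f i t) * (\<Sum>i\<in>I. a i)) (at t)"
  using assms
proof (induction I rule: infinite_finite_induct)
  case (insert i I)
  have "((\<lambda>t. f i t * (\<Prod>i\<in>I. f i t)) has_field_derivative
      f i t * a i * (\<Prod>i\<in>I. f i t) + (\<Prod>i\<in>I. f i t) * (\<Sum>i\<in>I. a i) * f i t) (at t)"
    using insert by (intro DERIV_mult) auto
  then show ?case using insert.hyps by (simp add: algebra_simps)
qed auto

text \<open>F is known to vanish only where L does not. By continuity L is non-zero near the base
  point, and the derivative depends on nothing else.\<close>

lemma zero_near_imp_deriv_0: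
  assumes "(F has_field_derivative d) (at 0)" and "papply L u \<noteq> 0"
    and "\<And>t. papply L (u + t *s v) \<noteq> 0 \<Longrightarrow> F t = 0"
  shows "d = 0"
proof -
  obtain P where P: "\<And>t. papply L (u + t *s v) = poly P t" using papply_line by blast
  have "poly P 0 \<noteq> 0" using P[of 0] assms(2) by simp
  then have "eventually (\<lambda>t. poly P t \<noteq> 0) (at 0)"
    by (intro tendsto_imp_eventually_ne[of _ "poly P 0"] isContD poly_isCont)
  then have "eventually (\<lambda>t. F t = 0) (at 0)"
    by (rule eventually_mono) (use assms(3) P in auto)
  moreover have "F 0 = 0" using assms(2) assms(3)[of 0] by simp
  ultimately have "eventually (\<lambda>t. F t = 0) (nhds 0)"
    unfolding eventually_at_filter by (auto elim: eventually_mono)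
  then have "(F has_field_derivative d) (at 0) \<longleftrightarrow> ((\<lambda>_. 0) has_field_derivative d) (at 0)"
    by (intro DERIV_cong_ev) auto
  then have "((\<lambda>_. 0) has_field_derivative d) (at 0)" using assms(1) by simp
  then show ?thesis using DERIV_unique DERIV_const by blast
qed

definition vanishes_on_image :: "int ^ 'm::finite ^ 'n::finite \<Rightarrow> 'm pfun \<Rightarrow> bool" where
  "vanishes_on_image C f \<longleftrightarrow> (\<forall>u\<in>psi_domain C. papply f (psi C u) = 0)"

lemma vanishes_on_closure:
  assumes "vanishes_on_image C f" "y \<in> S_var C"
  shows "papply f y = 0"
proof -
  obtain p where p: "f = pf_of p" using pf_of_surj by blast
  have "psi C ` psi_domain C \<subseteq> zero_locus {p}"
    using assms(1) by (auto simp: vanishes_on_image_def zero_locus_def p)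
  then have "S_var C \<subseteq> zero_locus {p}"
    unfolding S_var_def zariski_closure_def
    by (intro hull_minimal) (auto simp: zariski_closed_def)
  then show ?thesis using assms(2) by (auto simp: zero_locus_def p)
qed

section \<open>The map \<psi>, its rational functions and its differential\<close>

locale horn_map =
  fixes C :: "int ^ 'm::finite ^ 'n::finite"
  assumes rows: "row i C \<noteq> 0" and regular: "regular C"
begin

definition L0 :: "'m pfun" where "L0 = (\<Prod>i\<in>UNIV. linp C i)"

lemma L0_nonzero: "L0 \<noteq> 0"
  using linp_nonzero[OF rows] by (simp add: L0_def)

lemma psi_domain_iff: "u \<in> psi_domain C \<longleftrightarrow> papply L0 u \<noteq> 0"
proof -
  have "lin_form C i 0 = 0" for i by (simp add: lin_form_def)
  then show ?thesis by (auto simp: psi_domain_def L0_def)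
qed

lemma linp_dvd_L0: "linp C i dvd L0"
  unfolding L0_def by (rule dvd_prodI) auto

lemma psi_nonzero: "u \<in> psi_domain C \<Longrightarrow> psi C u $ k \<noteq> 0"
  by (simp add: psi_domain_def psi_def)

lemma rat_psi: "L0 dvd L \<Longrightarrow> rat L (\<lambda>u. psi C u $ k)"
  unfolding psi_def using linp_dvd_L0
  by (auto simp flip: papply_linp intro!: rat_prod rat_power_int_factor intro: dvd_trans)

lemma rat_psi_compose: "L0 dvd L \<Longrightarrow> rat L (\<lambda>u. papply f (psi C u))"
  using rat_compose[of L "\<lambda>k u. psi C u $ k" f] rat_psi by simp

lemma sum_column: "(\<Sum>i\<in>UNIV. C $ i $ k) = 0"
  using regular by (simp add: regular_def vec_eq_iff row_def)

lemma psi_scale: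
  assumes "c \<noteq> 0" shows "psi C (c *s u) = psi C u"
proof -
  have "(\<Prod>i\<in>UNIV. c powi (C $ i $ k)) = 1" for k
    using power_int_sum[OF assms, of "\<lambda>i. C $ i $ k" UNIV] sum_column by simp
  then show ?thesis
    by (simp add: psi_def vec_eq_iff lin_form_scale power_int_mult_distrib prod.distrib)
qed

text \<open>The product of h with f composed with \<psi> is rational and vanishes where L does not,
  so \<open>rat_mult_eq_0\<close> removes the factor h. A second application, now over
  \<open>L0\<close>, removes L.\<close>

lemma vanishes_generic:
  assumes "L0 dvd L" "L \<noteq> 0" "rat L h" "\<exists>u. papply L u \<noteq> 0 \<and> h u \<noteq> 0"
    and "\<And>u. papply L u \<noteq> 0 \<Longrightarrow> h u \<noteq> 0 \<Longrightarrow> papply f (psi C u) = 0"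
  shows "vanishes_on_image C f"
proof -
  have "h u * papply f (psi C u) = 0" if "papply L u \<noteq> 0" for u using assms(5)[OF that] by auto
  from rat_mult_eq_0[OF assms(2,3) rat_psi_compose[OF assms(1)] this]
  have *: "papply f (psi C u) = 0" if "papply L u \<noteq> 0" for u
    using assms(4) that by blast
  have "papply f (psi C u) * papply L u = 0" for u using * by fastforce
  from rat_mult_eq_0[OF L0_nonzero rat_psi_compose[OF dvd_refl] rat_papply this]
  have "(\<forall>u. papply L0 u \<noteq> 0 \<longrightarrow> papply f (psi C u) = 0) \<or> (\<forall>u. papply L0 u \<noteq> 0 \<longrightarrow> papply L u = 0)" .
  moreover have "\<exists>u. papply L0 u \<noteq> 0 \<and> papply L u \<noteq> 0"
  proof -
    have "L0 * L \<noteq> 0" using assms L0_nonzero by simp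
    then show ?thesis by (auto simp: pfun_eq_0_iff)
  qed
  ultimately show ?thesis by (auto simp: vanishes_on_image_def psi_domain_iff)
qed

lemma vanishes_mult:
  assumes "vanishes_on_image C (f * g)"
  shows "vanishes_on_image C f \<or> vanishes_on_image C g"
  using rat_mult_eq_0[OF L0_nonzero rat_psi_compose[OF dvd_refl, of f] rat_psi_compose[OF dvd_refl, of g]] assms
  by (auto simp: vanishes_on_image_def psi_domain_iff)

text \<open>The derivative of log \<psi>_k at u in direction v. Its matrix, the transpose of C times
  diag(1 / l_i(u)) times C, is symmetric; by regularity it is the Hessian of the sum of the l_i log
  l_i.\<close>

definition H :: "complex ^ 'm \<Rightarrow> complex ^ 'm \<Rightarrow> 'm \<Rightarrow> complex" where
  "H u v k = (\<Sum>i\<in>UNIV. of_int (C $ i $ k) * lin_form C i v / lin_form C i u)"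

lemma DERIV_psi:
  assumes "papply L0 u \<noteq> 0"
  shows "((\<lambda>t. psi C (u + t *s v) $ k) has_field_derivative psi C u $ k * H u v k) (at 0)"
proof -
  have nz: "lin_form C i u \<noteq> 0" for i using assms by (simp add: L0_def)
  have "((\<lambda>t. (lin_form C i u + t * lin_form C i v) powi (C $ i $ k)) has_field_derivative
      (lin_form C i u + 0 * lin_form C i v) powi (C $ i $ k) *
        (of_int (C $ i $ k) * lin_form C i v / lin_form C i u)) (at 0)" for i
    using nz[of i] by (auto intro!: derivative_eq_intros simp: power_int_diff)
  from DERIV_prod_log[of UNIV, OF this] show ?thesis
    by (simp add: psi_def H_def lin_form_add_scale)
qed

text \<open>Euler's relation: \<psi> is homogeneous of degree 0, because the columns of C sum to
  0.\<close>

lemma H_self: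
  assumes "papply L0 u \<noteq> 0" shows "H u u k = 0"
proof -
  have "lin_form C i u \<noteq> 0" for i using assms by (simp add: L0_def)
  then have "H u u k = of_int (\<Sum>i\<in>UNIV. C $ i $ k)" by (simp add: H_def)
  then show ?thesis by (simp add: sum_column)
qed

lemma H_diff_scale: "H u (v - c *s w) k = H u v k - c * H u w k"
proof -
  have *: "lin_form C i (v - c *s w) = lin_form C i v - c * lin_form C i w" for i
    using lin_form_add_scale[of C i v "- c" w] by simp
  show ?thesis
    unfolding H_def * by (simp add: H_def algebra_simps sum_subtractf sum_distrib_left diff_divide_distrib)
qed

lemma H_symmetric: "(\<Sum>k\<in>UNIV. w $ k * H u v k) = (\<Sum>k\<in>UNIV. v $ k * H u w k)"
proof -
  have *: "(\<Sum>k\<in>UNIV. w $ k * H u v k) = (\<Sum>i\<in>UNIV. lin_form C i w * lin_form C i v / lin_form C i u)" for w v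
  proof -
    have "(\<Sum>k\<in>UNIV. w $ k * H u v k) =
        (\<Sum>i\<in>UNIV. \<Sum>k\<in>UNIV. of_int (C $ i $ k) * w $ k * lin_form C i v / lin_form C i u)"
      unfolding H_def sum_distrib_left by (subst sum.swap) (simp add: mult_ac)
    also have "\<dots> = (\<Sum>i\<in>UNIV. lin_form C i w * lin_form C i v / lin_form C i u)"
      unfolding lin_form_def[of C _ w] by (simp add: sum_distrib_right sum_divide_distrib)
    finally show ?thesis .
  qed
  show ?thesis unfolding * by (simp add: mult.commute)
qed

text \<open>The exponents are split by sign, \<open>nat\<close> sending negative ones to 0, so that
  \<psi>_k = \<open>num k\<close> / \<open>den k\<close>.\<close>

definition num :: "'m \<Rightarrow> 'm pfun" where
  "num k = (\<Prod>i\<in>UNIV. linp C i ^ nat (C $ i $ k))"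

definition den :: "'m \<Rightarrow> 'm pfun" where
  "den k = (\<Prod>i\<in>UNIV. linp C i ^ nat (- (C $ i $ k)))"

lemma psi_mult_den:
  assumes "papply L0 u \<noteq> 0" shows "psi C u $ k * papply (den k) u = papply (num k) u"
proof -
  have "lin_form C i u powi (C $ i $ k) * lin_form C i u ^ nat (- (C $ i $ k)) =
      lin_form C i u ^ nat (C $ i $ k)" for i
    using assms by (auto simp: L0_def power_int_def field_simps)
  then show ?thesis by (simp add: psi_def num_def den_def flip: prod.distrib)
qed

lemma den_nonzero: "papply L0 u \<noteq> 0 \<Longrightarrow> papply (den k) u \<noteq> 0"
  by (simp add: L0_def den_def)

text \<open>The two degrees differ by a column sum of C, which is 0. Since they agree, replacing u
  by a multiple in the equation y_k den k = num k only multiplies it by a power of the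
  scalar.\<close>

lemma num_den_homogeneous:
  "\<exists>e. \<forall>c u. papply (num k) (c *s u) = c ^ e * papply (num k) u \<and>
     papply (den k) (c *s u) = c ^ e * papply (den k) u"
proof -
  have eq: "(\<Sum>i\<in>UNIV. nat (C $ i $ k)) = (\<Sum>i\<in>UNIV. nat (- (C $ i $ k)))"
  proof -
    have "int (\<Sum>i\<in>UNIV. nat (C $ i $ k)) - int (\<Sum>i\<in>UNIV. nat (- (C $ i $ k))) = (\<Sum>i\<in>UNIV. C $ i $ k)"
      unfolding of_nat_sum sum_subtractf[symmetric] by (intro sum.cong) auto
    then show ?thesis using sum_column[of k] by linarith
  qed
  have "papply (num k) (c *s u) = c ^ (\<Sum>i\<in>UNIV. nat (C $ i $ k)) * papply (num k) u" for c u
    by (simp add: num_def lin_form_scale power_mult_distrib prod.distrib power_sum)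
  moreover have "papply (den k) (c *s u) = c ^ (\<Sum>i\<in>UNIV. nat (- (C $ i $ k))) * papply (den k) u" for c u
    by (simp add: den_def lin_form_scale power_mult_distrib prod.distrib power_sum)
  ultimately show ?thesis using eq by metis
qed

end

text \<open>\<open>k0\<close> is a variable that occurs in \<Delta>, the one to be eliminated;
  \<open>j\<close> selects the affine chart u_j \<noteq> 0 of projective space and is
  arbitrary.\<close>

locale horn_hypersurface = horn_map C for C :: "int ^ 'm::finite ^ 'n::finite" +
  fixes \<Delta> :: "'m pfun" and k0 j :: 'm
  assumes irr: "irreducible \<Delta>" and S: "S_var C = {y. papply \<Delta> y = 0}"
    and k0: "\<Delta> \<notin> Dep (- {k0})"
begin

lemma Delta_vanishes: "vanishes_on_image C \<Delta>"
proof -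
  have "psi C ` psi_domain C \<subseteq> S_var C"
    unfolding S_var_def zariski_closure_def by (rule hull_subset)
  then show ?thesis using S by (auto simp: vanishes_on_image_def)
qed

text \<open>Vanishing on the image extends to the whole hypersurface, where
  \<open>no_elimination\<close> excludes it for a non-zero r free of \<open>k0\<close>. In other
  words, the coordinates of \<psi> other than \<open>k0\<close> are algebraically
  independent.\<close>

lemma vanishes_Dep:
  assumes "vanishes_on_image C r" "r \<in> Dep (- {k0})"
  shows "r = 0"
  using no_elimination[OF k0 assms(2)] vanishes_on_closure[OF assms(1)] S by blast

theorem vanishes_iff_dvd: "vanishes_on_image C f \<longleftrightarrow> \<Delta> dvd f"
proof
  assume f: "vanishes_on_image C f"
  from pfun_gauss_dichotomy[OF irr k0, of f] show "\<Delta> dvd f"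
  proof (elim disjE exE conjE)
    fix a b r assume r: "r \<in> Dep (- {k0})" "r \<noteq> 0" "a * \<Delta> + b * f = r"
    have "vanishes_on_image C (a * \<Delta> + b * f)"
      using f Delta_vanishes by (simp add: vanishes_on_image_def)
    then show ?thesis using r vanishes_Dep by blast
  qed
qed (use Delta_vanishes in \<open>auto simp: vanishes_on_image_def elim!: dvdE\<close>)

definition L :: "'m pfun" where "L = Var j * L0"

lemma L_simps: "papply L u \<noteq> 0 \<longleftrightarrow> u $ j \<noteq> 0 \<and> papply L0 u \<noteq> 0" "L0 dvd L" "Var j dvd L"
  by (auto simp: L_def)

lemma L_nonzero: "L \<noteq> 0"
  using L0_nonzero by (simp add: L_def Var_nonzero)

text \<open>A relation between the coordinates of \<open>psi_with i u\<close> makes \<open>u $ i / u $ j\<close> algebraic over the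
  coordinates of \<open>\<psi>(u)\<close> other than \<open>k0\<close>.\<close>

definition psi_with :: "'m \<Rightarrow> complex ^ 'm \<Rightarrow> complex ^ 'm" where
  "psi_with i u = upd (psi C u) k0 (u $ i / u $ j)"

definition relation :: "'m \<Rightarrow> 'm pfun \<Rightarrow> bool" where
  "relation i R \<longleftrightarrow> (\<forall>u. papply L u \<noteq> 0 \<longrightarrow> papply R (psi_with i u) = 0)"

lemma rat_psi_with: "rat L (\<lambda>u. psi_with i u $ k)"
proof -
  have "rat L (\<lambda>u. u $ i * inverse (u $ j))"
    using rat_mult[OF rat_papply[of L "Var i"] rat_inverse_factor[OF L_simps(3)]] by simp
  then show ?thesis
    using rat_psi[OF L_simps(2)] by (cases "k = k0") (auto simp: psi_with_def divide_inverse)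
qed

text \<open>All coordinates of \<open>psi_with i\<close> have degree 0 in u, so u may be scaled to
  u_j = 1, which leaves one variable fewer than there are functions. The exponents
  \<open>N k\<close> are raised to a common E to obtain a single denominator.\<close>

lemma ex_relation: "\<exists>R. R \<noteq> 0 \<and> relation i R"
proof -
  have "\<forall>k. \<exists>Q N. \<forall>u. papply L u \<noteq> 0 \<longrightarrow> psi_with i u $ k * papply L u ^ N = papply Q u"
    using rat_psi_with unfolding rat_def by blast
  then obtain Q N where QN: "\<And>k u. papply L u \<noteq> 0 \<Longrightarrow> psi_with i u $ k * papply L u ^ N k = papply (Q k) u"
    by metis
  define E where "E = (\<Sum>k\<in>UNIV. N k)"
  have NE: "N k \<le> E" for k unfolding E_def by (rule member_le_sum) auto
  define B where "B = (\<lambda>k. Q k * L ^ (E - N k))"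
  have B: "psi_with i u = (\<chi> k. papply (B k) u / papply (L ^ E) u)" if u: "papply L u \<noteq> 0" for u
  proof -
    have "papply (B k) u / papply (L ^ E) u = psi_with i u $ k" for k
    proof -
      have "papply L u ^ E = papply L u ^ N k * papply L u ^ (E - N k)"
        using NE[of k] by (simp flip: power_add)
      then have "papply (B k) u = psi_with i u $ k * papply L u ^ E"
        using QN[OF u, of k] by (simp add: B_def)
      then show ?thesis using u by simp
    qed
    then show ?thesis by (simp add: vec_eq_iff)
  qed
  obtain R where R: "R \<noteq> 0"
    "\<And>u. u $ j = 1 \<Longrightarrow> papply (L ^ E) u \<noteq> 0 \<Longrightarrow> papply R (\<chi> k. papply (B k) u / papply (L ^ E) u) = 0"
    using algebraic_dependence[of j "L ^ E" B] by blast
  have "papply R (psi_with i u) = 0" if u: "papply L u \<noteq> 0" for u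
  proof -
    define c where "c = inverse (u $ j)"
    have c: "c \<noteq> 0" "c * u $ j = 1" using u by (auto simp: c_def L_simps)
    have "papply L0 (c *s u) \<noteq> 0" using u c by (simp add: L_simps L0_def lin_form_scale)
    then have Lc: "papply L (c *s u) \<noteq> 0" using c by (simp add: L_simps)
    have "c * u $ i = u $ i / u $ j" by (simp add: c_def divide_inverse)
    then have "psi_with i (c *s u) = psi_with i u"
      using c by (simp add: psi_with_def psi_scale)
    then show ?thesis using R(2)[of "c *s u"] B[OF Lc] Lc c by simp
  qed
  then show ?thesis using R(1) unfolding relation_def by blast
qed

lemma relation_Dep:
  assumes "relation i R" "R \<in> Dep (- {k0})" shows "R = 0"
proof (rule vanishes_Dep[OF _ assms(2)])
  show "vanishes_on_image C R"
  proof (rule vanishes_generic[OF L_simps(2) L_nonzero rat_const[of _ 1]])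
    fix u assume "papply L u \<noteq> 0"
    then have "papply R (psi_with i u) = 0" using assms(1) by (simp add: relation_def)
    moreover have "papply R (psi_with i u) = papply R (psi C u)"
      by (rule DepD[OF assms(2)]) (auto simp: psi_with_def)
    ultimately show "papply R (psi C u) = 0" by simp
  qed (use L_nonzero in \<open>auto simp: pfun_eq_0_iff\<close>)
qed

text \<open>Take a non-zero relation of least degree in \<open>k0\<close>. This degree is positive
  by \<open>relation_Dep\<close>, so the derivative is non-zero and of smaller degree, and cannot be
  a relation.\<close>

lemma ex_separable_relation: "\<exists>R. relation i R \<and> \<not> relation i (pd k0 R)"
proof -
  obtain R0 where "R0 \<noteq> 0 \<and> relation i R0" using ex_relation by blast
  from ex_has_least_nat[of "\<lambda>R. R \<noteq> 0 \<and> relation i R", OF this, of "\<lambda>R. degree (as_poly k0 R)"]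
  obtain R where R: "R \<noteq> 0" "relation i R"
    and Rmin: "\<And>Q. Q \<noteq> 0 \<Longrightarrow> relation i Q \<Longrightarrow> degree (as_poly k0 R) \<le> degree (as_poly k0 Q)"
    by blast
  have nD: "R \<notin> Dep (- {k0})" using R relation_Dep by blast
  then have "degree (as_poly k0 R) > 0" using degree_as_poly_eq_0_iff by blast
  then have "\<not> relation i (pd k0 R)"
    using Rmin[OF pd_nonzero[OF nD]] degree_pd[of k0 R] by linarith
  then show ?thesis using R by blast
qed

definition R :: "'m \<Rightarrow> 'm pfun" where
  "R i = (SOME R. relation i R \<and> \<not> relation i (pd k0 R))"

lemma R: "relation i (R i)" "\<not> relation i (pd k0 (R i))"
  using someI_ex[OF ex_separable_relation[of i]] by (auto simp: R_def)

text \<open>The first factor keeps the gradient of \<Delta> at \<psi>(u) from vanishing. The others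
  say that each relation \<open>R i\<close> has a simple root at u_i / u_j, so that it determines
  the derivative of u_i / u_j.\<close>

definition generic :: "complex ^ 'm \<Rightarrow> complex" where
  "generic u = papply (pd k0 \<Delta>) (psi C u) * (\<Prod>i\<in>UNIV. papply (pd k0 (R i)) (psi_with i u))"

lemma rat_psi_with_compose: "rat L (\<lambda>u. papply f (psi_with i u))"
  using rat_compose[of L "\<lambda>k u. psi_with i u $ k" f] rat_psi_with by simp

lemma rat_generic: "rat L generic"
  unfolding generic_def
  by (intro rat_mult rat_prod rat_psi_compose L_simps rat_psi_with_compose)

lemma ex_generic: "\<exists>u. papply L u \<noteq> 0 \<and> generic u \<noteq> 0"
proof -
  let ?h = "\<lambda>u. \<Prod>i\<in>UNIV. papply (pd k0 (R i)) (psi_with i u)"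
  have "\<exists>u. papply L u \<noteq> 0 \<and> (\<forall>i\<in>UNIV. papply (pd k0 (R i)) (psi_with i u) \<noteq> 0)"
    using R(2) by (intro rat_prod_nonzero L_nonzero rat_psi_with_compose) (auto simp: relation_def)
  then have h: "\<exists>u. papply L u \<noteq> 0 \<and> ?h u \<noteq> 0" by auto
  have r: "rat L ?h" by (intro rat_prod rat_psi_with_compose)
  have nv: "\<not> vanishes_on_image C (pd k0 \<Delta>)"
    unfolding vanishes_iff_dvd by (rule not_dvd_pd[OF k0])
  show ?thesis
  proof (rule ccontr)
    assume "\<not> ?thesis"
    then have "papply (pd k0 \<Delta>) (psi C u) = 0" if "papply L u \<noteq> 0" "?h u \<noteq> 0" for u
      using that unfolding generic_def by auto
    from vanishes_generic[OF L_simps(2) L_nonzero r h this] show False using nv by blast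
  qed
qed

definition log_grad :: "'m \<Rightarrow> 'm pfun" where "log_grad k = Var k * pd k \<Delta>"

text \<open>The logarithmic Gauss map inverts \<open>\<psi>\<close>: the logarithmic gradient \<open>g\<close> lies in the kernel of
  the symmetric matrix of \<open>H u\<close>, which is spanned by \<open>u\<close> at a generic point.\<close>

theorem log_gauss_map:
  assumes u: "papply L u \<noteq> 0" "generic u \<noteq> 0"
  shows "\<exists>c. c \<noteq> 0 \<and> (\<forall>k. papply (log_grad k) (psi C u) = c * u $ k)"
proof -
  have u0: "papply L0 u \<noteq> 0" and uj: "u $ j \<noteq> 0" using u by (auto simp: L_simps)
  have dom: "u \<in> psi_domain C" using u0 psi_domain_iff by blast
  define g where "g = (\<chi> k. papply (log_grad k) (psi C u))"
  \<comment> \<open>\<Delta> is zero along the curve t -> \<psi>(u + t v) near t = 0, so the chain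
    rule makes g orthogonal to the logarithmic differential.\<close>
  have "(\<Sum>k\<in>UNIV. g $ k * H u v k) = 0" for v
  proof -
    have "((\<lambda>t. papply \<Delta> (psi C (u + t *s v))) has_field_derivative
        (\<Sum>k\<in>UNIV. papply (pd k \<Delta>) (psi C (u + 0 *s v)) * (psi C u $ k * H u v k))) (at 0)"
      by (rule chain_rule) (rule DERIV_psi[OF u0])
    then have "(\<Sum>k\<in>UNIV. papply (pd k \<Delta>) (psi C (u + 0 *s v)) * (psi C u $ k * H u v k)) = 0"
      using u0 by (rule zero_near_imp_deriv_0)
        (use Delta_vanishes in \<open>auto simp: vanishes_on_image_def psi_domain_iff\<close>)
    then show ?thesis by (simp add: g_def log_grad_def mult_ac)
  qed
  \<comment> \<open>By symmetry, orthogonality to the image becomes membership in the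
    kernel.\<close>
  then have "(\<Sum>k\<in>UNIV. v $ k * H u g k) = 0" for v using H_symmetric by metis
  from this[of "axis k 1" for k] have Hg: "H u g k = 0" for k
    by (simp add: axis_def if_distrib if_distribR cong: if_cong)
  \<comment> \<open>The multiple of u that cancels coordinate j. Subtracting it from g stays in the
    kernel by Euler's relation \<open>H_self\<close>.\<close>
  define c where "c = g $ j / u $ j"
  define v where "v = g - c *s u"
  have vj: "v $ j = 0" using uj by (simp add: v_def c_def)
  have Hv: "H u v k = 0" for k
    unfolding v_def by (simp add: H_diff_scale Hg H_self[OF u0])
  have "v $ i = 0" for i
  proof -
    \<comment> \<open>As v lies in the kernel and v_j = 0, to first order only coordinate
      \<open>k0\<close> of \<open>psi_with i\<close> moves along u + t v, with speed v_i / u_j.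
      Differentiating the relation leaves a single term.\<close>
    have "((\<lambda>t. papply (R i) (psi_with i (u + t *s v))) has_field_derivative
        (\<Sum>k\<in>UNIV. papply (pd k (R i)) (psi_with i (u + 0 *s v)) * (if k = k0 then v $ i / u $ j else 0))) (at 0)"
    proof (rule chain_rule)
      fix k
      show "((\<lambda>t. psi_with i (u + t *s v) $ k) has_field_derivative
          (if k = k0 then v $ i / u $ j else 0)) (at 0)"
      proof (cases "k = k0")
        case True
        have "((\<lambda>t. (u $ i + t * v $ i) / u $ j) has_field_derivative v $ i / u $ j) (at 0)"
          using uj by (auto intro!: derivative_eq_intros)
        then show ?thesis using True vj by (simp add: psi_with_def)
      next
        case False
        then show ?thesis using DERIV_psi[OF u0, of v k] Hv by (simp add: psi_with_def)
      qed
    qed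
    then have "(\<Sum>k\<in>UNIV. papply (pd k (R i)) (psi_with i (u + 0 *s v)) * (if k = k0 then v $ i / u $ j else 0)) = 0"
      using u(1) by (rule zero_near_imp_deriv_0) (use R(1) in \<open>auto simp: relation_def\<close>)
    then have "papply (pd k0 (R i)) (psi_with i u) * (v $ i / u $ j) = 0"
      by (simp add: if_distrib cong: if_cong)
    moreover have "papply (pd k0 (R i)) (psi_with i u) \<noteq> 0"
      using u(2) by (simp add: generic_def)
    ultimately show ?thesis using uj by simp
  qed
  then have gu: "g $ k = c * u $ k" for k by (simp add: v_def)
  have "g $ k0 \<noteq> 0" using u(2) psi_nonzero[OF dom] by (simp add: g_def log_grad_def generic_def)
  then have "c \<noteq> 0" using gu by auto
  then show ?thesis using gu by (auto simp: g_def)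
qed

text \<open>The equation y_k = \<open>num k\<close> / \<open>den k\<close> with the logarithmic
  gradient of \<Delta> at y in place of u, cleared of denominators. Being polynomial in y, it
  extends from the image of \<psi> to its closure.\<close>

definition inv_rel :: "'m \<Rightarrow> 'm pfun" where
  "inv_rel k = Var k * psubst log_grad (den k) - psubst log_grad (num k)"

lemma papply_inv_rel:
  assumes "\<And>k. papply (log_grad k) y = c * u $ k"
  shows "\<exists>e. papply (inv_rel k) y = c ^ e * (y $ k * papply (den k) u - papply (num k) u)"
proof -
  from num_den_homogeneous[of k] obtain e where
    e: "\<And>c u. papply (num k) (c *s u) = c ^ e * papply (num k) u"
    "\<And>c u. papply (den k) (c *s u) = c ^ e * papply (den k) u" by blast
  have "(\<chi> i. papply (log_grad i) y) = c *s u" using assms by (simp add: vec_eq_iff)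
  then have "papply (inv_rel k) y = c ^ e * (y $ k * papply (den k) u - papply (num k) u)"
    by (simp add: inv_rel_def e algebra_simps)
  then show ?thesis by blast
qed

lemma inv_rel_vanishes: "vanishes_on_image C (inv_rel k)"
proof (rule vanishes_generic[OF L_simps(2) L_nonzero rat_generic ex_generic])
  fix u assume u: "papply L u \<noteq> 0" "generic u \<noteq> 0"
  then obtain c where "\<And>k. papply (log_grad k) (psi C u) = c * u $ k" using log_gauss_map by blast
  from papply_inv_rel[of "psi C u", OF this, of k] psi_mult_den[of u k] u
  show "papply (inv_rel k) (psi C u) = 0" by (auto simp: L_simps)
qed

definition scale :: "complex ^ 'm \<Rightarrow> 'm pfun \<Rightarrow> 'm pfun" where
  "scale \<epsilon> f = psubst (\<lambda>k. Cst (\<epsilon> $ k) * Var k) f"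

lemma papply_scale: "papply (scale \<epsilon> f) y = papply f (\<epsilon> * y)"
  by (simp add: scale_def times_vec_def)

text \<open>Write \<Delta>(\<epsilon> z) = \<Delta>(z) q(z). After N iterations translates of q
  multiply to 1, so q vanishes nowhere. At a generic y = \<psi>(u) the logarithmic gradients at y
  and at \<epsilon> y are then non-zero multiples of the same u, and \<open>inv_rel\<close>
  determines the point from u.\<close>

theorem trivial_stabilizer:
  assumes dvd: "\<Delta> dvd scale \<epsilon> \<Delta>" and N: "N > 0" "\<epsilon> ^ N = 1"
  shows "\<epsilon> = 1"
proof -
  from dvd obtain q where "scale \<epsilon> \<Delta> = \<Delta> * q" by (auto elim: dvdE)
  then have q: "papply \<Delta> (\<epsilon> * z) = papply \<Delta> z * papply q z" for z
    using papply_scale[of \<epsilon> \<Delta> z] by simp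
  have qnz: "papply q z \<noteq> 0" for z
  proof -
    have iter: "papply \<Delta> (\<epsilon> ^ n * z) = papply \<Delta> z * (\<Prod>i<n. papply q (\<epsilon> ^ i * z))" for n z
    proof (induction n)
      case (Suc n)
      have "papply \<Delta> (\<epsilon> ^ Suc n * z) = papply \<Delta> (\<epsilon> * (\<epsilon> ^ n * z))" by (simp add: mult.assoc)
      then show ?case using q[of "\<epsilon> ^ n * z"] Suc by (simp add: mult.assoc)
    qed simp
    define F where "F = (\<Prod>i<N. scale (\<epsilon> ^ i) q)"
    have F: "papply F z = (\<Prod>i<N. papply q (\<epsilon> ^ i * z))" for z by (simp add: F_def papply_scale)
    have "\<Delta> * (F - 1) = 0"
    proof (rule pfun_eqI)
      fix z show "papply (\<Delta> * (F - 1)) z = papply 0 z"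
        using iter[of N z] N by (simp add: F algebra_simps)
    qed
    then have "F = 1" using irr by auto
    then have "(\<Prod>i<N. papply q (\<epsilon> ^ i * z)) = 1" using F[of z] by simp
    then have "\<forall>i<N. papply q (\<epsilon> ^ i * z) \<noteq> 0" by (metis finite_lessThan lessThan_iff prod_zero_iff zero_neq_one)
    then have "papply q (\<epsilon> ^ 0 * z) \<noteq> 0" using N by blast
    then show ?thesis by simp
  qed
  obtain u where u: "papply L u \<noteq> 0" "generic u \<noteq> 0" using ex_generic by blast
  define y where "y = psi C u"
  have dom: "u \<in> psi_domain C" and u0: "papply L0 u \<noteq> 0" using u psi_domain_iff by (auto simp: L_simps)
  obtain c where c: "c \<noteq> 0" "\<And>k. papply (log_grad k) y = c * u $ k"
    using log_gauss_map[OF u] unfolding y_def by blast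
  have y0: "papply \<Delta> y = 0" using Delta_vanishes dom by (simp add: vanishes_on_image_def y_def)
  \<comment> \<open>Two computations of the derivative of \<Delta>(\<epsilon> z) in direction k: by
    the chain rule, and by the product rule, where \<Delta>(y) = 0 removes the term with the
    derivative of q.\<close>
  have grad: "\<epsilon> $ k * papply (pd k \<Delta>) (\<epsilon> * y) = papply q y * papply (pd k \<Delta>) y" for k
  proof -
    have lin: "((\<lambda>t. (\<epsilon> * upd y k t) $ i) has_field_derivative (if i = k then \<epsilon> $ k else 0)) (at t)" for i t
      by (cases "i = k") (auto intro!: derivative_eq_intros)
    have "((\<lambda>t. papply \<Delta> (\<epsilon> * upd y k t)) has_field_derivative
        (\<Sum>i\<in>UNIV. papply (pd i \<Delta>) (\<epsilon> * upd y k (y $ k)) * (if i = k then \<epsilon> $ k else 0))) (at (y $ k))"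
      by (rule chain_rule) (rule lin)
    then have 1: "((\<lambda>t. papply \<Delta> (\<epsilon> * upd y k t)) has_field_derivative
        \<epsilon> $ k * papply (pd k \<Delta>) (\<epsilon> * y)) (at (y $ k))"
      by (simp add: if_distrib mult.commute cong: if_cong)
    have "((\<lambda>t. papply \<Delta> (upd y k t) * papply q (upd y k t)) has_field_derivative
        papply (pd k \<Delta>) (upd y k (y $ k)) * papply q (upd y k (y $ k)) +
        papply (pd k q) (upd y k (y $ k)) * papply \<Delta> (upd y k (y $ k))) (at (y $ k))"
      by (rule DERIV_mult[OF pd_upd pd_upd])
    then have "((\<lambda>t. papply \<Delta> (\<epsilon> * upd y k t)) has_field_derivative
        papply q y * papply (pd k \<Delta>) y) (at (y $ k))"
      by (simp add: q y0 mult.commute)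
    from DERIV_unique[OF 1 this] show ?thesis .
  qed
  have gr: "papply (log_grad k) (\<epsilon> * y) = (papply q y * c) * u $ k" for k
  proof -
    have "papply (log_grad k) (\<epsilon> * y) = y $ k * (\<epsilon> $ k * papply (pd k \<Delta>) (\<epsilon> * y))"
      by (simp add: log_grad_def)
    also have "\<dots> = papply q y * papply (log_grad k) y" unfolding grad by (simp add: log_grad_def)
    finally show ?thesis using c by simp
  qed
  have "\<epsilon> $ k = 1" for k
  proof -
    have "papply \<Delta> (\<epsilon> * y) = 0" using q y0 by simp
    then have "papply (inv_rel k) (\<epsilon> * y) = 0"
      using vanishes_on_closure[OF inv_rel_vanishes] S by blast
    with papply_inv_rel[of "\<epsilon> * y", OF gr, of k] obtain e where
      "(papply q y * c) ^ e * ((\<epsilon> * y) $ k * papply (den k) u - papply (num k) u) = 0" by metis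
    then have "(\<epsilon> * y) $ k * papply (den k) u = papply (num k) u" using c qnz by simp
    also have "\<dots> = y $ k * papply (den k) u" using psi_mult_den[OF u0] by (simp add: y_def)
    finally show ?thesis using den_nonzero[OF u0, of k] psi_nonzero[OF dom, of k] by (simp add: y_def)
  qed
  then show ?thesis by (simp add: vec_eq_iff)
qed

end

section \<open>Monomial maps of the torus\<close>

definition torus :: "(complex ^ 'm::finite) set" where
  "torus = {y. \<forall>i. y $ i \<noteq> 0}"

lemma torus_one: "1 \<in> torus" by (simp add: torus_def)

lemma torus_mult: "y \<in> torus \<Longrightarrow> z \<in> torus \<Longrightarrow> y * z \<in> torus"
  by (simp add: torus_def)

lemma monom_at_add: "y \<in> torus \<Longrightarrow> monom_at y (a + b) = monom_at y a * monom_at y b"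
  by (simp add: monom_at_def torus_def power_int_add prod.distrib)

lemma monom_at_mult: "monom_at (y * z) a = monom_at y a * monom_at z a"
  by (simp add: monom_at_def power_int_mult_distrib prod.distrib)

lemma monom_at_0 [simp]: "monom_at y 0 = 1"
  by (simp add: monom_at_def)

lemma monom_at_1 [simp]: "monom_at 1 a = 1"
  by (simp add: monom_at_def)

lemma monom_at_nonzero: "y \<in> torus \<Longrightarrow> monom_at y a \<noteq> 0"
  by (simp add: monom_at_def torus_def)

lemma monom_at_axis: "monom_at y (axis k n) = y $ k powi n"
proof -
  have "monom_at y (axis k n) = (\<Prod>i\<in>UNIV. if i = k then y $ k powi n else 1)"
    unfolding monom_at_def by (intro prod.cong) (auto simp: axis_def)
  then show ?thesis by simp
qed

lemma prod_power_int: "(\<Prod>i\<in>I. f i) powi n = (\<Prod>i\<in>I. f i powi n)" for f :: "'i \<Rightarrow> complex"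
  by (induction I rule: infinite_finite_induct) (auto simp: power_int_mult_distrib)

lemma alpha_torus:
  assumes "y \<in> torus" shows "alpha M y \<in> torus"
proof -
  have "alpha M y $ i \<noteq> 0" for i using monom_at_nonzero[OF assms] by (simp add: alpha_def)
  then show ?thesis by (simp add: torus_def)
qed

lemma matrix_mult_axis: "M *v axis l 1 = column l M" for M :: "int ^ 'm::finite ^ 'm"
  by (simp add: matrix_vector_mult_def column_def vec_eq_iff axis_def if_distrib cong: if_cong)

lemma alpha_mult: "alpha M (y * z) = alpha M y * alpha M z"
  by (simp add: alpha_def monom_at_mult vec_eq_iff)

lemma monom_at_alpha:
  assumes "y \<in> torus" shows "monom_at (alpha M y) w = monom_at y (M *v w)"
proof -
  have nz: "y $ i \<noteq> 0" for i using assms by (simp add: torus_def)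
  have "monom_at (alpha M y) w = (\<Prod>k\<in>UNIV. \<Prod>i\<in>UNIV. y $ i powi (M $ i $ k * w $ k))"
    by (simp add: monom_at_def alpha_def prod_power_int column_def power_int_mult)
  also have "\<dots> = (\<Prod>i\<in>UNIV. \<Prod>k\<in>UNIV. y $ i powi (M $ i $ k * w $ k))"
    by (rule prod.swap)
  also have "\<dots> = monom_at y (M *v w)"
    by (simp add: monom_at_def matrix_vector_mult_def power_int_sum nz)
  finally show ?thesis .
qed

lemma column_lattice_eq: "column_lattice M = range ((*v) M)"
proof -
  have 1: "(\<Sum>k\<in>UNIV. w k *s column k M) = M *v (\<chi> k. w k)" for w
    by (simp add: matrix_mult_sum)
  have 2: "M *v w = (\<Sum>k\<in>UNIV. (w $ k) *s column k M)" for w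
    by (simp add: matrix_mult_sum)
  show ?thesis
  proof (intro equalityI subsetI)
    fix x assume "x \<in> column_lattice M"
    then obtain w where "x = (\<Sum>k\<in>UNIV. w k *s column k M)" unfolding column_lattice_def by blast
    then show "x \<in> range ((*v) M)" unfolding 1 by blast
  next
    fix x assume "x \<in> range ((*v) M)"
    then obtain w where "x = M *v w" by blast
    then show "x \<in> column_lattice M" unfolding 2 column_lattice_def by blast
  qed
qed

lemma mat_mult_vector: "mat c *v w = c *s w" for w :: "int ^ 'm::finite"
  by (simp add: matrix_vector_mult_def mat_def vec_eq_iff if_distrib if_distribR cong: if_cong)

lemma power_vec_nth [simp]: "(y ^ n) $ k = (y $ k) ^ n" for y :: "complex ^ 'm::finite"
  by (induction n) auto

section \<open>Laurent polynomials and their values on the torus\<close>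

abbreviation lev :: "complex ^ 'm::finite \<Rightarrow> 'm laurent \<Rightarrow> complex" where
  "lev y \<equiv> char_sum (monom_at y)"

lemma lev_mult: "y \<in> torus \<Longrightarrow> lev y (f * g) = lev y f * lev y g"
  by (rule char_sum_mult) (rule monom_at_add)

lemma lev_prod: "y \<in> torus \<Longrightarrow> lev y (prod f I) = (\<Prod>i\<in>I. lev y (f i))"
  by (induction I rule: infinite_finite_induct) (auto simp: lev_mult)

lemma lev_power: "y \<in> torus \<Longrightarrow> lev y (f ^ n) = lev y f ^ n"
  by (induction n) (auto simp: lev_mult)

lemma lev_of_int: "lev y (of_int n) = of_int n"
proof -
  have nat: "lev y (of_nat k) = of_nat k" for k by (induction k) (auto simp: char_sum_add)
  show ?thesis
    by (cases n) (simp_all add: nat char_sum_uminus char_sum_diff)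
qed

lemma lev_eq_0_imp:
  fixes f :: "'m::finite laurent"
  assumes "\<And>y. y \<in> torus \<Longrightarrow> lev y f = 0"
  shows "f = 0"
proof (rule char_sum_eq_0_imp[of torus "(*)" "\<lambda>a y. monom_at y a" 1])
  fix a b :: "int ^ 'm" assume "a \<noteq> b"
  then obtain k where k: "a $ k \<noteq> b $ k" by (auto simp: vec_eq_iff)
  have m: "monom_at (upd 1 k 2 :: complex ^ 'm) c = 2 powi (c $ k)" for c :: "int ^ 'm"
  proof -
    have "monom_at (upd 1 k 2 :: complex ^ 'm) c = (\<Prod>i\<in>UNIV. if i = k then 2 powi (c $ k) else 1)"
      unfolding monom_at_def by (intro prod.cong) auto
    then show ?thesis by simp
  qed
  have "(2::complex) powi (a $ k) \<noteq> 2 powi (b $ k)"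
  proof
    assume "(2::complex) powi (a $ k) = 2 powi (b $ k)"
    then have "cmod (2 powi (a $ k)) = cmod (2 powi (b $ k))" by simp
    then have "(2::real) powi (a $ k) = 2 powi (b $ k)" by (simp add: norm_power_int)
    then show False using k power_int_strict_increasing[of _ _ "2::real"] by (metis less_irrefl linorder_neqE one_less_numeral_iff semiring_norm(76))
  qed
  moreover have "(upd 1 k 2 :: complex ^ 'm) \<in> torus" by (simp add: torus_def)
  ultimately show "\<exists>x\<in>torus. monom_at (x :: complex ^ 'm) a \<noteq> monom_at x b"
    using m by (intro bexI[of _ "upd 1 k 2"]) auto
qed (use assms in \<open>simp_all add: monom_at_mult torus_one torus_mult\<close>)

lemma lev_eqI:
  assumes "\<And>y. y \<in> torus \<Longrightarrow> lev y f = lev y g" shows "f = g"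
proof -
  have "f - g = 0" by (rule lev_eq_0_imp) (simp add: char_sum_diff assms)
  then show ?thesis by simp
qed

text \<open>Its powers serve as common denominators of Laurent polynomials, and its non-vanishing
  cuts out the torus.\<close>

definition Vars :: "'m::finite pfun" where "Vars = (\<Prod>k\<in>UNIV. Var k)"

lemma Vars_nonzero_iff: "papply Vars y \<noteq> 0 \<longleftrightarrow> y \<in> torus"
  by (simp add: Vars_def torus_def)

lemma Vars_nonzero: "Vars \<noteq> (0 :: 'm::finite pfun)"
proof
  assume "Vars = (0 :: 'm pfun)"
  then have "papply Vars (1 :: complex ^ 'm) = 0" by simp
  then show False using Vars_nonzero_iff torus_one by blast
qed

lemma pfun_eqI_torus:
  fixes f g :: "'m::finite pfun"
  assumes "\<And>y. y \<in> torus \<Longrightarrow> papply f y = papply g y" shows "f = g"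
proof -
  have "(f - g) * Vars = 0"
  proof (rule pfun_eqI)
    fix y show "papply ((f - g) * Vars) y = papply 0 y"
      using assms[of y] Vars_nonzero_iff[of y] by auto
  qed
  then show ?thesis using Vars_nonzero[where 'm = 'm] by simp
qed

lemma laurent_numerator: "\<exists>n g. \<forall>y\<in>torus. papply g y = papply Vars y ^ n * lev y f"
proof -
  define n where "n = (\<Sum>w\<in>keys f. \<Sum>k\<in>UNIV. nat \<bar>w $ k\<bar>)"
  have n: "int n + w $ k \<ge> 0" if w: "w \<in> keys f" for w k
  proof -
    have "nat \<bar>w $ k\<bar> \<le> (\<Sum>k\<in>UNIV. nat \<bar>w $ k\<bar>)" by (rule member_le_sum) auto
    also have "\<dots> \<le> n" unfolding n_def using w by (intro member_le_sum) auto
    finally show ?thesis by linarith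
  qed
  define g where "g = (\<Sum>w\<in>keys f. Cst (lookup f w) *
    (\<Prod>k\<in>UNIV. Var k ^ nat (int n + w $ k)))"
  have "papply g y = papply Vars y ^ n * lev y f" if y: "y \<in> torus" for y
  proof -
    have nz: "y $ k \<noteq> 0" for k using y by (simp add: torus_def)
    have "(\<Prod>k\<in>UNIV. y $ k ^ nat (int n + w $ k)) = papply Vars y ^ n * monom_at y w"
      if w: "w \<in> keys f" for w
    proof -
      have "y $ k ^ nat (int n + w $ k) = y $ k ^ n * y $ k powi (w $ k)" for k
      proof -
        have "y $ k ^ nat (int n + w $ k) = y $ k powi (int n + w $ k)"
          using n[OF w, of k] by (simp add: power_int_def)
        also have "\<dots> = y $ k ^ n * y $ k powi (w $ k)" using nz by (simp add: power_int_add)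
        finally show ?thesis .
      qed
      then show ?thesis by (simp add: Vars_def monom_at_def prod.distrib prod_power_distrib)
    qed
    then have "papply g y = (\<Sum>w\<in>keys f.
        lookup f w * (papply Vars y ^ n * monom_at y w))"
      unfolding g_def by simp
    then show ?thesis by (simp add: char_sum_def sum_distrib_left mult_ac)
  qed
  then show ?thesis by blast
qed

lemma pfun_as_laurent: "\<exists>f. \<forall>y\<in>torus. lev y f = papply g y"
proof -
  obtain p where p: "g = pf_of p" using pf_of_surj by blast
  define f where "f = (\<Sum>a\<in>keys p.
    single ((\<chi> k. int (a $ k)) :: int ^ 'a) (lookup p a))"
  have "lev y f = papply g y" for y
    unfolding f_def p char_sum_sum char_sum_single
    by (simp add: mpoly_eval_eq char_sum_def monom_at_def nat_monom_def)
  then show ?thesis by blast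
qed

lemma laurent_no_zero_divisors:
  fixes f g :: "'m::finite laurent"
  assumes "\<And>y. y \<in> torus \<Longrightarrow> lev y f * lev y g = 0"
  shows "f = 0 \<or> g = 0"
proof -
  obtain n F where F: "\<forall>y\<in>torus. papply F y = papply Vars y ^ n * lev y f"
    using laurent_numerator by blast
  obtain n' G where G: "\<forall>y\<in>torus. papply G y = papply Vars y ^ n' * lev y g"
    using laurent_numerator by blast
  have "papply F y * papply G y = 0" if y: "y \<in> torus" for y
    using assms[OF y] F G y by (metis mult_eq_0_iff)
  then have "F * G = 0" by (intro pfun_eqI_torus) simp
  then have "F = 0 \<or> G = 0" by simp
  then show ?thesis
  proof
    assume "F = 0"
    then have "lev y f = 0" if "y \<in> torus" for y
      using F that Vars_nonzero_iff[of y] by auto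
    then show ?thesis using lev_eq_0_imp by blast
  next
    assume "G = 0"
    then have "lev y g = 0" if "y \<in> torus" for y
      using G that Vars_nonzero_iff[of y] by auto
    then show ?thesis using lev_eq_0_imp by blast
  qed
qed

section \<open>Integral matrices of full rank\<close>

lemma det_map_of_int: "det (map_matrix of_int M :: 'a::comm_ring_1 ^ 'm ^ 'm) = of_int (det M)"
  for M :: "int ^ 'm::finite ^ 'm"
  by (simp add: det_def)

text \<open>d is a common denominator for the entries of the rational inverse of M. Exponents stay
  integral when N takes the place of that inverse.\<close>

lemma ex_integral_inverse:
  fixes M :: "int ^ 'm::finite ^ 'm"
  assumes "det M \<noteq> 0"
  shows "\<exists>N d. d > 0 \<and> M ** N = mat (int d) \<and> N ** M = mat (int d)"
proof -
  let ?M = "map_matrix of_int M :: rat ^ 'm ^ 'm"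
  have "det ?M \<noteq> 0" using assms by (simp add: det_map_of_int)
  then obtain B where B: "?M ** B = mat 1" "B ** ?M = mat 1"
    using invertible_det_nz[of ?M] unfolding invertible_def by blast
  define den where "den = (\<lambda>i j. nat (snd (quotient_of (B $ i $ j))))"
  have den: "den i j > 0" "\<exists>z::int. of_nat (den i j) * B $ i $ j = of_int z" for i j
  proof -
    obtain p q where pq: "quotient_of (B $ i $ j) = (p, q)" by fastforce
    then have q: "q > 0" by (rule quotient_of_denom_pos)
    have denq: "den i j = nat q" by (simp add: den_def pq)
    have "B $ i $ j = of_int p / of_int q" using pq by (rule quotient_of_div)
    then have "of_nat (den i j) * B $ i $ j = of_int p" using q by (simp add: denq)
    then show "den i j > 0" "\<exists>z::int. of_nat (den i j) * B $ i $ j = of_int z"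
      using q by (auto simp: denq)
  qed
  define d where "d = (\<Prod>i\<in>UNIV. \<Prod>j\<in>UNIV. den i j)"
  have d: "d > 0" using den by (simp add: d_def)
  have "\<exists>z::int. of_nat d * B $ i $ j = of_int z" for i j
  proof -
    have "den i j dvd (\<Prod>j\<in>UNIV. den i j)" by (rule dvd_prodI) auto
    also have "\<dots> dvd d" unfolding d_def by (rule dvd_prodI) auto
    finally obtain c where "d = den i j * c" by (rule dvdE)
    moreover obtain z :: int where "of_nat (den i j) * B $ i $ j = of_int z" using den by blast
    ultimately have "of_nat d * B $ i $ j = of_int (z * int c)" by (simp add: mult_ac)
    then show ?thesis by blast
  qed
  then obtain z :: "'m \<Rightarrow> 'm \<Rightarrow> int" where z: "\<And>i j. of_nat d * B $ i $ j = of_int (z i j)" by metis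
  define N :: "int ^ 'm ^ 'm" where "N = (\<chi> i j. z i j)"
  have "(of_int ((M ** N) $ i $ j) :: rat) = of_int (mat (int d) $ i $ j)" for i j
  proof -
    have "(of_int ((M ** N) $ i $ j) :: rat) = of_nat d * (?M ** B) $ i $ j"
      by (simp add: matrix_matrix_mult_def N_def sum_distrib_left flip: z) (simp add: mult_ac)
    then show ?thesis by (simp add: B mat_def)
  qed
  moreover have "(of_int ((N ** M) $ i $ j) :: rat) = of_int (mat (int d) $ i $ j)" for i j
  proof -
    have "(of_int ((N ** M) $ i $ j) :: rat) = of_nat d * (B ** ?M) $ i $ j"
      by (simp add: matrix_matrix_mult_def N_def sum_distrib_left flip: z) (simp add: mult_ac)
    then show ?thesis by (simp add: B mat_def)
  qed
  ultimately have "M ** N = mat (int d)" "N ** M = mat (int d)"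
    by (simp_all only: vec_eq_iff of_int_eq_iff simp_thms)
  then show ?thesis using d by blast
qed

text \<open>Full rank makes \<open>C ** M\<close> injective, so M is injective as well.\<close>

lemma det_nonzero_of_rank:
  fixes C :: "int ^ 'm::finite ^ 'n::finite" and M :: "int ^ 'm ^ 'm"
  assumes "rank (map_matrix real_of_int (C ** M)) = CARD('m)"
  shows "det M \<noteq> 0"
proof -
  have eq: "map_matrix real_of_int (C ** M) = map_matrix real_of_int C ** map_matrix real_of_int M"
    by (simp add: matrix_matrix_mult_def map_matrix_def vec_eq_iff)
  have "inj ((*v) (map_matrix real_of_int (C ** M)))"
    using assms full_rank_injective by blast
  then have "inj ((*v) (map_matrix real_of_int M))"
    unfolding eq inj_def by (metis matrix_vector_mul_assoc)
  then have "det (map_matrix real_of_int M) \<noteq> 0"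
    by (simp only: matrix_left_invertible_injective[symmetric] invertible_left_inverse[symmetric]
      invertible_det_nz not_False_eq_True)
  then show ?thesis by (simp add: det_map_of_int)
qed

text \<open>On the torus \<open>alpha N\<close> inverts \<open>alpha M\<close> up to d-th powers:
  both composites raise every coordinate to the power d. In particular G_M consists of tuples of
  d-th roots of unity.\<close>

locale monomial_cover =
  fixes M N :: "int ^ 'm::finite ^ 'm" and d :: nat
  assumes d: "d > 0" and MN: "M ** N = mat (int d)" and NM: "N ** M = mat (int d)"
begin

lemma M_N: "M *v (N *v w) = int d *s w" and N_M: "N *v (M *v w) = int d *s w"
  by (simp_all add: matrix_vector_mul_assoc MN NM mat_mult_vector)

lemma G_torus: "\<epsilon> \<in> G_grp M \<Longrightarrow> \<epsilon> \<in> torus"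
  by (simp add: G_grp_def torus_def)

lemma G_alpha: "\<epsilon> \<in> G_grp M \<Longrightarrow> alpha M \<epsilon> = 1"
  by (simp add: G_grp_def vec_eq_iff)

lemma G_iff: "\<epsilon> \<in> G_grp M \<longleftrightarrow> \<epsilon> \<in> torus \<and> alpha M \<epsilon> = 1"
  by (simp add: G_grp_def torus_def vec_eq_iff)

lemma G_monom_lattice: "\<epsilon> \<in> G_grp M \<Longrightarrow> monom_at \<epsilon> (M *v w) = 1"
  using monom_at_alpha[of \<epsilon> M w] by (simp add: G_iff)

lemma G_power: 
  assumes "\<epsilon> \<in> G_grp M" shows "\<epsilon> ^ d = 1"
proof -
  have "\<epsilon> $ k ^ d = 1" for k
  proof -
    have "M *v (N *v axis k 1) = axis k (int d)"
      by (simp add: M_N vec_eq_iff axis_def)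
    then show ?thesis using G_monom_lattice[OF assms, of "N *v axis k 1"] by (simp add: monom_at_axis)
  qed
  then show ?thesis by (simp add: vec_eq_iff)
qed

lemma finite_G: "finite (G_grp M)"
proof -
  have "finite {z::complex. z ^ d = 1}" using d by (intro finite_nth_roots) auto
  then have "finite {v :: complex ^ 'm. \<forall>k. v $ k \<in> {z. z ^ d = 1}}" by (intro card_vec_box)
  moreover have "\<epsilon> $ k ^ d = 1" if "\<epsilon> \<in> G_grp M" for \<epsilon> k
    using G_power[OF that] by (metis power_vec_nth one_index)
  then have "G_grp M \<subseteq> {v :: complex ^ 'm. \<forall>k. v $ k \<in> {z. z ^ d = 1}}" by auto
  ultimately show ?thesis by (rule finite_subset[rotated])
qed

lemma G_one: "1 \<in> G_grp M"
  by (simp add: G_iff torus_one alpha_def vec_eq_iff)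

lemma G_mult: "\<epsilon> \<in> G_grp M \<Longrightarrow> \<eta> \<in> G_grp M \<Longrightarrow> \<epsilon> * \<eta> \<in> G_grp M"
  by (simp add: G_iff torus_mult alpha_mult)

lemma G_inverse:
  assumes "\<epsilon> \<in> G_grp M" shows "\<exists>\<eta>\<in>G_grp M. \<epsilon> * \<eta> = 1"
proof
  have "\<epsilon> ^ n \<in> G_grp M" for n using assms by (induction n) (auto intro: G_one G_mult)
  then show "\<epsilon> ^ (d - 1) \<in> G_grp M" .
  show "\<epsilon> * \<epsilon> ^ (d - 1) = 1" using G_power[OF assms] d by (simp add: power_eq_if)
qed

text \<open>For the converse let \<zeta> be a primitive d-th root of unity. Row k of N gives an
  element of G_M with coordinates \<zeta> to the power N_ki, at which the monomial w takes the value
  \<zeta> to the power (N w)_k. Hence d divides N w, and w = M (N w / d).\<close>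

theorem lattice_iff: "w \<in> column_lattice M \<longleftrightarrow> (\<forall>\<epsilon>\<in>G_grp M. monom_at \<epsilon> w = 1)"
proof
  assume "w \<in> column_lattice M"
  then show "\<forall>\<epsilon>\<in>G_grp M. monom_at \<epsilon> w = 1"
    using G_monom_lattice by (auto simp: column_lattice_eq)
next
  assume w: "\<forall>\<epsilon>\<in>G_grp M. monom_at \<epsilon> w = 1"
  define \<zeta> where "\<zeta> = exp (of_real (2 * pi) * \<i> / of_nat d)"
  have \<zeta>pow: "\<zeta> powi n = exp (of_int n * (of_real (2 * pi) * \<i> / of_nat d))" for n
    by (simp add: \<zeta>_def exp_power_int)
  have \<zeta>d: "\<zeta> powi (int d * n) = 1" for n
  proof -
    have "of_int (int d * n) * (of_real (2 * pi) * \<i> / of_nat d) = of_int n * (of_real (2 * pi) * \<i>)"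
      using d by simp
    then have "\<zeta> powi (int d * n) = exp (of_int n * (of_real (2 * pi) * \<i>))"
      unfolding \<zeta>pow by simp
    also have "\<dots> = 1" by (subst exp_eq_1) auto
    finally show ?thesis .
  qed
  have \<zeta>1: "int d dvd n" if n: "\<zeta> powi n = 1" for n
  proof -
    from n obtain k :: int where "of_int n * (2 * pi) / of_nat d = of_int (2 * k) * pi"
      unfolding \<zeta>pow exp_eq_1 by (auto simp: Im_divide_of_nat)
    then have "of_int n = of_int k * real d" using d by (simp add: field_simps)
    then have "n = k * int d" by (metis of_int_eq_iff of_int_mult of_int_of_nat_eq)
    then show ?thesis by simp
  qed
  have \<zeta>0: "\<zeta> \<noteq> 0" by (simp add: \<zeta>_def)
  have "int d dvd (N *v w) $ k" for k
  proof -
    define \<epsilon> :: "complex ^ 'm" where "\<epsilon> = (\<chi> i. \<zeta> powi (N $ k $ i))"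
    have mon: "monom_at \<epsilon> x = \<zeta> powi ((N *v x) $ k)" for x
      by (simp add: monom_at_def \<epsilon>_def matrix_vector_mult_def flip: power_int_mult power_int_sum[OF \<zeta>0])
    have "\<epsilon> \<in> torus" using \<zeta>0 by (simp add: torus_def \<epsilon>_def)
    moreover have "alpha M \<epsilon> $ l = 1" for l
    proof -
      have "column l M = M *v axis l 1"
        by (simp add: matrix_mult_axis)
      then have "alpha M \<epsilon> $ l = \<zeta> powi (int d * axis l 1 $ k)"
        by (simp add: alpha_def mon N_M)
      then show ?thesis using \<zeta>d by simp
    qed
    ultimately have "\<epsilon> \<in> G_grp M" by (simp add: G_iff vec_eq_iff)
    from bspec[OF w this] have "\<zeta> powi ((N *v w) $ k) = 1" unfolding mon .
    then show ?thesis by (rule \<zeta>1)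
  qed
  then obtain x where x: "\<And>k. (N *v w) $ k = int d * x k" unfolding dvd_def by metis
  have "N *v w = int d *s (\<chi> k. x k)" using x by (simp add: vec_eq_iff)
  then have "int d *s w = M *v (int d *s (\<chi> k. x k))" using M_N by metis
  also have "\<dots> = int d *s (M *v (\<chi> k. x k))"
    by (simp add: matrix_vector_mult_def vec_eq_iff sum_distrib_left mult_ac)
  finally have "w = M *v (\<chi> k. x k)" using d by (simp add: vec_eq_iff)
  then show "w \<in> column_lattice M" by (auto simp: column_lattice_eq)
qed

text \<open>A preimage is \<open>alpha N\<close> of a coordinatewise d-th root of z.\<close>

lemma alpha_surj:
  assumes z: "z \<in> torus" shows "\<exists>y\<in>torus. alpha M y = z"
proof -
  define r :: "complex ^ 'm" where "r = (\<chi> k. exp (Ln (z $ k) / of_nat d))"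
  have r: "r \<in> torus" by (simp add: torus_def r_def)
  have rd: "r $ k ^ d = z $ k" for k
    using z d by (simp add: r_def torus_def exp_of_nat_mult[symmetric])
  have "alpha M (alpha N r) $ l = z $ l" for l
  proof -
    have "alpha M (alpha N r) $ l = monom_at r (N *v (M *v axis l 1))"
      by (simp add: alpha_def[of M] monom_at_alpha[OF r] matrix_mult_axis)
    also have "N *v (M *v axis l 1) = axis l (int d)"
      by (simp add: N_M vec_eq_iff axis_def)
    finally show ?thesis by (simp add: monom_at_axis rd)
  qed
  then have "alpha M (alpha N r) = z" by (simp add: vec_eq_iff)
  then show ?thesis using alpha_torus[OF r] by blast
qed

text \<open>Translation by \<eta> multiplies the coefficient at w by the value of the monomial w at
  \<eta>. Invariance makes this value 1 on the support, and \<open>lattice_iff\<close>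
  applies.\<close>

lemma invariant_keys:
  fixes f :: "'m laurent"
  assumes "\<And>\<eta> y. \<eta> \<in> G_grp M \<Longrightarrow> y \<in> torus \<Longrightarrow> lev (\<eta> * y) f = lev y f"
    and w: "w \<in> keys f"
  shows "w \<in> column_lattice M"
  unfolding lattice_iff
proof
  fix \<eta> assume \<eta>: "\<eta> \<in> G_grp M"
  define g where "g = (\<Sum>w\<in>keys f. single w (lookup f w * monom_at \<eta> w))"
  have "lev y g = lev (\<eta> * y) f" for y
    unfolding g_def char_sum_sum char_sum_single by (simp add: char_sum_def monom_at_mult mult_ac)
  then have "g = f" using assms(1)[OF \<eta>] by (intro lev_eqI) simp
  moreover have "lookup g w = lookup f w * monom_at \<eta> w"
    unfolding g_def using w by (simp add: lookup_sum lookup_single when_def)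
  ultimately show "monom_at \<eta> w = 1" using w by (simp add: in_keys_iff)
qed

lemma invariant_descends:
  fixes f :: "'m laurent"
  assumes "\<And>\<eta> y. \<eta> \<in> G_grp M \<Longrightarrow> y \<in> torus \<Longrightarrow> lev (\<eta> * y) f = lev y f"
  shows "\<exists>g. \<forall>y\<in>torus. lev y f = lev (alpha M y) g"
proof -
  have "\<forall>w\<in>keys f. \<exists>x. w = M *v x"
    using invariant_keys[OF assms] by (auto simp: column_lattice_eq)
  then obtain x where x: "\<And>w. w \<in> keys f \<Longrightarrow> w = M *v x w" by metis
  define g where "g = (\<Sum>w\<in>keys f. single (x w) (lookup f w))"
  have "lev y f = lev (alpha M y) g" if y: "y \<in> torus" for y
    unfolding g_def char_sum_sum char_sum_single monom_at_alpha[OF y] using x by (simp add: char_sum_def)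
  then show ?thesis by blast
qed

end

section \<open>The factorization up to a constant\<close>

lemma Var_dvd_iff: "Var k dvd f \<longleftrightarrow> (\<forall>y. y $ k = 0 \<longrightarrow> papply f y = 0)"
proof
  assume f: "\<forall>y. y $ k = 0 \<longrightarrow> papply f y = 0"
  obtain c Q where cQ: "as_poly k f = pCons c Q" by (cases "as_poly k f")
  have c: "c \<in> Dep (- {k})"
    using as_poly(1)[of k f] cQ by (auto simp: polys_over_def coeff_pCons dest: spec[of _ 0])
  have eq: "f = c + Var k * poly Q (Var k)" using as_poly(2)[of k f] cQ by simp
  have "papply c y = 0" for y
  proof -
    have "papply c y = papply c (upd y k 0)" by (rule DepD[OF c]) auto
    also have "\<dots> = papply f (upd y k 0)" by (simp add: eq)
    finally show ?thesis using f by simp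
  qed
  then have "c = 0" by (intro pfun_eqI) simp
  then show "Var k dvd f" using eq by auto
qed (auto elim!: dvdE)

text \<open>Setting y_k = 0 is a ring homomorphism into a domain, with kernel the multiples of
  \<open>Var k\<close>.\<close>

lemma Var_prime:
  assumes "Var k dvd f * g" shows "Var k dvd f \<or> Var k dvd g"
proof -
  define \<sigma> where "\<sigma> = psubst (\<lambda>i. if i = k then 0 else Var i :: 'a pfun)"
  have \<sigma>: "papply (\<sigma> h) y = papply h (upd y k 0)" for h y
  proof -
    have "(\<chi> i. papply (if i = k then 0 else Var i) y) = upd y k 0" by (simp add: vec_eq_iff)
    then show ?thesis by (simp add: \<sigma>_def)
  qed
  have dvd: "Var k dvd h \<longleftrightarrow> \<sigma> h = 0" for h
  proof -
    have "\<sigma> h = 0 \<longleftrightarrow> (\<forall>y. papply h (upd y k 0) = 0)" by (simp add: pfun_eq_0_iff \<sigma>)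
    also have "\<dots> \<longleftrightarrow> (\<forall>y. y $ k = 0 \<longrightarrow> papply h y = 0)"
    proof (intro iffI allI impI)
      fix y :: "complex ^ 'a" assume "\<forall>y. papply h (upd y k 0) = 0" "y $ k = 0"
      then show "papply h y = 0" using upd_same[of y k] by metis
    qed simp
    finally show ?thesis by (simp add: Var_dvd_iff)
  qed
  have "\<sigma> f * \<sigma> g = \<sigma> (f * g)" by (rule pfun_eqI) (simp add: \<sigma>)
  then show ?thesis using assms dvd by (metis mult_eq_0_iff)
qed

text \<open>Every variable of the monomial is prime and can be cancelled from f or from g. Writing
  the monomial as a list of variables turns this into an induction.\<close>

lemma split_monomial:
  assumes "prod_list (map Var ks) * D = f * g"
  shows "\<exists>ks1 ks2 f' g'. f = prod_list (map Var ks1) * f' \<and> g = prod_list (map Var ks2) * g' \<and> f' * g' = D"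
  using assms
proof (induction ks arbitrary: f g)
  case Nil
  then show ?case by (intro exI[of _ "[]"] exI[of _ f] exI[of _ g]) simp
next
  case (Cons k ks)
  have eq: "Var k * (prod_list (map Var ks) * D) = f * g" using Cons.prems by (simp add: mult_ac)
  then have "Var k dvd f * g" by (metis dvd_triv_left)
  then consider f1 where "f = Var k * f1" | g1 where "g = Var k * g1"
    using Var_prime by (metis dvdE)
  then show ?case
  proof cases
    case (1 f1)
    then have "Var k * (prod_list (map Var ks) * D) = Var k * (f1 * g)" using eq by (simp add: mult_ac)
    then have "prod_list (map Var ks) * D = f1 * g" by (simp add: Var_nonzero)
    from Cons.IH[OF this] obtain ks1 ks2 f' g' where
      "f1 = prod_list (map Var ks1) * f'" "g = prod_list (map Var ks2) * g'" "f' * g' = D" by blast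
    then show ?thesis using 1
      by (intro exI[of _ "k # ks1"] exI[of _ ks2] exI[of _ f'] exI[of _ g']) (simp add: mult_ac)
  next
    case (2 g1)
    then have "Var k * (prod_list (map Var ks) * D) = Var k * (f * g1)" using eq by (simp add: mult_ac)
    then have "prod_list (map Var ks) * D = f * g1" by (simp add: Var_nonzero)
    from Cons.IH[OF this] obtain ks1 ks2 f' g' where
      "f = prod_list (map Var ks1) * f'" "g1 = prod_list (map Var ks2) * g'" "f' * g' = D" by blast
    then show ?thesis using 2
      by (intro exI[of _ ks1] exI[of _ "k # ks2"] exI[of _ f'] exI[of _ g']) (simp add: mult_ac)
  qed
qed

lemma Vars_power_list: "\<exists>ks. Vars ^ n = prod_list (map Var ks)"
proof (induction n)
  case 0
  then show ?case by (intro exI[of _ "[]"]) simp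
next
  case (Suc n)
  then obtain ks where ks: "Vars ^ n = (prod_list (map Var ks) :: 'a pfun)" by blast
  obtain xs :: "'a list" where xs: "set xs = UNIV" "distinct xs"
    using finite_distinct_list[of "UNIV :: 'a set"] by auto
  have "Vars = (prod_list (map Var xs) :: 'a pfun)"
    unfolding Vars_def using prod.distinct_set_conv_list[OF xs(2), of Var] xs(1) by simp
  then show ?case using ks by (intro exI[of _ "xs @ ks"]) simp
qed

lemma prod_list_Var_monom: "\<exists>w. \<forall>z\<in>torus. papply (prod_list (map Var ks)) z = monom_at z w"
proof (induction ks)
  case Nil
  then show ?case by (intro exI[of _ 0]) simp
next
  case (Cons k ks)
  then obtain w where "\<forall>z\<in>torus. papply (prod_list (map Var ks)) z = monom_at z w" by blast
  then show ?case by (intro exI[of _ "axis k 1 + w"]) (auto simp: monom_at_add monom_at_axis)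
qed

lemma Vars_monom: "\<exists>w. \<forall>z\<in>(torus :: (complex ^ 'm::finite) set). papply Vars z ^ n = monom_at z w"
proof -
  obtain ks where ks: "Vars ^ n = (prod_list (map Var ks) :: 'm pfun)" using Vars_power_list by blast
  obtain w where w: "\<forall>z\<in>torus. papply (prod_list (map Var ks) :: 'm pfun) z = monom_at z w"
    using prod_list_Var_monom by blast
  then show ?thesis by (intro exI[of _ w]) (simp flip: ks)
qed

lemma monom_at_uminus: "y \<in> torus \<Longrightarrow> monom_at y (- w) = inverse (monom_at y w)"
  using monom_at_add[of y w "- w"] monom_at_nonzero[of y w] by (simp add: field_simps)

lemma unit_pfun_const:
  assumes "f dvd 1" shows "\<exists>c. c \<noteq> 0 \<and> f = Cst c"
proof -
  from assms obtain g where g: "1 = f * g" by (auto elim: dvdE)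
  have "f \<in> Dep (- {k})" for k
  proof -
    have "as_poly k f * as_poly k g = 1"
      unfolding as_poly_mult[symmetric] g[symmetric]
      using subdomain.subdomain_polys_over[OF subdomain_Dep, of "- {k}"]
      by (intro as_poly_eqI subdomain.one_closed) auto
    then show ?thesis using unit_poly_degree degree_as_poly_eq_0_iff by blast
  qed
  then have "f \<in> Dep {}" by (rule Dep_emptyI)
  then have "papply f y = papply f 0" for y by (rule DepD) auto
  then have f: "f = Cst (papply f 0)" by (intro pfun_eqI) simp
  moreover have "papply f 0 \<noteq> 0"
  proof
    assume "papply f 0 = 0"
    then have "papply (f * g) 0 = 0" by simp
    then show False by (simp flip: g)
  qed
  ultimately show ?thesis by blast
qed

lemma map_matrix_of_int_mult:
  "map_matrix of_int (A ** B) = (map_matrix of_int A ** map_matrix of_int B :: 'r::comm_ring_1 ^ 'k ^ 'n)"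
  for A :: "int ^ 'm::finite ^ 'n" and B :: "int ^ 'k ^ 'm"
  by (simp add: matrix_matrix_mult_def map_matrix_def vec_eq_iff)

lemma lin_form_matrix: "lin_form C i u = (map_matrix of_int C *v u) $ i"
  by (simp add: lin_form_def matrix_vector_mult_def)

context horn_map
begin

lemma psi_torus: "u \<in> psi_domain C \<Longrightarrow> psi C u \<in> torus"
  using psi_nonzero by (auto simp: torus_def)

end

text \<open>Let u' = N u / d be the preimage of u under M. The linear forms of \<open>C ** M\<close>
  at u' are those of C at u, and the exponents regroup by the columns of M.\<close>

lemma psi_compose:
  fixes C :: "int ^ 'm::finite ^ 'n::finite"
  assumes "monomial_cover M N d" and u: "u \<in> psi_domain C"
  shows "\<exists>u'\<in>psi_domain (C ** M). psi (C ** M) u' = alpha M (psi C u)"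
proof -
  interpret monomial_cover M N d by fact
  define u' where "u' = inverse (of_nat d) *s (map_matrix of_int N *v u)"
  have Mu': "map_matrix of_int M *v u' = u"
  proof -
    have "map_matrix of_int M *v u' = inverse (of_nat d) *s ((map_matrix of_int M ** map_matrix of_int N) *v u)"
      unfolding u'_def matrix_vector_mul_assoc[symmetric]
      by (simp add: matrix_vector_mult_def vec_eq_iff sum_distrib_left mult_ac)
    also have "map_matrix of_int M ** map_matrix of_int N = (mat (of_nat d) :: complex ^ 'm ^ 'm)"
      unfolding map_matrix_of_int_mult[symmetric] MN by (simp add: mat_def vec_eq_iff)
    also have "inverse (of_nat d) *s (mat (of_nat d) *v u) = u"
      using d by (simp add: matrix_vector_mult_def mat_def vec_eq_iff if_distrib if_distribR cong: if_cong)
    finally show ?thesis .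
  qed
  have lin: "lin_form (C ** M) i u' = lin_form C i u" for i
    unfolding lin_form_matrix map_matrix_of_int_mult by (simp add: Mu' flip: matrix_vector_mul_assoc)
  have nz: "lin_form C i u \<noteq> 0" for i using u by (simp add: psi_domain_def)
  have "u' \<noteq> 0"
  proof
    assume "u' = 0"
    then have "lin_form (C ** M) i u' = 0" for i by (simp add: lin_form_def)
    then show False using lin nz by simp
  qed
  then have "u' \<in> psi_domain (C ** M)" using nz by (simp add: psi_domain_def lin)
  moreover have "psi (C ** M) u' $ k = alpha M (psi C u) $ k" for k
  proof -
    have "psi (C ** M) u' $ k = (\<Prod>i\<in>UNIV. \<Prod>j\<in>UNIV. lin_form C i u powi (C $ i $ j * M $ j $ k))"
      by (simp add: psi_def lin power_int_sum nz) (simp add: matrix_matrix_mult_def)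
    also have "\<dots> = (\<Prod>j\<in>UNIV. \<Prod>i\<in>UNIV. lin_form C i u powi (C $ i $ j * M $ j $ k))"
      by (rule prod.swap)
    also have "\<dots> = alpha M (psi C u) $ k"
      by (simp add: alpha_def monom_at_def psi_def column_def prod_power_int power_int_mult)
    finally show ?thesis .
  qed
  ultimately show ?thesis by (auto simp: vec_eq_iff)
qed

section \<open>Divisibility by the translates of \<Delta> and descent along \<alpha>_M\<close>

locale horn_cover = monomial_cover M N d + horn_hypersurface C \<Delta> k0 j
  for M N :: "int ^ 'm::finite ^ 'm" and d and C :: "int ^ 'm ^ 'n::finite" and \<Delta> k0 j +
  fixes \<Delta>1 :: "'m pfun"
  assumes irr1: "irreducible \<Delta>1" and van1: "vanishes_on_image (C ** M) \<Delta>1"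
begin

lemma scale_mult: "scale \<epsilon> (f * g) = scale \<epsilon> f * scale \<epsilon> g"
  by (rule pfun_eqI) (simp add: papply_scale)

lemma scale_inverse:
  assumes "\<epsilon> * \<eta> = 1" shows "scale \<epsilon> (scale \<eta> f) = f"
proof (rule pfun_eqI)
  fix y
  have "\<eta> * (\<epsilon> * y) = (\<epsilon> * \<eta>) * y" by (simp only: mult_ac)
  then show "papply (scale \<epsilon> (scale \<eta> f)) y = papply f y" by (simp add: papply_scale assms)
qed

lemma scale_dvd_iff:
  assumes "\<epsilon> * \<eta> = 1"
  shows "scale \<epsilon> \<Delta> dvd g \<longleftrightarrow> vanishes_on_image C (scale \<eta> g)"
proof -
  have eta: "\<eta> * \<epsilon> = 1" using assms by (simp add: mult.commute)
  have "scale \<epsilon> \<Delta> dvd g \<longleftrightarrow> \<Delta> dvd scale \<eta> g"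
  proof
    assume "scale \<epsilon> \<Delta> dvd g"
    then obtain h where "g = scale \<epsilon> \<Delta> * h" by (auto elim: dvdE)
    then have "scale \<eta> g = \<Delta> * scale \<eta> h" by (simp add: scale_mult scale_inverse[OF eta])
    then show "\<Delta> dvd scale \<eta> g" by simp
  next
    assume "\<Delta> dvd scale \<eta> g"
    then obtain h where h: "scale \<eta> g = \<Delta> * h" by (auto elim: dvdE)
    have "g = scale \<epsilon> (scale \<eta> g)" by (simp add: scale_inverse[OF assms])
    also have "\<dots> = scale \<epsilon> \<Delta> * scale \<epsilon> h" unfolding h by (rule scale_mult)
    finally show "scale \<epsilon> \<Delta> dvd g" by simp
  qed
  then show ?thesis by (simp add: vanishes_iff_dvd)
qed

text \<open>The factors are pairwise non-associated primes, because \<open>\<Delta>\<close> has trivial stabilizer.\<close>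

lemma prod_scale_dvd:
  assumes "finite E" "E \<subseteq> G_grp M" "\<And>\<epsilon>. \<epsilon> \<in> E \<Longrightarrow> scale \<epsilon> \<Delta> dvd g"
  shows "(\<Prod>\<epsilon>\<in>E. scale \<epsilon> \<Delta>) dvd g"
  using assms
proof (induction E arbitrary: g rule: finite_induct)
  case (insert \<epsilon> E)
  then obtain h where h: "g = scale \<epsilon> \<Delta> * h" by (metis dvdE insertI1)
  have "scale \<eta> \<Delta> dvd h" if \<eta>: "\<eta> \<in> E" for \<eta>
  proof -
    have \<eta>G: "\<eta> \<in> G_grp M" "\<epsilon> \<in> G_grp M" using \<eta> insert.prems by auto
    obtain \<theta> where \<theta>: "\<theta> \<in> G_grp M" "\<eta> * \<theta> = 1" using G_inverse[OF \<eta>G(1)] by blast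
    \<comment> \<open>\<open>scale \<eta> \<Delta>\<close> divides
      \<open>scale \<epsilon> \<Delta> * h\<close>. Translated by \<theta>, this says that a product
      vanishes on the image, hence that one factor does. For the first factor, \<epsilon> * \<theta>
      would stabilize \<Delta>.\<close>
    have "vanishes_on_image C (scale \<theta> (scale \<epsilon> \<Delta>) * scale \<theta> h)"
      using insert.prems(2)[of \<eta>] \<eta> h by (simp add: scale_dvd_iff[OF \<theta>(2)] scale_mult)
    then consider "vanishes_on_image C (scale \<theta> (scale \<epsilon> \<Delta>))" | "vanishes_on_image C (scale \<theta> h)"
      using vanishes_mult by blast
    then show ?thesis
    proof cases
      case 1
      have "scale \<theta> (scale \<epsilon> \<Delta>) = scale (\<epsilon> * \<theta>) \<Delta>"
        by (rule pfun_eqI) (simp add: papply_scale mult.assoc)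
      then have "\<Delta> dvd scale (\<epsilon> * \<theta>) \<Delta>" using 1 vanishes_iff_dvd by metis
      then have 1: "\<epsilon> * \<theta> = 1"
        using trivial_stabilizer[OF _ d] G_power[OF G_mult[OF \<eta>G(2) \<theta>(1)]] by blast
      have "\<epsilon> = \<epsilon> * (\<eta> * \<theta>)" by (simp add: \<theta>(2))
      also have "\<dots> = \<eta> * (\<epsilon> * \<theta>)" by (simp only: mult_ac)
      finally have "\<epsilon> = \<eta>" by (simp add: 1)
      then show ?thesis using \<eta> insert.hyps by blast
    next
      case 2
      then show ?thesis by (simp add: scale_dvd_iff[OF \<theta>(2)])
    qed
  qed
  then have "(\<Prod>\<epsilon>\<in>E. scale \<epsilon> \<Delta>) dvd h" using insert by blast
  then show ?case using insert.hyps h by (simp add: mult_dvd_mono)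
qed simp

definition P :: "'m pfun" where "P = (\<Prod>\<epsilon>\<in>G_grp M. scale \<epsilon> \<Delta>)"

lemma P_invariant:
  assumes \<eta>: "\<eta> \<in> G_grp M" shows "papply P (\<eta> * y) = papply P y"
proof -
  obtain \<theta> where \<theta>: "\<theta> \<in> G_grp M" "\<eta> * \<theta> = 1" using G_inverse[OF \<eta>] by blast
  have "papply P (\<eta> * y) = (\<Prod>\<epsilon>\<in>G_grp M. papply \<Delta> ((\<epsilon> * \<eta>) * y))"
    by (simp add: P_def papply_scale mult.assoc)
  also have "\<dots> = (\<Prod>\<epsilon>\<in>G_grp M. papply \<Delta> (\<epsilon> * y))"
  proof (rule prod.reindex_bij_witness[of _ "\<lambda>\<epsilon>. \<epsilon> * \<theta>" "\<lambda>\<epsilon>. \<epsilon> * \<eta>"])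
    fix a show "a * \<eta> * \<theta> = a" "a * \<theta> * \<eta> = a"
      using \<theta>(2) by (simp_all add: mult.assoc) (simp add: mult.commute)
  qed (auto intro: G_mult \<eta> \<theta>)
  finally show ?thesis by (simp add: P_def papply_scale)
qed

lemma P_nonzero: "P \<noteq> 0"
proof -
  have "scale \<epsilon> \<Delta> \<noteq> 0" if \<epsilon>: "\<epsilon> \<in> G_grp M" for \<epsilon>
  proof
    assume 0: "scale \<epsilon> \<Delta> = 0"
    obtain \<theta> where "\<epsilon> * \<theta> = 1" using G_inverse[OF \<epsilon>] by blast
    then have "\<Delta> = scale \<theta> (scale \<epsilon> \<Delta>)" by (simp add: scale_inverse mult.commute)
    also have "\<dots> = 0" unfolding 0 by (rule pfun_eqI) (simp add: papply_scale)
    finally show False using irr by simp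
  qed
  then show ?thesis by (simp add: P_def finite_G)
qed

text \<open>The zero lies on the image of \<psi> and comes from the factor \<epsilon> = 1. It shows
  later that the Laurent polynomial descended from P is no monomial, so that \<Delta>1 must go to
  this factor.\<close>

lemma P_zero: "\<exists>y\<in>torus. papply P y = 0"
proof -
  obtain u where u: "u \<in> psi_domain C" using L0_nonzero psi_domain_iff by (auto simp: pfun_eq_0_iff)
  have "papply \<Delta> (psi C u) = 0" using Delta_vanishes u by (simp add: vanishes_on_image_def)
  then have "papply (scale 1 \<Delta>) (psi C u) = 0" by (simp add: papply_scale)
  then have "papply P (psi C u) = 0" unfolding P_def using finite_G G_one by auto
  then show ?thesis using psi_torus[OF u] by blast
qed

theorem factorization:
  "\<exists>v\<in>column_lattice M. \<exists>c. \<forall>y\<in>torus. papply \<Delta>1 (alpha M y) = c * monom_at y v * papply P y"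
proof -
  obtain f where f: "\<forall>y\<in>torus. lev y f = papply \<Delta>1 y" using pfun_as_laurent by blast
  define F where "F = (\<Sum>w\<in>keys f. single (M *v w) (lookup f w))"
  have F: "lev y F = papply \<Delta>1 (alpha M y)" if y: "y \<in> torus" for y
  proof -
    have "lev y F = lev (alpha M y) f"
      unfolding F_def char_sum_sum char_sum_single by (simp add: char_sum_def monom_at_alpha[OF y])
    then show ?thesis using f alpha_torus[OF y] by simp
  qed
  obtain n F' where F': "\<forall>y\<in>torus. papply F' y = papply Vars y ^ n * lev y F"
    using laurent_numerator by blast
  have "scale \<epsilon> \<Delta> dvd F'" if \<epsilon>: "\<epsilon> \<in> G_grp M" for \<epsilon>
  proof -
    obtain \<theta> where \<theta>: "\<theta> \<in> G_grp M" "\<epsilon> * \<theta> = 1" using G_inverse[OF \<epsilon>] by blast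
    show ?thesis
      unfolding scale_dvd_iff[OF \<theta>(2)] vanishes_on_image_def papply_scale
    proof
      fix u assume u: "u \<in> psi_domain C"
      have t: "\<theta> * psi C u \<in> torus" using G_torus[OF \<theta>(1)] psi_torus[OF u] by (rule torus_mult)
      obtain u' where "u' \<in> psi_domain (C ** M)" "psi (C ** M) u' = alpha M (psi C u)"
        using psi_compose[OF monomial_cover_axioms u] by blast
      \<comment> \<open>\<alpha>_M is multiplicative with \<theta> in its kernel, so \<Delta>1 is
        evaluated at \<alpha>_M(\<psi>(u)), a point of the image for \<open>C ** M\<close>.\<close>
      then have "papply \<Delta>1 (alpha M (\<theta> * psi C u)) = 0"
        using van1 \<theta>(1) by (auto simp: vanishes_on_image_def alpha_mult G_alpha)
      then show "papply F' (\<theta> * psi C u) = 0" using F' t F[OF t] by simp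
    qed
  qed
  then have "P dvd F'" unfolding P_def by (intro prod_scale_dvd finite_G) auto
  then obtain Q where Q: "F' = P * Q" by (auto elim: dvdE)
  obtain g where g: "\<forall>y\<in>torus. lev y g = papply Q y" using pfun_as_laurent by blast
  obtain w0 where w0: "\<forall>z\<in>(torus :: (complex ^ 'm) set). papply Vars z ^ n = monom_at z w0" using Vars_monom by blast
  \<comment> \<open>F' is the Laurent polynomial F times the monomial \<open>Vars ^ n\<close>, of
    exponent w0 on the torus. QL takes this monomial out of the cofactor again.\<close>
  define QL where "QL = g * single (- w0) 1"
  have eq: "papply \<Delta>1 (alpha M y) = papply P y * lev y QL" if y: "y \<in> torus" for y
  proof -
    have "papply P y * papply Q y = monom_at y w0 * papply \<Delta>1 (alpha M y)"
      using F' F[OF y] w0 y Q by (metis papply_mult)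
    then show ?thesis
      using monom_at_nonzero[OF y, of w0] g y
      by (simp add: QL_def lev_mult monom_at_uminus field_simps)
  qed
  obtain PL where PL: "\<forall>y\<in>torus. lev y PL = papply P y" using pfun_as_laurent by blast
  have PL0: "PL \<noteq> 0"
  proof
    assume "PL = 0"
    then have "P = 0" using PL by (intro pfun_eqI_torus) auto
    then show False using P_nonzero by simp
  qed
  \<comment> \<open>With h the translate of QL by \<eta>, both P and P * QL = \<Delta>1 \<circ>
    \<alpha>_M are invariant, so P * (h - QL) vanishes on the torus and P cancels.\<close>
  have Qinv: "lev (\<eta> * y) QL = lev y QL" if \<eta>: "\<eta> \<in> G_grp M" and y: "y \<in> torus" for \<eta> y
  proof -
    define h where "h = (\<Sum>w\<in>keys QL. single w (lookup QL w * monom_at \<eta> w))"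
    have h: "lev y h = lev (\<eta> * y) QL" for y
      unfolding h_def char_sum_sum char_sum_single by (simp add: char_sum_def monom_at_mult mult_ac)
    have "lev y PL * lev y (h - QL) = 0" if y: "y \<in> torus" for y
    proof -
      have \<eta>y: "\<eta> * y \<in> torus" using G_torus[OF \<eta>] y by (rule torus_mult)
      have "papply P y * lev (\<eta> * y) QL = papply P y * lev y QL"
        using eq[OF y] eq[OF \<eta>y] P_invariant[OF \<eta>, of y] G_alpha[OF \<eta>] by (auto simp: alpha_mult)
      then show ?thesis using PL y by (simp add: char_sum_diff h algebra_simps)
    qed
    from laurent_no_zero_divisors[OF this] have "h = QL" using PL0 by simp
    then show ?thesis using h by simp
  qed
  have "\<exists>p. \<forall>y\<in>torus. lev y PL = lev (alpha M y) p"
    by (rule invariant_descends) (use PL P_invariant G_torus torus_mult in metis)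
  then obtain p where p: "\<And>y. y \<in> torus \<Longrightarrow> lev y PL = lev (alpha M y) p" by blast
  have "\<exists>q. \<forall>y\<in>torus. lev y QL = lev (alpha M y) q"
    by (rule invariant_descends) (rule Qinv)
  then obtain q where q: "\<And>y. y \<in> torus \<Longrightarrow> lev y QL = lev (alpha M y) q" by blast
  have pq: "papply \<Delta>1 z = lev z p * lev z q" if z: "z \<in> torus" for z
  proof -
    obtain y where "y \<in> torus" "alpha M y = z" using alpha_surj z by blast
    then show ?thesis using eq[of y] PL p q by metis
  qed
  obtain a p' where p': "\<forall>z\<in>torus. papply p' z = papply Vars z ^ a * lev z p"
    using laurent_numerator by blast
  obtain b q' where q': "\<forall>z\<in>torus. papply q' z = papply Vars z ^ b * lev z q"
    using laurent_numerator by blast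
  \<comment> \<open>Surjectivity of \<alpha>_M has given \<Delta>1 = p * q at every point of the
    torus. Without denominators this is an identity of polynomials, and the variables on the left
    can be shared out between p' and q'.\<close>
  have "Vars ^ (a + b) * \<Delta>1 = p' * q'"
    using p' q' pq by (intro pfun_eqI_torus) (simp add: power_add mult_ac)
  moreover obtain ks where "Vars ^ (a + b) = (prod_list (map Var ks) :: 'm pfun)" using Vars_power_list by blast
  ultimately obtain ks1 ks2 p'' q'' where split: "p' = prod_list (map Var ks1) * p''"
      "q' = prod_list (map Var ks2) * q''" "p'' * q'' = \<Delta>1"
    using split_monomial by metis
  have "\<not> p'' dvd 1"
  proof
    assume "p'' dvd 1"
    then obtain c where c: "c \<noteq> 0" "p'' = Cst c" using unit_pfun_const by blast
    obtain w where w: "\<forall>z\<in>torus. papply (prod_list (map Var ks1) :: 'm pfun) z = monom_at z w"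
      using prod_list_Var_monom by blast
    obtain y where y: "y \<in> torus" "papply P y = 0" using P_zero by blast
    have "lev (alpha M y) p = 0" using p[OF y(1)] PL y by simp
    then have "papply p' (alpha M y) = 0" using p' alpha_torus[OF y(1)] by simp
    then have "monom_at (alpha M y) w * c = 0" using split(1) c w alpha_torus[OF y(1)] by simp
    then show False using c monom_at_nonzero[OF alpha_torus[OF y(1), of M], of w] by simp
  qed
  then have "q'' dvd 1" using irr1 split(3) unfolding irreducible_def by metis
  then obtain c where c: "c \<noteq> 0" "q'' = Cst c" using unit_pfun_const by blast
  obtain w2 where w2: "\<forall>z\<in>torus. papply (prod_list (map Var ks2) :: 'm pfun) z = monom_at z w2"
    using prod_list_Var_monom by blast
  obtain wb where wb: "\<forall>z\<in>(torus :: (complex ^ 'm) set). papply Vars z ^ b = monom_at z wb" using Vars_monom by blast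
  have qz: "lev z q = c * monom_at z (w2 - wb)" if z: "z \<in> torus" for z
  proof -
    have "monom_at z wb * lev z q = monom_at z w2 * c"
      using q' split(2) c w2 wb z by simp
    also have "monom_at z w2 = monom_at z wb * monom_at z (w2 - wb)"
      using monom_at_add[OF z, of wb "w2 - wb"] by simp
    finally have "monom_at z wb * lev z q = monom_at z wb * (c * monom_at z (w2 - wb))"
      by (simp add: mult_ac)
    then show ?thesis using monom_at_nonzero[OF z, of wb] by simp
  qed
  \<comment> \<open>A monomial of exponent x in \<alpha>_M(y) has exponent M x in y; this places v
    in the column lattice.\<close>
  have "papply \<Delta>1 (alpha M y) = c * monom_at y (M *v (w2 - wb)) * papply P y" if y: "y \<in> torus" for y
    using eq[OF y] q[OF y] qz[OF alpha_torus[OF y]] monom_at_alpha[OF y] by simp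
  moreover have "M *v (w2 - wb) \<in> column_lattice M" by (simp add: column_lattice_eq)
  ultimately show ?thesis by blast
qed

end

section \<open>The constant factor\<close>

lemma int_poly_hom:
  "map_poly of_int (p + q) = (map_poly of_int p + map_poly of_int q :: complex poly)"
  "map_poly of_int (p * q) = (map_poly of_int p * map_poly of_int q :: complex poly)"
  "map_poly of_int (- p) = (- map_poly of_int p :: complex poly)"
  by (rule poly_eqI, simp add: coeff_map_poly coeff_mult)+

text \<open>The ring Z[\<zeta>]. For \<zeta> a primitive d-th root of unity it contains the values
  of all monomials at the elements of G_M.\<close>

definition cyc :: "complex \<Rightarrow> complex set" where
  "cyc \<zeta> = range (\<lambda>h :: int poly. poly (map_poly of_int h) \<zeta>)"

lemma cycI: "poly (map_poly of_int h) \<zeta> \<in> cyc \<zeta>"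
  by (auto simp: cyc_def)

lemma cyc_of_int: "of_int n \<in> cyc \<zeta>"
  using cycI[of "[:n:]" \<zeta>] by (simp add: map_poly_pCons)

lemma cyc_self: "\<zeta> \<in> cyc \<zeta>"
  using cycI[of "[:0, 1:]" \<zeta>] by (simp add: map_poly_pCons)

lemma subdomain_cyc: "subdomain (cyc \<zeta>)"
proof
  show "0 \<in> cyc \<zeta>" "1 \<in> cyc \<zeta>" using cyc_of_int[of 0] cyc_of_int[of 1] by simp_all
  fix a assume "a \<in> cyc \<zeta>"
  then obtain p where p: "a = poly (map_poly of_int p) \<zeta>" by (auto simp: cyc_def)
  show "- a \<in> cyc \<zeta>" using cycI[of "- p" \<zeta>] by (simp add: p int_poly_hom)
  fix b assume "b \<in> cyc \<zeta>"
  then obtain q where q: "b = poly (map_poly of_int q) \<zeta>" by (auto simp: cyc_def)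
  show "a + b \<in> cyc \<zeta>" using cycI[of "p + q" \<zeta>] by (simp add: p q int_poly_hom)
  show "a * b \<in> cyc \<zeta>" using cycI[of "p * q" \<zeta>] by (simp add: p q int_poly_hom)
qed

text \<open>Lets \<open>gauss_dichotomy\<close> run over the integers; \<omega> counts prime factors
  with multiplicity.\<close>

lemma factorial_in_int: "factorial_in (UNIV :: int set)"
proof -
  have dvd: "dvd_in UNIV a b \<longleftrightarrow> a dvd b" for a b :: int by (auto simp: dvd_in_def dvd_def)
  show ?thesis
    unfolding factorial_in_def
  proof (intro conjI allI impI)
    show "subdomain (UNIV :: int set)" by unfold_locales auto
    show "\<exists>\<omega> :: int \<Rightarrow> nat. (\<forall>a\<in>UNIV - {0}. \<forall>b\<in>UNIV - {0}. \<omega> (a * b) = \<omega> a + \<omega> b) \<and>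
        (\<forall>a\<in>UNIV - {0}. \<omega> a = 0 \<longrightarrow> dvd_in UNIV a 1)"
      by (intro exI[of _ "\<lambda>a. size (prime_factorization a)"])
        (auto simp: prime_factorization_mult dvd prime_factorization_empty_iff)
    fix p :: int assume "irreducible_in UNIV p"
    then have "irreducible p" by (auto simp: irreducible_in_def irreducible_def dvd)
    then have "prime_elem p" by (rule irreducible_imp_prime_elem)
    then show "prime_in UNIV p" unfolding prime_in_def prime_elem_def dvd by blast
  qed
qed

text \<open>A monic integer polynomial of minimal degree with root \<open>\<zeta>\<close> is irreducible.\<close>

lemma ex_integral_equation:
  fixes \<zeta> :: complex
  assumes "d > 0" "\<zeta> ^ d = 1"
  shows "\<exists>\<Phi> :: int poly. irreducible_in UNIV \<Phi> \<and> degree \<Phi> > 0 \<and> lead_coeff \<Phi> dvd 1 \<and>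
    poly (map_poly of_int \<Phi>) \<zeta> = 0"
proof -
  define ev where "ev = (\<lambda>p :: int poly. poly (map_poly of_int p) \<zeta>)"
  define X where "X = (monom 1 d - 1 :: int poly)"
  have "coeff X d = 1" using assms by (simp add: X_def)
  moreover have "degree X \<le> d" unfolding X_def by (intro degree_diff_le) (auto simp: degree_monom_le)
  ultimately have X: "degree X = d" "lead_coeff X = 1"
    using le_degree[of X d] by auto
  have "map_poly of_int X = (monom 1 d - 1 :: complex poly)"
    by (rule poly_eqI) (simp add: X_def coeff_map_poly)
  then have "ev X = 0" using assms by (simp add: ev_def poly_monom)
  then have "X \<noteq> 0 \<and> lead_coeff X dvd 1 \<and> ev X = 0" using X assms by auto
  from ex_has_least_nat[of "\<lambda>p. p \<noteq> 0 \<and> lead_coeff p dvd 1 \<and> ev p = 0", OF this, of degree]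
  obtain \<Phi> where \<Phi>: "\<Phi> \<noteq> 0" "lead_coeff \<Phi> dvd 1" "ev \<Phi> = 0"
    and min: "\<And>p. p \<noteq> 0 \<Longrightarrow> lead_coeff p dvd 1 \<Longrightarrow> ev p = 0 \<Longrightarrow> degree \<Phi> \<le> degree p" by blast
  have deg: "degree \<Phi> > 0"
  proof (rule ccontr)
    assume "\<not> ?thesis"
    then obtain c where c: "\<Phi> = [:c:]" by (metis degree_eq_zeroE gr0I)
    then show False using \<Phi> by (simp add: ev_def map_poly_pCons)
  qed
  \<comment> \<open>The factor of \<Phi> with root \<zeta> again has a unit as leading coefficient,
    so by minimality it takes up the whole degree, and the other factor is a constant unit.\<close>
  have factor: "dvd_in UNIV b 1" if ab: "\<Phi> = a * b" "ev a = 0" for a b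
  proof -
    have nz: "a \<noteq> 0" "b \<noteq> 0" using \<Phi>(1) ab(1) by auto
    have "lead_coeff a * lead_coeff b dvd 1" using \<Phi>(2) by (simp only: ab(1) lead_coeff_mult)
    then have l: "lead_coeff a dvd 1" "lead_coeff b dvd 1" by (rule dvd_mult_left, rule dvd_mult_right)
    have "degree a + degree b \<le> degree a"
      using min[OF nz(1) l(1) ab(2)] nz unfolding ab(1) by (simp add: degree_mult_eq)
    then obtain c where c: "b = [:c:]" by (metis add_le_same_cancel1 degree_eq_zeroE le_zero_eq)
    then have "c dvd 1" using l(2) by simp
    then obtain e where "1 = c * e" by (rule dvdE)
    then have "1 = b * [:e:]" using c by (simp add: one_pCons mult.commute)
    then show ?thesis unfolding dvd_in_def by blast
  qed
  have "irreducible_in UNIV \<Phi>"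
    unfolding irreducible_in_def
  proof (intro conjI ballI impI)
    show "\<not> dvd_in UNIV \<Phi> 1"
      unfolding dvd_in_def using deg unit_poly_degree by (metis less_irrefl)
    fix a b assume ab: "\<Phi> = a * b"
    then have "ev a * ev b = 0" using \<Phi>(3) by (simp add: ev_def int_poly_hom)
    then show "dvd_in UNIV a 1 \<or> dvd_in UNIV b 1"
      using factor[OF ab] factor[of b a] ab by (auto simp: mult.commute)
  qed (use \<Phi> in auto)
  then show ?thesis using \<Phi> deg by (auto simp: ev_def)
qed

text \<open>If r / p = h(\<zeta>), then g = p h - r has the root \<zeta>, so g = \<Phi> k. Were p
  not to divide r, it would not divide all coefficients of k. At the largest index i where it fails,
  coefficient i + degree \<Phi> of \<Phi> k is prime to p, since the leading coefficient of \<Phi>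
  is a unit; but it is p times a coefficient of h.\<close>

theorem cyc_rational:
  assumes "d > 0" "\<zeta> ^ d = 1" and p: "prime (p :: int)"
    and r: "of_int r / of_int p \<in> cyc \<zeta>"
  shows "p dvd r"
proof (rule ccontr)
  assume nr: "\<not> p dvd r"
  have p0: "p \<noteq> 0" using p by auto
  obtain \<Phi> :: "int poly" where \<Phi>: "irreducible_in UNIV \<Phi>" "degree \<Phi> > 0" "lead_coeff \<Phi> dvd 1"
    "poly (map_poly of_int \<Phi>) \<zeta> = 0" using ex_integral_equation[OF assms(1,2)] by blast
  obtain h :: "int poly" where h: "of_int r / of_int p = poly (map_poly of_int h) \<zeta>"
    using r by (auto simp: cyc_def)
  define g where "g = [:p:] * h + - [:r:]"
  have g0: "poly (map_poly of_int g) \<zeta> = 0"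
    unfolding g_def int_poly_hom using p0 by (simp add: map_poly_pCons flip: h)
  have pU: "polys_over (UNIV :: int set) = UNIV" by (auto simp: polys_over_def)
  from gauss_dichotomy[OF factorial_in_int, unfolded pU, OF \<Phi>(1,2) UNIV_I, of g] show False
  proof (elim disjE bexE conjE)
    \<comment> \<open>A non-zero integer s in the ideal of \<Phi> and g would be 0 by evaluation at
      \<zeta>.\<close>
    fix a b s assume s: "s \<noteq> 0" "a * \<Phi> + b * g = [:s:]"
    have "poly (map_poly of_int (a * \<Phi> + b * g)) \<zeta> = 0"
      by (simp add: int_poly_hom \<Phi> g0)
    then show False using s by (simp add: map_poly_pCons)
  next
    assume "dvd_in UNIV \<Phi> g"
    then obtain k where k: "g = \<Phi> * k" by (auto simp: dvd_in_def)
    define I where "I = {i. \<not> p dvd coeff k i}"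
    have fin: "finite I"
      unfolding I_def by (rule finite_subset[of _ "{..degree k}"]) (auto intro: le_degree)
    have "I \<noteq> {}"
    proof
      assume "I = {}"
      then have "p dvd coeff k i" for i by (auto simp: I_def)
      then have "p dvd coeff g 0" unfolding k coeff_mult by (intro dvd_sum dvd_mult) auto
      moreover have "coeff g 0 = p * coeff h 0 - r" by (simp add: g_def)
      ultimately have "p dvd p * coeff h 0 - (p * coeff h 0 - r)" by (metis dvd_diff dvd_triv_left)
      then show False using nr by simp
    qed
    define i where "i = Max I"
    have i: "\<not> p dvd coeff k i" using Max_in[OF fin \<open>I \<noteq> {}\<close>] by (auto simp: i_def I_def)
    have big: "p dvd coeff k l" if l: "l > i" for l
    proof (rule ccontr)
      assume "\<not> ?thesis"
      then have "l \<in> I" by (simp add: I_def)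
      then have "l \<le> i" unfolding i_def using fin by simp
      then show False using l by simp
    qed
    define n where "n = degree \<Phi>"
    have "coeff g (i + n) = coeff \<Phi> n * coeff k i +
        (\<Sum>l\<in>{..i + n} - {n}. coeff \<Phi> l * coeff k (i + n - l))"
      unfolding k coeff_mult by (subst sum.remove[of _ n]) auto
    moreover have "p dvd (\<Sum>l\<in>{..i + n} - {n}. coeff \<Phi> l * coeff k (i + n - l))"
    proof (rule dvd_sum)
      fix l assume l: "l \<in> {..i + n} - {n}"
      show "p dvd coeff \<Phi> l * coeff k (i + n - l)"
      proof (cases "l < n")
        case True
        then have "p dvd coeff k (i + n - l)" by (intro big) simp
        then show ?thesis by simp
      next
        case False
        then have "coeff \<Phi> l = 0" using l by (intro coeff_eq_0) (auto simp: n_def)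
        then show ?thesis by simp
      qed
    qed
    moreover have "p dvd coeff g (i + n)"
    proof -
      have "coeff g (i + n) = p * coeff h (i + n)"
        using \<Phi>(2) by (simp add: g_def n_def coeff_pCons split: nat.split)
      then show ?thesis by simp
    qed
    ultimately have "p dvd coeff \<Phi> n * coeff k i" using dvd_add_left_iff by metis
    then have "p dvd coeff \<Phi> n" using p i prime_dvd_mult_iff by blast
    then have "p dvd 1" using \<Phi>(3) n_def dvd_trans by blast
    then show False using p not_prime_unit by blast
  qed
qed

lemma root_of_unity_in_cyc:
  assumes "d > 0" "z ^ d = 1" shows "z \<in> cyc (cis (2 * pi / real d))"
proof -
  obtain k where "z = cis (2 * pi * real k / real d)"
    using Complex.bij_betw_roots_unity[OF assms(1)] assms(2) unfolding bij_betw_def by auto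
  then have "z = cis (2 * pi / real d) ^ k" by (simp add: Complex.DeMoivre mult_ac)
  then show ?thesis using subdomain.power_closed[OF subdomain_cyc cyc_self] by simp
qed

section \<open>Leading coefficients and divisibility of coefficients\<close>

lemma lookup_times:
  "lookup (p * q) x = (\<Sum>a\<in>keys p. \<Sum>b\<in>keys q.
      if a + b = x then lookup p a * lookup q b else 0)"
  for p q :: "'a::comm_monoid_add \<Rightarrow>\<^sub>0 'r::comm_ring_1"
  by (subst mult_eq_sum_single) (simp add: lookup_sum lookup_single when_def)

lemma lookup_single_times:
  "lookup (single v c * f) (v + x) = c * lookup f x"
  for f :: "'a::ab_group_add \<Rightarrow>\<^sub>0 'r::comm_ring_1"
proof (cases "c = 0")
  case False
  then have "lookup (single v c * f) (v + x) =
      (\<Sum>b\<in>keys f. if b = x then c * lookup f b else 0)"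
    unfolding lookup_times by simp
  then show ?thesis by (simp add: in_keys_iff)
qed simp

definition dot :: "int ^ 'm::finite \<Rightarrow> int ^ 'm \<Rightarrow> int" where
  "dot w x = (\<Sum>k\<in>UNIV. w $ k * x $ k)"

lemma dot_add: "dot w (x + y) = dot w x + dot w y"
  by (simp add: dot_def algebra_simps sum.distrib)

text \<open>x is the vertex exposed by the functional \<open>dot w\<close>, and \<alpha> its
  coefficient, possibly 0.\<close>

definition leading :: "int ^ 'm::finite \<Rightarrow> 'm laurent \<Rightarrow> int ^ 'm \<Rightarrow> complex \<Rightarrow> bool" where
  "leading w f x \<alpha> \<longleftrightarrow> lookup f x = \<alpha> \<and>
     (\<forall>a\<in>keys f. a \<noteq> x \<longrightarrow> dot w a < dot w x)"

text \<open>The sum of the two strict maxima is reached by the pair of x and z alone, so a single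
  product contributes to this coefficient.\<close>

lemma leading_mult:
  assumes f: "leading w f x \<alpha>" and g: "leading w g z \<beta>"
  shows "leading w (f * g) (x + z) (\<alpha> * \<beta>)"
  unfolding leading_def
proof (intro conjI ballI impI)
  have uniq: "a + b = x + z \<longleftrightarrow> a = x \<and> b = z"
    if "a \<in> keys f" "b \<in> keys g" for a b
  proof
    assume eq: "a + b = x + z"
    have "dot w a + dot w b = dot w x + dot w z" using eq by (simp flip: dot_add)
    moreover have "a \<noteq> x \<Longrightarrow> dot w a < dot w x" "b \<noteq> z \<Longrightarrow> dot w b < dot w z"
      using f g that by (auto simp: leading_def)
    ultimately have "a = x" by (cases "b = z") force+
    then show "a = x \<and> b = z" using eq by simp
  qed simp
  have "lookup (f * g) (x + z) = (\<Sum>a\<in>keys f. \<Sum>b\<in>keys g.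
      if a = x then if b = z then \<alpha> * \<beta> else 0 else 0)"
    unfolding lookup_times using f g by (intro sum.cong refl) (auto simp: uniq leading_def)
  also have "\<dots> = (\<Sum>a\<in>keys f. if a = x then \<alpha> * \<beta> else 0)"
  proof (rule sum.cong)
    fix a show "(\<Sum>b\<in>keys g. if a = x then if b = z then \<alpha> * \<beta> else 0 else 0) =
        (if a = x then \<alpha> * \<beta> else 0)"
      using g by (simp add: leading_def in_keys_iff)
  qed simp
  also have "\<dots> = \<alpha> * \<beta>" using f by (simp add: leading_def in_keys_iff)
  finally show "lookup (f * g) (x + z) = \<alpha> * \<beta>" .
next
  fix k assume "k \<in> keys (f * g)" and k: "k \<noteq> x + z"
  then obtain a b where ab: "k = a + b" "a \<in> keys f" "b \<in> keys g"
    using keys_mult[of f g] by blast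
  have "a = x \<or> dot w a < dot w x" "b = z \<or> dot w b < dot w z"
    using f g ab by (auto simp: leading_def)
  then show "dot w k < dot w (x + z)" using k ab(1) by (auto simp: dot_add)
qed

lemma leading_prod:
  assumes "finite E" "\<And>\<epsilon>. \<epsilon> \<in> E \<Longrightarrow> leading w (f \<epsilon>) x (\<alpha> \<epsilon>)"
  shows "leading w (\<Prod>\<epsilon>\<in>E. f \<epsilon>) (\<Sum>\<epsilon>\<in>E. x) (\<Prod>\<epsilon>\<in>E. \<alpha> \<epsilon>)"
  using assms
proof (induction E rule: finite_induct)
  case empty
  then show ?case by (simp add: leading_def lookup_one)
next
  case (insert \<epsilon> E)
  then have "leading w (f \<epsilon> * (\<Prod>\<epsilon>\<in>E. f \<epsilon>)) (x + (\<Sum>\<epsilon>\<in>E. x)) (\<alpha> \<epsilon> * (\<Prod>\<epsilon>\<in>E. \<alpha> \<epsilon>))"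
    by (intro leading_mult) auto
  then show ?case by (simp only: sum.insert[OF insert.hyps] prod.insert[OF insert.hyps])
qed

definition ivec :: "nat ^ 'm::finite \<Rightarrow> int ^ 'm" where
  "ivec a = (\<chi> k. int (a $ k))"

lemma ivec_inj: "ivec a = ivec b \<longleftrightarrow> a = b"
  by (auto simp: ivec_def vec_eq_iff)

lemma monom_at_ivec: "monom_at y (ivec a) = nat_monom y a"
  by (simp add: monom_at_def nat_monom_def ivec_def)

text \<open>A vector of maximal Euclidean norm is a vertex, exposed by its own inner product.\<close>

lemma ex_exposed:
  fixes S :: "(nat ^ 'm::finite) set"
  assumes "finite S" "S \<noteq> {}"
  shows "\<exists>a\<in>S. \<forall>b\<in>S. b \<noteq> a \<longrightarrow> dot (ivec a) (ivec b) < dot (ivec a) (ivec a)"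
proof -
  define q where "q = (\<lambda>a :: nat ^ 'm. dot (ivec a) (ivec a))"
  have "Max (q ` S) \<in> q ` S" using assms by (intro Max_in) auto
  then obtain a where a: "a \<in> S" "q a = Max (q ` S)" by auto
  have "dot (ivec a) (ivec b) < dot (ivec a) (ivec a)" if b: "b \<in> S" "b \<noteq> a" for b
  proof -
    have "q b \<le> q a" unfolding a(2) using assms b by (intro Max_ge) auto
    obtain k where k: "b $ k \<noteq> a $ k" using b by (auto simp: vec_eq_iff)
    \<comment> \<open>The squared distance of a and b is positive, and b is no longer than a;
      expanding the square bounds the inner product strictly.\<close>
    have "0 < (int (a $ k) - int (b $ k))\<^sup>2" using k by simp
    also have "\<dots> \<le> (\<Sum>k\<in>UNIV. (int (a $ k) - int (b $ k))\<^sup>2)" by (rule member_le_sum) auto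
    also have "\<dots> = q a - 2 * dot (ivec a) (ivec b) + q b"
      by (simp add: q_def dot_def ivec_def power2_eq_square algebra_simps sum.distrib sum_subtractf
        sum_distrib_left)
    finally show ?thesis using \<open>q b \<le> q a\<close> by (simp add: q_def)
  qed
  then show ?thesis using a by blast
qed

lemma mpoly_eval_of_int:
  "mpoly_eval Y (of_int_mpoly D) = (\<Sum>a\<in>keys D. of_int (lookup D a) * nat_monom Y a)"
proof -
  have lookup: "lookup (of_int_mpoly D) a = of_int (lookup D a)" for a
    by (simp add: of_int_mpoly_def Poly_Mapping.map.rep_eq when_def)
  have "keys (of_int_mpoly D) \<subseteq> keys D"
    by (auto simp: in_keys_iff lookup)
  then show ?thesis unfolding mpoly_eval_eq by (subst char_sum_superset[OF finite_keys]) (auto simp: lookup)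
qed

lemma lev_mpoly_eval:
  assumes "y \<in> torus"
  shows "lev y (mpoly_eval Y (of_int_mpoly D)) = mpoly_eval (\<chi> k. lev y (Y $ k)) (of_int_mpoly D)"
  by (simp add: mpoly_eval_of_int char_sum_sum lev_mult[OF assms] lev_of_int nat_monom_def
    lev_prod[OF assms] lev_power[OF assms])

lemma lev_comp_alpha:
  assumes "y \<in> torus" shows "lev y (comp_alpha D M) = mpoly_eval (alpha M y) (of_int_mpoly D)"
  unfolding comp_alpha_def lev_mpoly_eval[OF assms] by (simp add: laurent_monom_def alpha_def)

lemma lev_comp_scale:
  assumes "y \<in> torus" shows "lev y (comp_scale D \<epsilon>) = mpoly_eval (\<epsilon> * y) (of_int_mpoly D)"
proof -
  have "(\<chi> k. lev y (laurent_const (\<epsilon> $ k) * laurent_monom (axis k 1))) = \<epsilon> * y"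
    by (simp add: laurent_monom_def laurent_const_def vec_eq_iff lev_mult[OF assms] monom_at_axis)
  then show ?thesis unfolding comp_scale_def lev_mpoly_eval[OF assms] by simp
qed

lemma comp_alpha_eq:
  "comp_alpha D M = (\<Sum>a\<in>keys D.
     single (M *v ivec a) (of_int (lookup D a)))"
  by (rule lev_eqI) (simp add: lev_comp_alpha mpoly_eval_of_int char_sum_sum
    monom_at_ivec flip: monom_at_alpha)

lemma comp_scale_eq:
  "comp_scale D \<epsilon> = (\<Sum>a\<in>keys D.
     single (ivec a) (of_int (lookup D a) * nat_monom \<epsilon> a))"
  by (rule lev_eqI) (simp add: lev_comp_scale mpoly_eval_of_int char_sum_sum monom_at_ivec
    nat_monom_mult mult_ac)

lemma content_not_all_dvd:
  assumes "content D = 1" "prime (p :: int)"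
  shows "\<exists>a\<in>keys D. \<not> p dvd lookup D a"
proof (rule ccontr)
  assume "\<not> ?thesis"
  then have "p dvd content D" unfolding content_def by (intro Gcd_greatest) auto
  then show False using assms by (simp add: not_prime_unit)
qed

text \<open>For c = 1 this says that the coefficients lie in Z[\<zeta>], for c = p that f is zero
  modulo p.\<close>

definition coeffs_divisible :: "complex \<Rightarrow> complex \<Rightarrow> 'm::finite laurent \<Rightarrow> bool" where
  "coeffs_divisible \<zeta> c f \<longleftrightarrow> (\<forall>w. lookup f w / c \<in> cyc \<zeta>)"

lemma coeffs_divisible_mult:
  assumes "coeffs_divisible \<zeta> c f" "coeffs_divisible \<zeta> 1 g"
  shows "coeffs_divisible \<zeta> c (f * g)"
proof -
  interpret subdomain "cyc \<zeta>" by (rule subdomain_cyc)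
  show ?thesis
    unfolding coeffs_divisible_def lookup_times sum_divide_distrib
  proof (intro allI sum_closed)
    fix w a b
    have "lookup f a / c * (lookup g b / 1) \<in> cyc \<zeta>"
      using assms by (intro mult_closed) (auto simp: coeffs_divisible_def)
    then show "(if a + b = w then lookup f a * lookup g b else 0) / c \<in> cyc \<zeta>"
      using zero_closed by simp
  qed
qed

lemma coeffs_divisible_add:
  assumes "coeffs_divisible \<zeta> c f" "coeffs_divisible \<zeta> c g"
  shows "coeffs_divisible \<zeta> c (f + g)"
  using assms subdomain.add_closed[OF subdomain_cyc]
  by (auto simp: coeffs_divisible_def lookup_add add_divide_distrib)

lemma coeffs_divisible_one: "coeffs_divisible \<zeta> 1 1"
  using subdomain.zero_closed[OF subdomain_cyc] subdomain.one_closed[OF subdomain_cyc]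
  by (auto simp: coeffs_divisible_def lookup_one when_def)

lemma coeffs_divisible_prod:
  "(\<And>i. i \<in> I \<Longrightarrow> coeffs_divisible \<zeta> 1 (f i)) \<Longrightarrow> coeffs_divisible \<zeta> 1 (prod f I)"
  by (induction I rule: infinite_finite_induct) (auto intro: coeffs_divisible_mult coeffs_divisible_one)

text \<open>A congruence of products modulo c, with explicit error e: each replacement of
  \<open>f i + g i\<close> by \<open>f i\<close> costs a term containing \<open>g i\<close>.\<close>

lemma prod_add_divisible:
  assumes "finite I" "\<And>i. i \<in> I \<Longrightarrow> coeffs_divisible \<zeta> 1 (f i)"
    "\<And>i. i \<in> I \<Longrightarrow> coeffs_divisible \<zeta> c (g i)" "\<And>i. i \<in> I \<Longrightarrow> coeffs_divisible \<zeta> 1 (g i)"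
  shows "\<exists>e. coeffs_divisible \<zeta> c e \<and> (\<Prod>i\<in>I. f i + g i) = (\<Prod>i\<in>I. f i) + e"
  using assms
proof (induction I rule: finite_induct)
  case empty
  then show ?case
    using subdomain.zero_closed[OF subdomain_cyc] by (intro exI[of _ 0]) (simp add: coeffs_divisible_def)
next
  case (insert i I)
  then obtain e where e: "coeffs_divisible \<zeta> c e" "(\<Prod>i\<in>I. f i + g i) = (\<Prod>i\<in>I. f i) + e" by auto
  have "(\<Prod>i\<in>insert i I. f i + g i) = (\<Prod>i\<in>insert i I. f i) +
      (g i * (\<Prod>i\<in>I. f i) + e * (f i + g i))"
    using insert.hyps e(2) by (simp add: algebra_simps)
  moreover have "coeffs_divisible \<zeta> c (g i * (\<Prod>i\<in>I. f i) + e * (f i + g i))"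
    using insert e(1)
    by (intro coeffs_divisible_add coeffs_divisible_mult coeffs_divisible_prod) auto
  ultimately show ?case by blast
qed

context monomial_cover
begin

definition \<zeta> :: complex where "\<zeta> = cis (2 * pi / real d)"

lemma zeta_power: "\<zeta> ^ d = 1"
  using d by (simp add: \<zeta>_def Complex.DeMoivre)

lemma nat_monom_cyc:
  assumes "\<epsilon> \<in> G_grp M" shows "nat_monom \<epsilon> a \<in> cyc \<zeta>"
proof -
  interpret R: subdomain "cyc \<zeta>" by (rule subdomain_cyc)
  have prod: "prod f I \<in> cyc \<zeta>" if "\<And>i. f i \<in> cyc \<zeta>" for f :: "'m \<Rightarrow> complex" and I
    using that by (induction I rule: infinite_finite_induct) (auto intro: R.one_closed R.mult_closed)
  have "\<epsilon> $ k ^ d = 1" for k using G_power[OF assms] by (metis power_vec_nth one_index)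
  then have "\<epsilon> $ k \<in> cyc \<zeta>" for k unfolding \<zeta>_def using d by (intro root_of_unity_in_cyc)
  then show ?thesis unfolding nat_monom_def by (intro prod R.power_closed)
qed

text \<open>Inversion, written as the power d - 1, permutes the group. The square of the product
  therefore pairs each value with its inverse and equals 1.\<close>

lemma prod_nat_monom: "(\<Prod>\<epsilon>\<in>G_grp M. nat_monom \<epsilon> a) = 1 \<or> (\<Prod>\<epsilon>\<in>G_grp M. nat_monom \<epsilon> a) = - 1"
proof -
  let ?s = "\<Prod>\<epsilon>\<in>G_grp M. nat_monom \<epsilon> a"
  have pow: "\<epsilon> ^ n \<in> G_grp M" if "\<epsilon> \<in> G_grp M" for \<epsilon> n
    using that by (induction n) (auto intro: G_one G_mult)
  have inv: "\<epsilon> * \<epsilon> ^ (d - 1) = 1" if "\<epsilon> \<in> G_grp M" for \<epsilon>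
    using G_power[OF that] d by (simp add: power_eq_if)
  have "(\<epsilon> ^ (d - 1)) ^ (d - 1) = \<epsilon>" if \<epsilon>: "\<epsilon> \<in> G_grp M" for \<epsilon>
  proof -
    have "(\<epsilon> ^ (d - 1)) ^ (d - 1) = (\<epsilon> * \<epsilon> ^ (d - 1)) * (\<epsilon> ^ (d - 1)) ^ (d - 1)"
      by (simp only: inv[OF \<epsilon>] mult_1)
    also have "\<dots> = \<epsilon> * (\<epsilon> ^ (d - 1) * (\<epsilon> ^ (d - 1)) ^ (d - 1))" by (simp only: mult.assoc)
    also have "\<dots> = \<epsilon>" by (simp only: inv[OF pow[OF \<epsilon>]] mult_1_right)
    finally show ?thesis .
  qed
  then have "?s = (\<Prod>\<epsilon>\<in>G_grp M. nat_monom (\<epsilon> ^ (d - 1)) a)"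
    by (intro prod.reindex_bij_witness[of _ "\<lambda>\<epsilon>. \<epsilon> ^ (d - 1)" "\<lambda>\<epsilon>. \<epsilon> ^ (d - 1)"]) (auto intro: pow)
  then have "?s * ?s = (\<Prod>\<epsilon>\<in>G_grp M. nat_monom (\<epsilon> * \<epsilon> ^ (d - 1)) a)"
    by (simp add: nat_monom_mult prod.distrib)
  also have "\<dots> = 1" by (intro prod.neutral ballI) (simp only: inv nat_monom_one)
  finally have "(?s - 1) * (?s + 1) = 0" by (simp add: algebra_simps)
  then show ?thesis by (auto simp: eq_neg_iff_add_eq_0)
qed

text \<open>One exponent a is exposed for all \<epsilon> at once, and the values of its monomial
  over the group multiply to a sign. The subset S makes the lemma applicable both to all of D and to
  its terms not divisible by a prime.\<close>

lemma leading_coefficient: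
  fixes D :: "(int, 'm) mpoly"
  assumes S: "S \<subseteq> keys D" "S \<noteq> {}"
  defines "A \<equiv> \<lambda>\<epsilon>. \<Sum>a\<in>S. single (ivec a) (of_int (lookup D a) * nat_monom \<epsilon> a)"
  shows "\<exists>a\<in>S. \<exists>x. \<exists>s\<in>{1, - 1}. lookup (\<Prod>\<epsilon>\<in>G_grp M. A \<epsilon>) x =
    s * of_int (lookup D a) ^ card (G_grp M)"
proof -
  have fin: "finite S" using S(1) finite_keys by (rule finite_subset)
  obtain a where a: "a \<in> S" and ex: "\<And>b. b \<in> S \<Longrightarrow> b \<noteq> a \<Longrightarrow> dot (ivec a) (ivec b) < dot (ivec a) (ivec a)"
    using ex_exposed[OF fin S(2)] by blast
  have lookup: "lookup (A \<epsilon>) x = (\<Sum>b\<in>S. if ivec b = x then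
      of_int (lookup D b) * nat_monom \<epsilon> b else 0)" for \<epsilon> x
    unfolding A_def by (simp add: lookup_sum lookup_single when_def)
  have "leading (ivec a) (A \<epsilon>) (ivec a) (of_int (lookup D a) * nat_monom \<epsilon> a)" for \<epsilon>
    unfolding leading_def
  proof (intro conjI ballI impI)
    show "lookup (A \<epsilon>) (ivec a) = of_int (lookup D a) * nat_monom \<epsilon> a"
      unfolding lookup using a fin by (simp add: ivec_inj)
    fix x assume x: "x \<in> keys (A \<epsilon>)" "x \<noteq> ivec a"
    have "\<exists>b\<in>S. x = ivec b"
    proof (rule ccontr)
      assume "\<not> ?thesis"
      then have "lookup (A \<epsilon>) x = 0" unfolding lookup by (intro sum.neutral) auto
      then show False using x by (simp add: in_keys_iff)
    qed
    then show "dot (ivec a) x < dot (ivec a) (ivec a)" using ex x by auto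
  qed
  then have "leading (ivec a) (\<Prod>\<epsilon>\<in>G_grp M. A \<epsilon>) (\<Sum>\<epsilon>\<in>G_grp M. ivec a)
      (\<Prod>\<epsilon>\<in>G_grp M. of_int (lookup D a) * nat_monom \<epsilon> a)"
    by (intro leading_prod finite_G)
  then have "lookup (\<Prod>\<epsilon>\<in>G_grp M. A \<epsilon>) (\<Sum>\<epsilon>\<in>G_grp M. ivec a) =
      (\<Prod>\<epsilon>\<in>G_grp M. nat_monom \<epsilon> a) * of_int (lookup D a) ^ card (G_grp M)"
    by (simp add: leading_def prod.distrib mult.commute)
  then show ?thesis using a prod_nat_monom[of a] by blast
qed

text \<open>M is injective because N M = d, so distinct exponents of D stay distinct and its
  coefficients reappear unchanged.\<close>

lemma comp_alpha_integral:
  "\<exists>f :: int ^ 'm \<Rightarrow> int. (\<forall>w. lookup (comp_alpha D M) w = of_int (f w)) \<and>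
    (\<forall>a. f (M *v ivec a) = lookup D a)"
proof -
  define f where "f = (\<lambda>w. \<Sum>a\<in>keys D. if M *v ivec a = w then lookup D a else 0)"
  have inj: "M *v ivec a = M *v ivec b \<longleftrightarrow> a = b" for a b
  proof
    assume "M *v ivec a = M *v ivec b"
    then have "int d *s ivec a = int d *s ivec b" using N_M by metis
    then show "a = b" using d by (auto simp: vec_eq_iff ivec_def)
  qed simp
  have "lookup (comp_alpha D M) w = of_int (f w)" for w
    unfolding f_def comp_alpha_eq
    by (simp add: lookup_sum lookup_single when_def if_distrib cong: if_cong)
  moreover have "f (M *v ivec a) = lookup D a" for a
    by (simp add: f_def inj in_keys_iff)
  ultimately show ?thesis by blast
qed

text \<open>An exposed vertex of the support of \<open>D2\<close> shows that \<open>c\<close> is rational; the vertices of the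
  supports modulo the primes \<open>p\<close> show that \<open>p\<close> divides neither numerator nor denominator.\<close>

theorem constant_unit:
  fixes D1 D2 :: "(int, 'm) mpoly"
  assumes content: "content D1 = 1" "content D2 = 1"
    and eq: "comp_alpha D1 M = single v c * (\<Prod>\<epsilon>\<in>G_grp M. comp_scale D2 \<epsilon>)"
  shows "c = 1 \<or> c = - 1"
proof -
  interpret R: subdomain "cyc \<zeta>" by (rule subdomain_cyc)
  define P where "P = (\<Prod>\<epsilon>\<in>G_grp M. comp_scale D2 \<epsilon>)"
  obtain f :: "int ^ 'm \<Rightarrow> int" where f: "\<And>w. lookup (comp_alpha D1 M) w = of_int (f w)"
    "\<And>a. f (M *v ivec a) = lookup D1 a" using comp_alpha_integral[of D1] by blast
  have cP: "c * lookup P x = of_int (f (v + x))" for x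
    using f(1)[of "v + x"] lookup_single_times[of v c P x] by (simp add: eq P_def)
  have cP': "of_int (f w) = c * lookup P (w - v)" for w using cP[of "w - v"] by simp
  have "coeffs_divisible \<zeta> 1 P"
    unfolding P_def
  proof (rule coeffs_divisible_prod)
    fix \<epsilon> assume "\<epsilon> \<in> G_grp M"
    then show "coeffs_divisible \<zeta> 1 (comp_scale D2 \<epsilon>)"
      unfolding coeffs_divisible_def comp_scale_eq lookup_sum lookup_single sum_divide_distrib
      by (auto simp: when_def intro!: R.sum_closed R.mult_closed cyc_of_int nat_monom_cyc R.zero_closed)
  qed
  then have Pcyc: "lookup P w \<in> cyc \<zeta>" for w by (simp add: coeffs_divisible_def)
  have keys: "keys D2 \<noteq> {}" using content(2) by (auto simp: content_def)
  have "c \<noteq> 0"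
  proof
    assume "c = 0"
    then have "f w = 0" for w using cP'[of w] by simp
    then have "lookup D1 a = 0" for a by (simp flip: f(2))
    then have "D1 = 0" by (intro poly_mapping_eqI) simp
    then show False using content(1) by (simp add: content_def)
  qed
  obtain a x s where a: "a \<in> keys D2" "s \<in> {1, - 1}"
      "lookup P x = s * of_int (lookup D2 a) ^ card (G_grp M)"
    using leading_coefficient[OF subset_refl keys] unfolding P_def comp_scale_eq by blast
  define \<alpha> where "\<alpha> = lookup D2 a ^ card (G_grp M)"
  have "\<alpha> \<noteq> 0" using a by (simp add: \<alpha>_def in_keys_iff)
  have "\<exists>n m. m \<noteq> 0 \<and> c = of_int n / of_int m"
  proof -
    \<comment> \<open>The left side is a coefficient of \<open>comp_alpha D1 M\<close>, hence an
      integer; as s is a sign, c is rational.\<close>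
    have "c * (s * of_int \<alpha>) = of_int (f (v + x))" using cP[of x] a by (simp add: \<alpha>_def)
    moreover have "s * s = 1" "s \<noteq> 0" using a(2) by auto
    moreover have "s * (c * (s * of_int \<alpha>)) = (s * s) * (c * of_int \<alpha>)" by (simp only: mult_ac)
    ultimately have "c = s * of_int (f (v + x)) / of_int \<alpha>"
      using \<open>\<alpha> \<noteq> 0\<close> by (simp add: field_simps)
    moreover have "s * of_int (f (v + x)) = of_int (f (v + x)) \<or> s * of_int (f (v + x)) = of_int (- f (v + x))"
      using a(2) by auto
    ultimately show ?thesis using \<open>\<alpha> \<noteq> 0\<close> by metis
  qed
  then obtain n0 m0 :: int where nm0: "m0 \<noteq> 0" "c = of_int n0 / of_int m0" by blast
  define n where "n = n0 div gcd n0 m0"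
  define m where "m = m0 div gcd n0 m0"
  have g: "gcd n0 m0 \<noteq> 0" "n0 = n * gcd n0 m0" "m0 = m * gcd n0 m0" using nm0 by (auto simp: n_def m_def)
  have cop: "coprime n m" unfolding n_def m_def using nm0 by (intro div_gcd_coprime) auto
  have m0: "m \<noteq> 0" using g nm0 by auto
  have cnm: "c * of_int m = of_int n"
  proof -
    have "c * of_int m0 = of_int n0" using nm0 by simp
    then have "c * of_int m * of_int (gcd n0 m0) = of_int n * of_int (gcd n0 m0)"
      using g by (metis mult.assoc of_int_mult)
    then show ?thesis using nm0(1) by auto
  qed
  have n0: "n \<noteq> 0" using cnm m0 \<open>c \<noteq> 0\<close> by auto
  have rel: "of_int (m * f (v + x)) = of_int n * lookup P x" for x
  proof -
    have "of_int (m * f (v + x)) = of_int m * (c * lookup P x)" by (simp add: cP)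
    also have "\<dots> = (c * of_int m) * lookup P x" by (simp only: mult_ac)
    finally show ?thesis by (simp only: cnm)
  qed
  note cyc_dvd = cyc_rational[OF d zeta_power]
  \<comment> \<open>If p divided n, each m * f w / p would be an integer multiple of a coefficient
    of P, hence in Z[\<zeta>]. Since p does not divide m, it would divide all f w and so all
    coefficients of D1, against content 1.\<close>
  have not_dvd_n: "\<not> p dvd n" if p: "prime p" for p
  proof
    assume pn: "p dvd n"
    then obtain l where l: "n = p * l" by (auto elim: dvdE)
    have p0: "p \<noteq> 0" using p by auto
    have "\<not> p dvd m" using cop p pn by (metis coprime_common_divisor not_prime_unit)
    have "p dvd f w" for w
    proof -
      have "of_int (m * f (v + (w - v))) / of_int p = of_int l * lookup P (w - v)"
        unfolding rel using p0 by (simp add: l)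
      also have "\<dots> \<in> cyc \<zeta>" by (intro R.mult_closed cyc_of_int Pcyc)
      finally have "p dvd m * f (v + (w - v))" by (rule cyc_dvd[OF p])
      then have "p dvd f (v + (w - v))" using \<open>\<not> p dvd m\<close> prime_dvd_mult_iff[OF p] by blast
      then show ?thesis by simp
    qed
    then have "p dvd lookup D1 a" for a by (simp flip: f(2))
    then show False using content_not_all_dvd[OF content(1) p] by blast
  qed
  have not_dvd_m: "\<not> p dvd m" if p: "prime p" for p
  proof
    assume pm: "p dvd m"
    then obtain l where l: "m = p * l" by (auto elim: dvdE)
    have p0: "p \<noteq> 0" using p by auto
    have pn: "\<not> p dvd n" using cop p pm by (metis coprime_common_divisor not_prime_unit)
    \<comment> \<open>Modulo p only these terms of D2 survive, so P is congruent to the product of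
      the \<open>A \<epsilon>\<close>, which has a coefficient plus or minus \<alpha> with p not
      dividing \<alpha>. But n times any coefficient of P is m times an integer, so p | m would
      force p | n * \<alpha>.\<close>
    define S where "S = {a \<in> keys D2. \<not> p dvd lookup D2 a}"
    have S: "S \<subseteq> keys D2" "S \<noteq> {}"
      using content_not_all_dvd[OF content(2) p] by (auto simp: S_def)
    define A :: "complex ^ 'm \<Rightarrow> 'm laurent" where
      "A = (\<lambda>\<epsilon>. \<Sum>a\<in>S. single (ivec a) (of_int (lookup D2 a) * nat_monom \<epsilon> a))"
    define B :: "complex ^ 'm \<Rightarrow> 'm laurent" where
      "B = (\<lambda>\<epsilon>. \<Sum>a\<in>keys D2 - S. single (ivec a) (of_int (lookup D2 a) * nat_monom \<epsilon> a))"
    have AB: "comp_scale D2 \<epsilon> = A \<epsilon> + B \<epsilon>" for \<epsilon>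
      unfolding comp_scale_eq A_def B_def using S(1) by (subst sum.subset_diff[of S]) (auto simp: add.commute)
    have coeff: "coeffs_divisible \<zeta> 1 (\<Sum>a\<in>T. single (ivec a) (of_int (lookup D2 a) * nat_monom \<epsilon> a))"
      if "\<epsilon> \<in> G_grp M" for \<epsilon> T
      unfolding coeffs_divisible_def lookup_sum lookup_single sum_divide_distrib using that
      by (auto simp: when_def intro!: R.sum_closed R.mult_closed cyc_of_int nat_monom_cyc R.zero_closed)
    have Bp: "coeffs_divisible \<zeta> (of_int p) (B \<epsilon>)" if \<epsilon>: "\<epsilon> \<in> G_grp M" for \<epsilon>
      unfolding coeffs_divisible_def B_def lookup_sum lookup_single sum_divide_distrib
    proof (intro allI R.sum_closed)
      fix w b assume "b \<in> keys D2 - S"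
      then obtain e where e: "lookup D2 b = p * e" by (auto simp: S_def elim: dvdE)
      have "of_int (lookup D2 b) * nat_monom \<epsilon> b / of_int p = of_int e * nat_monom \<epsilon> b"
        using p0 by (simp add: e)
      also have "\<dots> \<in> cyc \<zeta>" by (intro R.mult_closed cyc_of_int nat_monom_cyc \<epsilon>)
      finally show "(of_int (lookup D2 b) * nat_monom \<epsilon> b when ivec b = w) / of_int p \<in> cyc \<zeta>"
        using R.zero_closed by (simp add: when_def)
    qed
    obtain e where e: "coeffs_divisible \<zeta> (of_int p) e" "P = (\<Prod>\<epsilon>\<in>G_grp M. A \<epsilon>) + e"
    proof -
      have "\<exists>e. coeffs_divisible \<zeta> (of_int p) e \<and> (\<Prod>\<epsilon>\<in>G_grp M. A \<epsilon> + B \<epsilon>) = (\<Prod>\<epsilon>\<in>G_grp M. A \<epsilon>) + e"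
        using Bp coeff by (intro prod_add_divisible finite_G) (auto simp: A_def B_def)
      then show ?thesis using that unfolding P_def AB by blast
    qed
    obtain a x s where a: "a \<in> S" "s \<in> {1, - 1}" "lookup (\<Prod>\<epsilon>\<in>G_grp M. A \<epsilon>) x =
        s * of_int (lookup D2 a) ^ card (G_grp M)"
      using leading_coefficient[OF S] unfolding A_def by blast
    define \<alpha> where "\<alpha> = lookup D2 a ^ card (G_grp M)"
    have "of_int n * lookup P x / of_int p = of_int (l * f (v + x))"
      unfolding rel[symmetric] using p0 by (simp add: l)
    then have "of_int n * lookup P x / of_int p \<in> cyc \<zeta>" by (simp only: cyc_of_int)
    moreover have "of_int n * (lookup e x / of_int p) \<in> cyc \<zeta>"
      using e(1) by (intro R.mult_closed cyc_of_int) (simp add: coeffs_divisible_def)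
    ultimately have "of_int n * lookup P x / of_int p - of_int n * (lookup e x / of_int p) \<in> cyc \<zeta>"
      by (rule R.diff_closed)
    also have "of_int n * lookup P x / of_int p - of_int n * (lookup e x / of_int p) =
        s * of_int (n * \<alpha>) / of_int p"
      by (simp add: e(2) lookup_add a(3) \<alpha>_def add_divide_distrib distrib_left)
    finally have s: "s * of_int (n * \<alpha>) / of_int p \<in> cyc \<zeta>" .
    have "of_int (n * \<alpha>) / of_int p \<in> cyc \<zeta>"
      using s a(2) R.uminus_closed[OF s] by auto
    then have "p dvd n * \<alpha>" by (rule cyc_dvd[OF p])
    then have "p dvd lookup D2 a"
      using p pn prime_dvd_mult_iff prime_dvd_power unfolding \<alpha>_def by blast
    then show False using a(1) by (simp add: S_def)
  qed
  have "is_unit n" using not_dvd_n prime_divisor_exists[OF n0] by blast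
  moreover have "is_unit m" using not_dvd_m prime_divisor_exists[OF m0] by blast
  ultimately have "n = 1 \<or> n = - 1" "m = 1 \<or> m = - 1" by (auto simp: zdvd1_eq abs_if split: if_splits)
  then show ?thesis using cnm by (auto simp: minus_equation_iff)
qed

end

theorem theorem3p4:
  fixes C1 C2 :: "int ^ 'm::finite ^ 'n::finite"
    and M :: "int ^ 'm ^ 'm"
    and \<Delta>1 \<Delta>2 :: "(int, 'm) mpoly"
  assumes "CARD('n) \<ge> CARD('m)"
    and "\<forall>i. row i C1 \<noteq> 0" and "\<forall>i. row i C2 \<noteq> 0"
    and "regular C1" and "regular C2"
    and "rank (map_matrix real_of_int C1) = CARD('m)"
    and "rank (map_matrix real_of_int C2) = CARD('m)"
    and "non_defective C1" and "non_defective C2"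
    and "irreducible_equation (S_var C1) \<Delta>1"
    and "irreducible_equation (S_var C2) \<Delta>2"
    and "C1 = C2 ** M"
  shows "finite (G_grp M)
    \<and> (\<forall>w. w \<in> column_lattice M \<longleftrightarrow> (\<forall>\<epsilon>\<in>G_grp M. monom_at \<epsilon> w = 1))
    \<and> (\<exists>v\<in>column_lattice M.
          comp_alpha \<Delta>1 M = laurent_monom v * (\<Prod>\<epsilon>\<in>G_grp M. comp_scale \<Delta>2 \<epsilon>)
        \<or> comp_alpha \<Delta>1 M = - (laurent_monom v * (\<Prod>\<epsilon>\<in>G_grp M. comp_scale \<Delta>2 \<epsilon>)))"
proof -
  let ?D1 = "of_int_mpoly \<Delta>1 :: (complex, 'm) mpoly" and ?D2 = "of_int_mpoly \<Delta>2 :: (complex, 'm) mpoly"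
  have "det M \<noteq> 0" using assms by (intro det_nonzero_of_rank[of C2]) simp
  then obtain N d where "d > 0" "M ** N = mat (int d)" "N ** M = mat (int d)"
    using ex_integral_inverse by blast
  then interpret monomial_cover M N d by unfold_locales
  have irr: "irreducible (pf_of ?D1)" "irreducible (pf_of ?D2)"
    using assms by (simp_all add: irreducible_equation_def irreducible_pf_of)
  have S: "S_var C1 = {y. papply (pf_of ?D1) y = 0}" "S_var C2 = {y. papply (pf_of ?D2) y = 0}"
    using assms by (auto simp: irreducible_equation_def zero_locus_def)
  have content: "content \<Delta>1 = 1" "content \<Delta>2 = 1"
    using assms by (simp_all add: irreducible_equation_def)
  \<comment> \<open>An irreducible \<Delta>2 is neither zero nor a unit, so some variable occurs in
    it.\<close>
  obtain k0 where k0: "pf_of ?D2 \<notin> Dep (- {k0})"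
    using ex_not_Dep[of "pf_of ?D2"] irr(2) unfolding irreducible_def by blast
  have "psi C1 ` psi_domain C1 \<subseteq> S_var C1"
    unfolding S_var_def zariski_closure_def by (rule hull_subset)
  then have van1: "vanishes_on_image (C2 ** M) (pf_of ?D1)"
    using S(1) \<open>C1 = C2 ** M\<close> by (auto simp: vanishes_on_image_def)
  \<comment> \<open>Any affine chart serves, so \<open>undefined\<close> is taken for
    \<open>j\<close>.\<close>
  interpret horn_cover M N d C2 "pf_of ?D2" k0 undefined "pf_of ?D1"
    using assms irr S k0 van1 by unfold_locales auto
  obtain v c where v: "v \<in> column_lattice M"
    and eq: "\<And>y. y \<in> torus \<Longrightarrow> papply (pf_of ?D1) (alpha M y) = c * monom_at y v * papply P y"
    using factorization by blast
  have "comp_alpha \<Delta>1 M = single v c * (\<Prod>\<epsilon>\<in>G_grp M. comp_scale \<Delta>2 \<epsilon>)"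
  proof (rule lev_eqI)
    fix y :: "complex ^ 'm" assume y: "y \<in> torus"
    show "lev y (comp_alpha \<Delta>1 M) = lev y (single v c * (\<Prod>\<epsilon>\<in>G_grp M. comp_scale \<Delta>2 \<epsilon>))"
      using eq[OF y] by (simp add: lev_comp_alpha[OF y] lev_mult[OF y] lev_prod[OF y]
        lev_comp_scale[OF y] P_def papply_scale)
  qed
  moreover from constant_unit[OF content this] have "c = 1 \<or> c = - 1" .
  moreover have "single v (- 1) = - (single v 1 :: 'm laurent)"
    by (simp add: single_uminus)
  ultimately have "comp_alpha \<Delta>1 M = laurent_monom v * (\<Prod>\<epsilon>\<in>G_grp M. comp_scale \<Delta>2 \<epsilon>)
      \<or> comp_alpha \<Delta>1 M = - (laurent_monom v * (\<Prod>\<epsilon>\<in>G_grp M. comp_scale \<Delta>2 \<epsilon>))"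
    by (auto simp: laurent_monom_def)
  then show ?thesis using finite_G lattice_iff v by blast
qed

end
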